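(* Let $A\in L^2_{loc}(\mathbb{R}^2;\mathbb{R}^2)$ generate a magnetic field $B=\operatorname{curl}A$ that satisfies the following flux condition: there exist $\varepsilon\in(0,1/2)$, a constant $K=K(\varepsilon)$ and a finite or infinite number $N$ of open intervals $I_j=(\alpha_j,\beta_j)$ such that $$\{r>0:\ \min_{k\in\mathbb{Z}}|k-\Phi(r)|<\varepsilon\}\subset\bigcup_{j=1}^N I_j,$$ $$\beta_{j-1}<\alpha_j<\beta_j,\qquad |I_j|\le K\,\min\{1+\alpha_j,\ \alpha_j-\beta_{j-1},\ \alpha_{j+1}-\beta_j\},\qquad j=1,\dots,N .$$ Then for any $q\in[2,\infty)$ there exists a constant $S_q>0$ such that $$\int_{\mathbb{R}^2}|(i\nabla+A)u|^2\,dx\ \ge\ S_q\Big(\int_{\mathbb{R}^2}|u(x)|^q\,(1+|x|)^{-2}\,dx\Big)^{2/q}$$ holds for all $u\in C_0^\infty(\mathbb{R}^2)$. In particular, if $|A|\in L^\infty(\mathbb{R}^2)$, then this inequality holds for all $u\in H^1(\mathbb{R}^2)$.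
   Context: $B=\operatorname{curl}A=\partial_{1}A_2-\partial_{2}A_1$. The flux of $B$ through the disc of radius $r$ centered at the origin is $\Phi(r)=\frac1{2\pi}\int_{\{|x|\le r\}}B(x)\,dx$ (so $B$ is taken to be locally integrable). In the flux condition the intervals satisfy $\alpha_j\ge 0$, and the conditions and terms involving the undefined endpoints $\beta_0$ and (if $N<\infty$) $\alpha_{N+1}$ are omitted, i.e. $\beta_0=-\infty$, $\alpha_{N+1}=+\infty$. Functions $u$ are complex-valued. *)

theory Defs
  imports "HOL-Analysis.Analysis" "HOL-Library.Extended_Nat"
begin

section \<open>Smooth functions and weak derivatives\<close>

definition partial_deriv ::
    "'n::finite \<Rightarrow> (real^'n \<Rightarrow> 'b::real_normed_vector) \<Rightarrow> real^'n \<Rightarrow> 'b" where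
  "partial_deriv k f x = frechet_derivative f (at x) (axis k 1)"

primrec C_k :: "nat \<Rightarrow> (real^'n::finite \<Rightarrow> 'b::real_normed_vector) \<Rightarrow> bool" where
  "C_k 0 f \<longleftrightarrow> continuous_on UNIV f"
| "C_k (Suc m) f \<longleftrightarrow>
    (\<forall>x. f differentiable (at x)) \<and> (\<forall>k. C_k m (partial_deriv k f))"

definition test_functions :: "(real^'n::finite \<Rightarrow> 'b::real_normed_vector) set" where
  "test_functions = {f. (\<forall>m. C_k m f) \<and> compact (closure (support_on UNIV f))}"

definition grad :: "(real^'n::finite \<Rightarrow> complex) \<Rightarrow> real^'n \<Rightarrow> complex^'n" where
  "grad u x = (\<chi> k. partial_deriv k u x)"

definition L1_loc :: "(real^'n::finite \<Rightarrow> 'b::euclidean_space) set" where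
  "L1_loc = {f. f \<in> borel_measurable lebesgue \<and>
                (\<forall>C. compact C \<longrightarrow> set_integrable lebesgue C f)}"

definition L2_loc :: "(real^'n::finite \<Rightarrow> 'b::euclidean_space) set" where
  "L2_loc = {f. f \<in> borel_measurable lebesgue \<and>
                (\<forall>C. compact C \<longrightarrow> set_integrable lebesgue C (\<lambda>x. (norm (f x))\<^sup>2))}"

definition L2 :: "(real^'n::finite \<Rightarrow> 'b::euclidean_space) set" where
  "L2 = {f. f \<in> borel_measurable lebesgue \<and> integrable lebesgue (\<lambda>x. (norm (f x))\<^sup>2)}"

definition weak_partial_deriv ::
    "'n::finite \<Rightarrow> (real^'n \<Rightarrow> complex) \<Rightarrow> (real^'n \<Rightarrow> complex) \<Rightarrow> bool" where
  "weak_partial_deriv k u g \<longleftrightarrow> u \<in> L1_loc \<and> g \<in> L1_loc \<and>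
     (\<forall>\<phi> :: real^'n \<Rightarrow> real. \<phi> \<in> test_functions \<longrightarrow>
        (LINT x|lebesgue. partial_deriv k \<phi> x *\<^sub>R u x) = - (LINT x|lebesgue. \<phi> x *\<^sub>R g x))"

text \<open>
  Functions stand for their classes modulo null sets, so the weak gradient of a Sobolev function
  is determined only almost everywhere and is carried along: the relation says that
  \<open>u \<in> H\<^sup>1\<close> and \<open>\<nabla>u = G\<close>.
\<close>

definition H1_with_gradient ::
    "(real^'n::finite \<Rightarrow> complex) \<Rightarrow> (real^'n \<Rightarrow> complex^'n) \<Rightarrow> bool" where
  "H1_with_gradient u G \<longleftrightarrow>
     u \<in> L2 \<and> G \<in> L2 \<and> (\<forall>k. weak_partial_deriv k u (\<lambda>x. G x $ k))"

definition essentially_bounded :: "(real^'n::finite \<Rightarrow> 'b::euclidean_space) \<Rightarrow> bool" where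
  "essentially_bounded f \<longleftrightarrow>
     f \<in> borel_measurable lebesgue \<and> (\<exists>M. AE x in lebesgue. norm (f x) \<le> M)"


section \<open>Magnetic fields and their flux\<close>

text \<open>
  The field is the distributional curl \<open>\<partial>\<^sub>1 A\<^sub>2 - \<partial>\<^sub>2 A\<^sub>1\<close>, which is required to be a locally
  integrable function; the separate derivatives \<open>\<partial>\<^sub>1 A\<^sub>2\<close> and \<open>\<partial>\<^sub>2 A\<^sub>1\<close> need not be functions.
\<close>

definition is_curl :: "(real^2 \<Rightarrow> real) \<Rightarrow> (real^2 \<Rightarrow> real^2) \<Rightarrow> bool" where
  "is_curl B A \<longleftrightarrow> B \<in> L1_loc \<and>
     (\<forall>\<phi> :: real^2 \<Rightarrow> real. \<phi> \<in> test_functions \<longrightarrow>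
        (LINT x|lebesgue. B x * \<phi> x) =
        - (LINT x|lebesgue. A x $ 2 * partial_deriv 1 \<phi> x - A x $ 1 * partial_deriv 2 \<phi> x))"

definition flux :: "(real^2 \<Rightarrow> real) \<Rightarrow> real \<Rightarrow> real" where
  "flux B r = 1 / (2 * pi) * (LINT x:cball 0 r|lebesgue. B x)"

text \<open>
  The intervals are indexed by \<open>1 \<le> j \<le> N\<close> with \<open>N \<le> \<infinity>\<close>. Values of \<open>\<alpha>\<close> and \<open>\<beta>\<close> outside this
  range are never used: terms with \<open>\<beta>\<^sub>0 = -\<infinity>\<close> or \<open>\<alpha>\<^sub>N\<^sub>+\<^sub>1 = \<infinity>\<close> are left out.
\<close>

definition flux_condition :: "(real^2 \<Rightarrow> real) \<Rightarrow> bool" where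
  "flux_condition B \<longleftrightarrow>
    (\<exists>\<epsilon> K :: real. \<exists>N :: enat. \<exists>\<alpha> \<beta> :: nat \<Rightarrow> real.
       0 < \<epsilon> \<and> \<epsilon> < 1/2 \<and>
       {r. 0 < r \<and> (INF k::int. \<bar>of_int k - flux B r\<bar>) < \<epsilon>}
         \<subseteq> (\<Union>j\<in>{j. 1 \<le> j \<and> enat j \<le> N}. {\<alpha> j<..<\<beta> j}) \<and>
       (\<forall>j. 1 \<le> j \<and> enat j \<le> N \<longrightarrow>
          0 \<le> \<alpha> j \<and> \<alpha> j < \<beta> j \<and> (j \<noteq> 1 \<longrightarrow> \<beta> (j - 1) < \<alpha> j) \<and>
          \<beta> j - \<alpha> j \<le> K * Min ({1 + \<alpha> j}
                              \<union> (if j = 1 then {} else {\<alpha> j - \<beta> (j - 1)})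
                              \<union> (if enat (j + 1) \<le> N then {\<alpha> (j + 1) - \<beta> j} else {}))))"


section \<open>The inequality\<close>

text \<open>The vector \<open>(i\<nabla> + A)u\<close> at a point, where \<open>G\<close> is the gradient of \<open>u\<close>.\<close>

definition magnetic_gradient ::
    "(real^2 \<Rightarrow> real^2) \<Rightarrow> (real^2 \<Rightarrow> complex) \<Rightarrow> (real^2 \<Rightarrow> complex^2) \<Rightarrow> real^2 \<Rightarrow> complex^2" where
  "magnetic_gradient A u G x = (\<chi> k. \<i> * G x $ k + of_real (A x $ k) * u x)"

text \<open>
  The Bochner integral of a non-integrable function is \<open>0\<close>, so the finiteness of both integrals
  is stated explicitly.
\<close>

definition magnetic_sobolev_inequality ::
    "(real^2 \<Rightarrow> real^2) \<Rightarrow> real \<Rightarrow> real \<Rightarrow> (real^2 \<Rightarrow> complex) \<Rightarrow> (real^2 \<Rightarrow> complex^2) \<Rightarrow> bool" where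
  "magnetic_sobolev_inequality A q S u G \<longleftrightarrow>
     integrable lebesgue (\<lambda>x. (norm (magnetic_gradient A u G x))\<^sup>2) \<and>
     integrable lebesgue (\<lambda>x. norm (u x) powr q * (1 + norm x) powr (- 2)) \<and>
     (LINT x|lebesgue. (norm (magnetic_gradient A u G x))\<^sup>2)
       \<ge> S * (LINT x|lebesgue. norm (u x) powr q * (1 + norm x) powr (- 2)) powr (2 / q)"

end

theory Submission
  imports Defs
begin

text \<open>
  Write \<open>D u = (i\<nabla> + A) u\<close> and \<open>E\<close> for the energy \<open>\<integral>|D u|\<^sup>2\<close>. The potential is invisible to the modulus of \<open>u\<close>:
  since \<open>i A u\<close> is orthogonal to \<open>u\<close>, the function \<open>|u|\<close> satisfies \<open>|\<nabla>|u|| \<le> |D u|\<close> pointwise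
  (\<open>grad_abs_le_magnetic\<close>). So the inequality follows, for continuously differentiable functions of compact support, from
  two estimates: the Hardy inequality \<open>\<integral>|u|\<^sup>2 / (1 + |x|\<^sup>2) \<le> C E\<close> (\<open>hardy_inequality\<close>), in which the magnetic field
  enters, and a weighted Sobolev inequality (\<open>weighted_sobolev\<close>) that bounds \<open>\<integral>|u|\<^sup>q / (1 + |x|\<^sup>2)\<close> by the power \<open>q/2\<close> of
  \<open>\<integral>|\<nabla>|u||\<^sup>2 + \<integral>|u|\<^sup>2 / (1 + |x|\<^sup>2)\<close>.
  
  The Hardy inequality starts on circles. A gauge transformation removes the potential from a circle at the price of a
  jump by the factor \<open>exp(-2\<pi>i \<Phi>)\<close>, where \<open>2\<pi>\<Phi>\<close> is the circulation of \<open>A\<close>. If \<open>\<Phi>\<close> keeps its distance from the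
  integers, a function that is multiplied by this factor along the circle is controlled by its derivative
  (\<open>circle_inequality\<close>). Testing the weak equation \<open>curl A = B\<close> with radial functions shows that for almost every radius
  \<open>\<Phi>\<close> is the flux of \<open>B\<close> (\<open>circulation_eq_flux\<close>). This bounds the integral of \<open>|u|\<^sup>2 / |x|\<^sup>2\<close> over all good radii.
  An interval \<open>I\<close> of bad radii is followed by an interval of good radii of length \<open>|I| / K\<close>. On each ray, integrating the
  derivative of \<open>(r\<^sup>2 - \<alpha>\<^sup>2) |u|\<^sup>2\<close> and averaging the end point over the good interval carries the bound over to \<open>I\<close>
  (\<open>radial_interval_average\<close>), with the energy in the two intervals as the error; as \<open>|I| \<le> K (1 + \<alpha>)\<close> the weight
  does not vary much, and as the pairs of intervals are disjoint the errors add up to a multiple of \<open>E\<close>.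
  
  The Sobolev inequality comes from \<open>\<parallel>f\<parallel>\<^sub>2 \<le> \<parallel>\<nabla>f\<parallel>\<^sub>1\<close> in the plane (\<open>gagliardo_nirenberg_plane\<close>), applied to
  \<open>f = |u|\<^sup>2\<^sup>m (1 + |x|\<^sup>2)\<^sup>-\<^sup>1\<^sup>/\<^sup>2\<close>. It bounds the weighted integral of \<open>|u|\<^sup>4\<^sup>m\<close> by that of \<open>|u|\<^sup>4\<^sup>m\<^sup>-\<^sup>2\<close>, and the latter is
  interpolated between the exponents \<open>2\<close> and \<open>4m\<close>. Choosing \<open>4m \<ge> q\<close> and interpolating once more gives the exponent \<open>q\<close>.
  
  If \<open>A\<close> is bounded, the energy is continuous on \<open>H\<^sup>1\<close>. A Sobolev function is approximated by mollifying and cutting off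
  (\<open>H1_approximation\<close>), and the weighted integral of \<open>|u|\<^sup>q\<close> passes to the limit by Fatou's lemma with the same constant.
\<close>

section \<open>Fubini and polar coordinates in the plane\<close>


text \<open>
  Areas and partial derivatives live on \<open>real^2\<close>, whereas Fubini's theorem and the polar map live on
  pairs; this map carries the product measure to Lebesgue measure.
\<close>
definition plane_pt :: "real \<times> real \<Rightarrow> real^2" where
  "plane_pt z = (\<chi> i. if i = 1 then fst z else snd z)"

lemma pt_nth [simp]: "plane_pt z $ 1 = fst z" "plane_pt z $ 2 = snd z"
  by (simp_all add: plane_pt_def)

lemma vec2_eqI: "x $ 1 = y $ 1 \<Longrightarrow> x $ 2 = y $ 2 \<Longrightarrow> x = (y :: 'a^2)"
  by (simp add: vec_eq_iff forall_2)

lemma pt_components [simp]: "plane_pt (x $ 1, x $ 2) = x"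
  by (rule vec2_eqI) auto

lemma norm_vec2: "norm (x :: real^2) = sqrt ((x $ 1)\<^sup>2 + (x $ 2)\<^sup>2)"
  by (simp add: norm_vec_def L2_set_def UNIV_2)

lemma continuous_on_pt: "continuous_on UNIV plane_pt"
  unfolding plane_pt_def
proof (rule continuous_on_vec_lambda)
  fix i :: 2
  show "continuous_on UNIV (\<lambda>z::real \<times> real. if i = 1 then fst z else snd z)"
    by (cases "i = 1") (auto intro!: continuous_intros)
qed

lemma borel_measurable_pt [measurable]: "plane_pt \<in> borel_measurable borel"
  using continuous_on_pt by (rule borel_measurable_continuous_onI)

lemma borel_measurable_pt_pair [measurable]: "plane_pt \<in> borel_measurable (lborel \<Otimes>\<^sub>M lborel)"
  by (simp add: lborel_prod)

lemma Basis_vec2: "(Basis :: (real^2) set) = {axis 1 1, axis 2 1}"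
  by (auto simp: Basis_vec_def UNIV_2)

text \<open>
  Both measures give every box the product of its side lengths.
\<close>
lemma lborel_eq_distr_pt: "lborel = distr (lborel \<Otimes>\<^sub>M lborel) borel plane_pt"
proof (rule lborel_eqI)
  fix l u :: "real^2"
  assume le: "\<And>b. b \<in> Basis \<Longrightarrow> l \<bullet> b \<le> u \<bullet> b"
  from le[of "axis 1 1"] le[of "axis 2 1"] have le12: "l $ 1 \<le> u $ 1" "l $ 2 \<le> u $ 2"
    by (auto simp: Basis_vec2 inner_axis)
  have vim: "plane_pt -` box l u = box (l $ 1) (u $ 1) \<times> box (l $ 2) (u $ 2)"
    by (auto simp: box_def Basis_vec2 inner_axis)
  have "emeasure (distr (lborel \<Otimes>\<^sub>M lborel) borel plane_pt) (box l u)
      = emeasure (lborel \<Otimes>\<^sub>M lborel) (box (l $ 1) (u $ 1) \<times> box (l $ 2) (u $ 2))"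
    by (simp add: emeasure_distr vim space_pair_measure)
  also have "\<dots> = emeasure lborel (box (l $ 1) (u $ 1)) * emeasure lborel (box (l $ 2) (u $ 2))"
    by (rule lborel.emeasure_pair_measure_Times) auto
  also have "\<dots> = ennreal (u $ 1 - l $ 1) * ennreal (u $ 2 - l $ 2)"
    using le12 by (simp add: box_real)
  also have "\<dots> = ennreal (\<Prod>b\<in>Basis. (u - l) \<bullet> b)"
    using le12 by (simp add: Basis_vec2 inner_axis ennreal_mult'' axis_eq_axis)
  finally show "emeasure (distr (lborel \<Otimes>\<^sub>M lborel) borel plane_pt) (box l u) = ennreal (\<Prod>b\<in>Basis. (u - l) \<bullet> b)" .
qed simp

lemma nn_integral_plane:
  assumes [measurable]: "f \<in> borel_measurable borel"
  shows "(\<integral>\<^sup>+x. f x \<partial>(lborel :: (real^2) measure)) = (\<integral>\<^sup>+a. \<integral>\<^sup>+b. f (plane_pt (a, b)) \<partial>lborel \<partial>lborel)"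
    and "(\<integral>\<^sup>+x. f x \<partial>(lborel :: (real^2) measure)) = (\<integral>\<^sup>+b. \<integral>\<^sup>+a. f (plane_pt (a, b)) \<partial>lborel \<partial>lborel)"
proof -
  have *: "(\<integral>\<^sup>+x. f x \<partial>(lborel :: (real^2) measure)) = (\<integral>\<^sup>+z. f (plane_pt z) \<partial>(lborel \<Otimes>\<^sub>M lborel))"
    by (subst lborel_eq_distr_pt) (simp add: nn_integral_distr)
  show "(\<integral>\<^sup>+x. f x \<partial>(lborel :: (real^2) measure)) = (\<integral>\<^sup>+a. \<integral>\<^sup>+b. f (plane_pt (a, b)) \<partial>lborel \<partial>lborel)"
    unfolding * by (subst lborel.nn_integral_fst [symmetric]) auto
  show "(\<integral>\<^sup>+x. f x \<partial>(lborel :: (real^2) measure)) = (\<integral>\<^sup>+b. \<integral>\<^sup>+a. f (plane_pt (a, b)) \<partial>lborel \<partial>lborel)"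
    unfolding * by (subst lborel_pair.nn_integral_snd [symmetric]) auto
qed


definition polar_pt :: "real \<times> real \<Rightarrow> real^2" where
  "polar_pt z = plane_pt (fst z * cos (snd z), fst z * sin (snd z))"

lemma pol_nth [simp]: "polar_pt (r, t) $ 1 = r * cos t" "polar_pt (r, t) $ 2 = r * sin t"
  by (simp_all add: polar_pt_def)

lemma norm_pol [simp]: "norm (polar_pt (r, t)) = \<bar>r\<bar>"
proof -
  have "(r * cos t)\<^sup>2 + (r * sin t)\<^sup>2 = r\<^sup>2 * ((sin t)\<^sup>2 + (cos t)\<^sup>2)"
    by (simp only: power_mult_distrib distrib_left add.commute)
  then show ?thesis by (simp add: norm_vec2)
qed

lemma borel_measurable_pol [measurable]: "polar_pt \<in> borel_measurable borel"
proof -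
  have "continuous_on UNIV polar_pt"
    unfolding polar_pt_def by (intro continuous_intros continuous_on_compose2 [OF continuous_on_pt]) auto
  then show ?thesis by (rule borel_measurable_continuous_onI)
qed

text \<open>
  The two factors of the area element \<open>r dr d\<theta>\<close>. With the Jacobian built into the radial factor,
  integration in polar coordinates is a plain product integral.
\<close>
definition radial_measure :: "real measure" where
  "radial_measure = density lborel (\<lambda>r. ennreal r * indicator {0<..} r)"

definition angular_measure :: "real measure" where
  "angular_measure = density lborel (indicator {0<..<2 * pi})"

lemma sets_radial_angular [measurable_cong, simp]:
  "sets radial_measure = sets borel" "sets angular_measure = sets borel"
  "space radial_measure = UNIV" "space angular_measure = UNIV"
  by (simp_all add: radial_measure_def angular_measure_def)

lemma finite_measure_angular: "finite_measure angular_measure"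
  by (rule finite_measureI) (simp add: angular_measure_def emeasure_density)

lemma sigma_finite_radial: "sigma_finite_measure radial_measure"
proof -
  have "ennreal r * indicator {0<..} r = ennreal (r * indicator {0<..} r)" for r :: real
    by (auto simp: indicator_def)
  then show ?thesis
    unfolding radial_measure_def
    by (subst sigma_finite_measure.sigma_finite_iff_density_finite[OF sigma_finite_lborel]) (auto simp: ennreal_mult_eq_top_iff indicator_def)
qed

interpretation angular: finite_measure angular_measure
  by (rule finite_measure_angular)

interpretation radial: sigma_finite_measure radial_measure
  by (rule sigma_finite_radial)

interpretation polar: pair_sigma_finite radial_measure angular_measure ..

lemma AE_radial_pos: "AE r in radial_measure. 0 < r"
  unfolding radial_measure_def by (subst AE_density) (auto simp: indicator_def)

lemma AE_angular: "AE s in angular_measure. s \<in> {0<..<2 * pi}"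
  unfolding angular_measure_def by (subst AE_density) (auto simp: indicator_def)

lemma borel_measurable_pol_pair [measurable]:
  "polar_pt \<in> borel_measurable (radial_measure \<Otimes>\<^sub>M angular_measure)"
proof -
  have "sets (radial_measure \<Otimes>\<^sub>M angular_measure) = sets (borel \<Otimes>\<^sub>M borel :: (real \<times> real) measure)"
    by (intro sets_pair_measure_cong) auto
  then show ?thesis
    by (subst measurable_cong_sets [OF _ refl]) (auto simp: borel_prod)
qed

lemma pol_vec_derivative:
  "((\<lambda>z::real^2. polar_pt (z $ 1, z $ 2)) has_derivative
     (\<lambda>h. plane_pt (cos (z $ 2) * h $ 1 - z $ 1 * sin (z $ 2) * h $ 2, sin (z $ 2) * h $ 1 + z $ 1 * cos (z $ 2) * h $ 2)))
     (at z within S)"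
proof (rule has_derivative_componentwise_within[THEN iffD2], intro ballI)
  have c: "((\<lambda>x::real^2. x $ i) has_derivative (\<lambda>x. x $ i)) (at z within S)" for i
    by (rule bounded_linear.has_derivative[OF bounded_linear_vec_nth]) (rule has_derivative_ident)
  fix b :: "real^2" assume "b \<in> Basis"
  then consider "b = axis 1 1" | "b = axis 2 1" by (auto simp: Basis_vec2)
  then show "((\<lambda>x. polar_pt (x $ 1, x $ 2) \<bullet> b) has_derivative
      (\<lambda>x. plane_pt (cos (z $ 2) * x $ 1 - z $ 1 * sin (z $ 2) * x $ 2, sin (z $ 2) * x $ 1 + z $ 1 * cos (z $ 2) * x $ 2) \<bullet> b)) (at z within S)"
  proof cases
    case 1
    show ?thesis unfolding 1 inner_axis
      by (auto intro!: derivative_eq_intros c simp: algebra_simps)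
  next
    case 2
    show ?thesis unfolding 2 inner_axis
      by (auto intro!: derivative_eq_intros c simp: algebra_simps)
  qed
qed

lemma det_pol:
  "det (matrix (\<lambda>h::real^2. plane_pt (cos (z $ 2) * h $ 1 - z $ 1 * sin (z $ 2) * h $ 2, sin (z $ 2) * h $ 1 + z $ 1 * cos (z $ 2) * h $ 2)))
    = (z::real^2) $ 1"
proof -
  have "z $ 1 * (cos (z $ 2))\<^sup>2 + z $ 1 * (sin (z $ 2))\<^sup>2 = z $ 1"
    by (metis distrib_left mult.right_neutral sin_cos_squared_add2)
  then show ?thesis
    by (simp add: det_2 matrix_def axis_def power2_eq_square algebra_simps)
qed

text \<open>
  Restricting the angle to the open interval makes the polar map a bijection onto the plane without
  a closed half-line, which is a null set.
\<close>
lemma pol_inj: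
  "inj_on (\<lambda>z::real^2. polar_pt (z $ 1, z $ 2)) {z. 0 < z $ 1 \<and> 0 < z $ 2 \<and> z $ 2 < 2 * pi}"
proof (rule inj_onI, clarsimp)
  fix x y :: "real^2"
  assume x: "0 < x $ 1" "0 < x $ 2" "x $ 2 < 2 * pi" and y: "0 < y $ 1" "0 < y $ 2" "y $ 2 < 2 * pi"
    and eq: "polar_pt (x $ 1, x $ 2) = polar_pt (y $ 1, y $ 2)"
  from arg_cong[OF eq, of norm] x y have 1: "x $ 1 = y $ 1" by simp
  with arg_cong[OF eq, of "\<lambda>v. v $ 1"] arg_cong[OF eq, of "\<lambda>v. v $ 2"] x
  have "cos (x $ 2) = cos (y $ 2)" "sin (x $ 2) = sin (y $ 2)" by auto
  then obtain n :: int where n: "x $ 2 = y $ 2 + 2 * pi * n"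
    using sin_cos_eq_iff[of "x $ 2" "y $ 2"] by auto
  have "n = 0"
  proof (rule ccontr)
    assume "n \<noteq> 0"
    then have "1 \<le> \<bar>of_int n :: real\<bar>" by linarith
    then have "2 * pi \<le> \<bar>2 * pi * n\<bar>" by (simp add: abs_mult)
    then show False using n x y by linarith
  qed
  then have "x $ 2 = y $ 2" using n by simp
  with 1 show "x = y" by (rule vec2_eqI)
qed

lemma pol_image:
  "(\<lambda>z::real^2. polar_pt (z $ 1, z $ 2)) ` {z. 0 < z $ 1 \<and> 0 < z $ 2 \<and> z $ 2 < 2 * pi} = UNIV - {x. x $ 2 = 0 \<and> 0 \<le> x $ 1}"
proof (intro equalityI subsetI)
  fix x :: "real^2" assume "x \<in> UNIV - {x. x $ 2 = 0 \<and> 0 \<le> x $ 1}"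
  then have x: "x $ 2 \<noteq> 0 \<or> x $ 1 < 0" by auto
  then have n: "norm x > 0" by auto
  have "(x $ 1 / norm x)\<^sup>2 + (x $ 2 / norm x)\<^sup>2 = ((x $ 1)\<^sup>2 + (x $ 2)\<^sup>2) / (norm x)\<^sup>2"
    by (simp add: power_divide add_divide_distrib)
  also have "\<dots> = (norm x)\<^sup>2 / (norm x)\<^sup>2" by (subst (2) norm_vec2) simp
  also have "\<dots> = 1" using n by simp
  finally obtain t where t: "0 \<le> t" "t < 2 * pi" "x $ 1 / norm x = cos t" "x $ 2 / norm x = sin t"
    by (rule sincos_total_2pi)
  have eq: "x $ 1 = norm x * cos t" "x $ 2 = norm x * sin t"
    using n t by (auto simp: field_simps)
  have "t \<noteq> 0" using x eq n by (auto simp: zero_less_mult_iff)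
  then have "plane_pt (norm x, t) \<in> {z. 0 < z $ 1 \<and> 0 < z $ 2 \<and> z $ 2 < 2 * pi}" using t n by auto
  moreover have "x = polar_pt (plane_pt (norm x, t) $ 1, plane_pt (norm x, t) $ 2)"
    by (rule vec2_eqI) (use eq in auto)
  ultimately show "x \<in> (\<lambda>z::real^2. polar_pt (z $ 1, z $ 2)) ` {z. 0 < z $ 1 \<and> 0 < z $ 2 \<and> z $ 2 < 2 * pi}"
    by (rule rev_image_eqI)
next
  fix x assume "x \<in> (\<lambda>z::real^2. polar_pt (z $ 1, z $ 2)) ` {z. 0 < z $ 1 \<and> 0 < z $ 2 \<and> z $ 2 < 2 * pi}"
  then obtain z :: "real^2" where z: "x = polar_pt (z $ 1, z $ 2)" "0 < z $ 1" "0 < z $ 2" "z $ 2 < 2 * pi" by auto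
  { assume "x $ 2 = 0" "0 \<le> x $ 1"
    then have s: "sin (z $ 2) = 0" "0 \<le> cos (z $ 2)" using z by (auto simp: zero_le_mult_iff)
    then have "z $ 2 = pi" using z sin_eq_0_pi[of "z $ 2 - pi"] by (simp add: sin_diff)
    with s have False by simp }
  then show "x \<in> UNIV - {x. x $ 2 = 0 \<and> 0 \<le> x $ 1}" by auto
qed

text \<open>
  It suffices to compare the two measures on boxes. The preimage of a box has an area-weighted
  measure that the change of variables formula evaluates as the area of its image, and the image is
  the box up to the excluded half-line.
\<close>
lemma lborel_eq_distr_pol: "lborel = distr (radial_measure \<Otimes>\<^sub>M angular_measure) borel polar_pt"
proof (rule lborel_eqI)
  fix l u :: "real^2"
  assume le: "\<And>b. b \<in> Basis \<Longrightarrow> l \<bullet> b \<le> u \<bullet> b"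
  define T where "T = {z::real^2. 0 < z $ 1 \<and> 0 < z $ 2 \<and> z $ 2 < 2 * pi}"
  define g where "g = (\<lambda>z::real^2. polar_pt (z $ 1, z $ 2))"
  define S where "S = T \<inter> g -` box l u"
  have [measurable]: "g \<in> borel_measurable borel"
    unfolding g_def
    by (rule borel_measurable_continuous_onI[OF has_derivative_continuous_on[OF pol_vec_derivative]])
  have "open T" unfolding T_def
    by (intro open_Collect_conj open_Collect_less continuous_intros)
  then have [measurable]: "T \<in> sets borel" by simp
  have S [measurable]: "S \<in> sets borel" unfolding S_def
    using measurable_sets[OF \<open>g \<in> borel_measurable borel\<close>, of "box l u"] by auto
  have "S \<in> sets lebesgue" using S by simp
  have gS: "g ` S = box l u - {x. x $ 2 = 0 \<and> 0 \<le> x $ 1}"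
  proof -
    have "g ` S = g ` T \<inter> box l u" unfolding S_def by auto
    also have "g ` T = UNIV - {x. x $ 2 = 0 \<and> 0 \<le> x $ 1}" using pol_image unfolding T_def g_def .
    finally show ?thesis by auto
  qed
  have null: "negligible {x::real^2. x $ 2 = 0 \<and> 0 \<le> x $ 1}"
    by (rule negligible_subset[OF negligible_standard_hyperplane_cart[of 2]]) auto
  have lm: "g ` S \<in> lmeasurable" unfolding gS
    by (rule lmeasurable_negligible_symdiff[OF lmeasurable_box negligible_subset[OF null]]) auto
  have me: "measure lebesgue (g ` S) = measure lebesgue (box l u)" unfolding gS
    by (rule measure_negligible_symdiff[OF _ negligible_subset[OF null]]) auto
  have inj: "inj_on g S"
    unfolding g_def by (rule inj_on_subset[OF pol_inj]) (auto simp: S_def T_def)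
  have "((\<lambda>z. \<bar>z $ 1\<bar>) has_integral measure lebesgue (g ` S)) S"
    using has_measure_differentiable_image[OF \<open>S \<in> sets lebesgue\<close> pol_vec_derivative[folded g_def] inj, THEN iffD1, OF conjI, OF lm refl]
    unfolding det_pol .
  then have eq: "(\<integral>\<^sup>+z. indicator S z * ennreal \<bar>z $ 1\<bar> \<partial>lborel) = ennreal (measure lebesgue (box l u))"
    unfolding me by (subst mult.commute, intro nn_integral_has_integral_lebesgue') auto
  have dens: "radial_measure \<Otimes>\<^sub>M angular_measure
     = density (lborel \<Otimes>\<^sub>M lborel) (\<lambda>(r, t). ennreal r * indicator {0<..} r * indicator {0<..<2 * pi} t)"
    using angular.sigma_finite_measure_axioms unfolding radial_measure_def angular_measure_def
    by (intro pair_measure_density lborel.sigma_finite_measure_axioms) auto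
  have "emeasure (distr (radial_measure \<Otimes>\<^sub>M angular_measure) borel polar_pt) (box l u)
     = (\<integral>\<^sup>+z. indicator (box l u) (polar_pt z) \<partial>(radial_measure \<Otimes>\<^sub>M angular_measure))"
    by (simp add: nn_integral_distr nn_integral_indicator[symmetric] del: nn_integral_indicator)
  also have "\<dots> = (\<integral>\<^sup>+z. (\<lambda>(r, t). ennreal r * indicator {0<..} r * indicator {0<..<2 * pi} t) z * indicator (box l u) (polar_pt z) \<partial>(lborel \<Otimes>\<^sub>M lborel))"
    unfolding dens
  proof (rule nn_integral_density)
    show "(\<lambda>(r, t). ennreal r * indicator {0<..} r * indicator {0<..<2 * pi} t) \<in> borel_measurable (lborel \<Otimes>\<^sub>M lborel)"
      by measurable
    show "(\<lambda>z. indicator (box l u) (polar_pt z) :: ennreal) \<in> borel_measurable (lborel \<Otimes>\<^sub>M lborel)"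
      by (simp add: lborel_prod)
  qed
  also have "\<dots> = (\<integral>\<^sup>+z. indicator S (plane_pt z) * ennreal \<bar>plane_pt z $ 1\<bar> \<partial>(lborel \<Otimes>\<^sub>M lborel))"
    by (intro nn_integral_cong) (auto simp: S_def T_def g_def indicator_def split: if_splits)
  also have "\<dots> = (\<integral>\<^sup>+z. indicator S z * ennreal \<bar>z $ 1\<bar> \<partial>lborel)"
    by (subst lborel_eq_distr_pt) (simp add: nn_integral_distr)
  also have "\<dots> = ennreal (measure lebesgue (box l u))" by (rule eq)
  also have "\<dots> = ennreal (\<Prod>b\<in>Basis. (u - l) \<bullet> b)"
    using le by (simp add: measure_def)
  finally show "emeasure (distr (radial_measure \<Otimes>\<^sub>M angular_measure) borel polar_pt) (box l u) = ennreal (\<Prod>b\<in>Basis. (u - l) \<bullet> b)" .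
qed simp


lemma nn_integral_polar:
  assumes [measurable]: "f \<in> borel_measurable borel"
  shows "(\<integral>\<^sup>+x. f x \<partial>(lborel :: (real^2) measure)) = (\<integral>\<^sup>+r. \<integral>\<^sup>+t. f (polar_pt (r, t)) \<partial>angular_measure \<partial>radial_measure)"
    and "(\<integral>\<^sup>+x. f x \<partial>(lborel :: (real^2) measure)) = (\<integral>\<^sup>+t. \<integral>\<^sup>+r. f (polar_pt (r, t)) \<partial>radial_measure \<partial>angular_measure)"
proof -
  have *: "(\<integral>\<^sup>+x. f x \<partial>(lborel :: (real^2) measure)) = (\<integral>\<^sup>+z. f (polar_pt z) \<partial>(radial_measure \<Otimes>\<^sub>M angular_measure))"
    by (subst lborel_eq_distr_pol) (simp add: nn_integral_distr)
  show "(\<integral>\<^sup>+x. f x \<partial>(lborel :: (real^2) measure)) = (\<integral>\<^sup>+r. \<integral>\<^sup>+t. f (polar_pt (r, t)) \<partial>angular_measure \<partial>radial_measure)"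
    unfolding * by (subst angular.nn_integral_fst [symmetric]) auto
  show "(\<integral>\<^sup>+x. f x \<partial>(lborel :: (real^2) measure)) = (\<integral>\<^sup>+t. \<integral>\<^sup>+r. f (polar_pt (r, t)) \<partial>radial_measure \<partial>angular_measure)"
    unfolding * by (subst polar.nn_integral_snd [symmetric]) auto
qed

section \<open>Density of compactly supported continuous functions\<close>


lemma abs_add_power_le: "\<bar>a + b :: real\<bar> ^ p \<le> 2 ^ p * (\<bar>a\<bar> ^ p + \<bar>b\<bar> ^ p)"
proof -
  have "\<bar>a + b\<bar> ^ p \<le> (2 * max \<bar>a\<bar> \<bar>b\<bar>) ^ p" by (intro power_mono) auto
  also have "\<dots> \<le> 2 ^ p * (\<bar>a\<bar> ^ p + \<bar>b\<bar> ^ p)"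
    by (auto simp: power_mult_distrib max_def)
  finally show ?thesis .
qed

text \<open>
  Approximation in \<open>L\<^sup>p\<close> by continuous functions of bounded support. It is needed for \<open>p = 1\<close> on the
  line (to regularise the potential on a circle) and for \<open>p = 2\<close> in the plane (for mollification).
\<close>
definition Cc_approximable :: "nat \<Rightarrow> ('a::euclidean_space \<Rightarrow> real) \<Rightarrow> bool" where
  "Cc_approximable p f \<longleftrightarrow> (\<forall>e>0::real. \<exists>c. continuous_on UNIV c \<and> bounded {x. c x \<noteq> 0} \<and>
      (\<integral>\<^sup>+x. ennreal (\<bar>f x - c x\<bar> ^ p) \<partial>lborel) \<le> ennreal e)"

lemma nn_integral_diff_power_le:
  fixes f g h :: "'a::euclidean_space \<Rightarrow> real"
  assumes [measurable]: "f \<in> borel_measurable borel" "g \<in> borel_measurable borel" "h \<in> borel_measurable borel"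
    and "(\<integral>\<^sup>+x. ennreal (\<bar>f x - g x\<bar> ^ p) \<partial>lborel) \<le> ennreal d"
    and "(\<integral>\<^sup>+x. ennreal (\<bar>g x - h x\<bar> ^ p) \<partial>lborel) \<le> ennreal e" and "0 \<le> d" "0 \<le> e"
  shows "(\<integral>\<^sup>+x. ennreal (\<bar>f x - h x\<bar> ^ p) \<partial>lborel) \<le> ennreal (2 ^ p * (d + e))"
proof -
  have "(\<integral>\<^sup>+x. ennreal (\<bar>f x - h x\<bar> ^ p) \<partial>lborel)
      \<le> (\<integral>\<^sup>+x. ennreal (2 ^ p) * (ennreal (\<bar>f x - g x\<bar> ^ p) + ennreal (\<bar>g x - h x\<bar> ^ p)) \<partial>lborel)"
  proof (intro nn_integral_mono)
    fix x
    show "ennreal (\<bar>f x - h x\<bar> ^ p) \<le> ennreal (2 ^ p) * (ennreal (\<bar>f x - g x\<bar> ^ p) + ennreal (\<bar>g x - h x\<bar> ^ p))"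
      using abs_add_power_le[of "f x - g x" "g x - h x" p]
      by (auto simp: ennreal_plus[symmetric] ennreal_mult'[symmetric] simp del: ennreal_plus intro!: ennreal_leI)
  qed
  also have "\<dots> = ennreal (2 ^ p) * ((\<integral>\<^sup>+x. ennreal (\<bar>f x - g x\<bar> ^ p) \<partial>lborel) + (\<integral>\<^sup>+x. ennreal (\<bar>g x - h x\<bar> ^ p) \<partial>lborel))"
    by (subst nn_integral_cmult, measurable) (simp add: nn_integral_add)
  also have "\<dots> \<le> ennreal (2 ^ p) * (ennreal d + ennreal e)"
    using assms by (intro mult_left_mono add_mono) auto
  also have "\<dots> = ennreal (2 ^ p * (d + e))"
    using assms by (simp add: ennreal_mult')
  finally show ?thesis .
qed

lemma Cc_approximable_limit:
  fixes f :: "'a::euclidean_space \<Rightarrow> real"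
  assumes f [measurable]: "f \<in> borel_measurable borel"
    and lim: "\<And>e. 0 < e \<Longrightarrow> \<exists>g. g \<in> borel_measurable borel \<and> Cc_approximable p g \<and>
           (\<integral>\<^sup>+x. ennreal (\<bar>f x - g x\<bar> ^ p) \<partial>lborel) \<le> ennreal e"
  shows "Cc_approximable p f"
  unfolding Cc_approximable_def
proof (intro allI impI)
  fix e :: real assume "0 < e"
  define d where "d = e / (2 * 2 ^ p)"
  have d: "0 < d" "2 ^ p * (d + d) = e" using \<open>0 < e\<close> by (auto simp: d_def)
  obtain g where g: "g \<in> borel_measurable borel" "Cc_approximable p g"
      "(\<integral>\<^sup>+x. ennreal (\<bar>f x - g x\<bar> ^ p) \<partial>lborel) \<le> ennreal d"
    using lim[OF d(1)] by auto
  obtain c where c: "continuous_on UNIV c" "bounded {x. c x \<noteq> 0}"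
      "(\<integral>\<^sup>+x. ennreal (\<bar>g x - c x\<bar> ^ p) \<partial>lborel) \<le> ennreal d"
    using g(2) d(1) unfolding Cc_approximable_def by meson
  have "c \<in> borel_measurable borel" using c(1) by (rule borel_measurable_continuous_onI)
  from nn_integral_diff_power_le[OF f g(1) this g(3) c(3)] d
  show "\<exists>c. continuous_on UNIV c \<and> bounded {x. c x \<noteq> 0} \<and>
      (\<integral>\<^sup>+x. ennreal (\<bar>f x - c x\<bar> ^ p) \<partial>lborel) \<le> ennreal e"
    using c by (intro exI[of _ c]) auto
qed

lemma Cc_approximable_lincomb:
  fixes f g :: "'a::euclidean_space \<Rightarrow> real"
  assumes f [measurable]: "f \<in> borel_measurable borel" and g [measurable]: "g \<in> borel_measurable borel"
    and af: "Cc_approximable p f" and ag: "Cc_approximable p g"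
  shows "Cc_approximable p (\<lambda>x. a * f x + b * g x)"
  unfolding Cc_approximable_def
proof (intro allI impI)
  fix e :: real assume "0 < e"
  define M where "M = 1 + \<bar>a\<bar> ^ p + \<bar>b\<bar> ^ p"
  have M: "1 \<le> M" "\<bar>a\<bar> ^ p \<le> M" "\<bar>b\<bar> ^ p \<le> M" by (auto simp: M_def)
  define d where "d = e / (2 ^ p * (2 * M))"
  have d: "0 < d" "2 ^ p * (M * d + M * d) = e" using \<open>0 < e\<close> M by (auto simp: d_def field_simps)
  obtain c where c: "continuous_on UNIV c" "bounded {x. c x \<noteq> 0}"
      "(\<integral>\<^sup>+x. ennreal (\<bar>f x - c x\<bar> ^ p) \<partial>lborel) \<le> ennreal d"
    using af d(1) unfolding Cc_approximable_def by meson
  obtain c' where c': "continuous_on UNIV c'" "bounded {x. c' x \<noteq> 0}"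
      "(\<integral>\<^sup>+x. ennreal (\<bar>g x - c' x\<bar> ^ p) \<partial>lborel) \<le> ennreal d"
    using ag d(1) unfolding Cc_approximable_def by meson
  have cm [measurable]: "c \<in> borel_measurable borel" "c' \<in> borel_measurable borel"
    using c(1) c'(1) by (auto intro: borel_measurable_continuous_onI)
  have scale: "(\<integral>\<^sup>+x. ennreal (\<bar>k * u x\<bar> ^ p) \<partial>lborel) \<le> ennreal (M * d)"
    if "\<bar>k\<bar> ^ p \<le> M" "(\<integral>\<^sup>+x. ennreal (\<bar>u x\<bar> ^ p) \<partial>lborel) \<le> ennreal d" "u \<in> borel_measurable borel"
    for k and u :: "'a \<Rightarrow> real"
  proof -
    have "(\<integral>\<^sup>+x. ennreal (\<bar>k * u x\<bar> ^ p) \<partial>lborel) = ennreal (\<bar>k\<bar> ^ p) * (\<integral>\<^sup>+x. ennreal (\<bar>u x\<bar> ^ p) \<partial>lborel)"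
      using that(3) by (subst nn_integral_cmult[symmetric]) (auto simp: abs_mult power_mult_distrib ennreal_mult')
    also have "\<dots> \<le> ennreal M * ennreal d" using that by (intro mult_mono ennreal_leI) auto
    also have "\<dots> = ennreal (M * d)" using M d by (simp add: ennreal_mult)
    finally show ?thesis .
  qed
  have 1: "(\<integral>\<^sup>+x. ennreal (\<bar>(a * f x + b * g x) - (a * c x + b * g x)\<bar> ^ p) \<partial>lborel) \<le> ennreal (M * d)"
    using scale[OF M(2) c(3)] by (simp add: right_diff_distrib)
  have 2: "(\<integral>\<^sup>+x. ennreal (\<bar>(a * c x + b * g x) - (a * c x + b * c' x)\<bar> ^ p) \<partial>lborel) \<le> ennreal (M * d)"
    using scale[OF M(3) c'(3)] by (simp add: right_diff_distrib)
  have 3: "(\<integral>\<^sup>+x. ennreal (\<bar>(a * f x + b * g x) - (a * c x + b * c' x)\<bar> ^ p) \<partial>lborel) \<le> ennreal (2 ^ p * (M * d + M * d))"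
    by (rule nn_integral_diff_power_le[OF _ _ _ 1 2]) (use M d in auto)
  have "bounded {x. a * c x + b * c' x \<noteq> 0}"
    by (rule bounded_subset[of "{x. c x \<noteq> 0} \<union> {x. c' x \<noteq> 0}"]) (use c c' in auto)
  then show "\<exists>c. continuous_on UNIV c \<and> bounded {x. c x \<noteq> 0} \<and>
      (\<integral>\<^sup>+x. ennreal (\<bar>(a * f x + b * g x) - c x\<bar> ^ p) \<partial>lborel) \<le> ennreal e"
    using 3 c c' d by (intro exI[of _ "\<lambda>x. a * c x + b * c' x"]) (auto intro!: continuous_intros)
qed

text \<open>
  A Borel set lies between a closed set and an open set whose difference is small, and Urysohn's lemma
  gives a continuous function that is \<open>1\<close> on the former and \<open>0\<close> off the latter.
\<close>
lemma Cc_approximable_bounded_indicator: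
  fixes A :: "'a::euclidean_space set"
  assumes A [measurable]: "A \<in> sets borel" and bd: "A \<subseteq> ball 0 R" and "0 < p"
  shows "Cc_approximable p (indicator A)"
  unfolding Cc_approximable_def
proof (intro allI impI)
  fix e :: real assume "0 < e"
  then have e2: "0 < e / 2" by simp
  have Al: "A \<in> sets lebesgue" using A by simp
  obtain U where U: "open U" "A \<subseteq> U" "emeasure lebesgue (U - A) < ennreal (e / 2)"
    using sets_lebesgue_outer_open[OF Al e2] by metis
  obtain K where K: "closed K" "K \<subseteq> A" "emeasure lebesgue (A - K) < ennreal (e / 2)"
    using sets_lebesgue_inner_closed[OF Al e2] by metis
  define V where "V = U \<inter> ball 0 R"
  have V: "open V" "A \<subseteq> V" "V \<subseteq> U" "bounded V" using U bd by (auto simp: V_def intro: bounded_subset)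
  obtain c :: "'a \<Rightarrow> real" where c: "continuous_on UNIV c" "\<And>x. c x \<in> closed_segment 1 0"
      "\<And>x. x \<in> K \<Longrightarrow> c x = 1" "\<And>x. x \<in> - V \<Longrightarrow> c x = 0"
    using Urysohn[of K "- V" "1::real" 0] K V by (metis Compl_disjoint Diff_eq closed_Compl disjoint_eq_subset_Compl double_complement subset_trans)
  have c01: "0 \<le> c x" "c x \<le> 1" for x using c(2)[of x] by (auto simp: closed_segment_eq_real_ivl)
  have meas: "U - A \<in> sets lborel" "A - K \<in> sets lborel" using U(1) K(1) by auto
  have "ennreal (\<bar>indicator A x - c x\<bar> ^ p) \<le> indicator (U - A) x + indicator (A - K) x" for x
  proof (cases "x \<in> U - K")
    case True
    have "\<bar>indicator A x - c x\<bar> ^ p \<le> 1"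
      using c01[of x] by (intro power_le_one) (auto simp: indicator_def)
    then have "ennreal (\<bar>indicator A x - c x\<bar> ^ p) \<le> 1"
      by (metis ennreal_1 ennreal_leI)
    then show ?thesis using True U K by (auto simp: indicator_def)
  next
    case False
    then have "indicator A x - c x = 0" using c(3,4)[of x] K V U by (auto simp: indicator_def)
    then show ?thesis using \<open>0 < p\<close> by (simp add: zero_power)
  qed
  then have "(\<integral>\<^sup>+x. ennreal (\<bar>indicator A x - c x\<bar> ^ p) \<partial>lborel) \<le> (\<integral>\<^sup>+x. indicator (U - A) x + indicator (A - K) x \<partial>lborel)"
    by (intro nn_integral_mono) auto
  also have "\<dots> = emeasure lborel (U - A) + emeasure lborel (A - K)"
    using meas by (subst nn_integral_add) auto
  also have "\<dots> \<le> ennreal (e / 2) + ennreal (e / 2)"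
    using U(3) K(3) meas by (intro add_mono) (auto simp: less_imp_le)
  also have "\<dots> = ennreal e" using e2 by (subst ennreal_plus[symmetric]) auto
  finally have *: "(\<integral>\<^sup>+x. ennreal (\<bar>indicator A x - c x\<bar> ^ p) \<partial>lborel) \<le> ennreal e" .
  have "{x. c x \<noteq> 0} \<subseteq> V" using c(4) by auto
  then have "bounded {x. c x \<noteq> 0}" using V(4) bounded_subset by blast
  with * c(1) show "\<exists>c. continuous_on UNIV c \<and> bounded {x. c x \<noteq> 0} \<and>
      (\<integral>\<^sup>+x. ennreal (\<bar>indicator A x - c x\<bar> ^ p) \<partial>lborel) \<le> ennreal e" by blast
qed

lemma Cc_approximable_dominated:
  fixes f :: "'a::euclidean_space \<Rightarrow> real"
  assumes f [measurable]: "f \<in> borel_measurable borel" and fin: "(\<integral>\<^sup>+x. ennreal (\<bar>f x\<bar> ^ p) \<partial>lborel) < \<infinity>"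
    and "0 < p" and g [measurable]: "\<And>i::nat. g i \<in> borel_measurable borel" and ap: "\<And>i. Cc_approximable p (g i)"
    and le: "\<And>i x. \<bar>g i x\<bar> \<le> \<bar>f x\<bar>" and lim: "\<And>x. (\<lambda>i. g i x) \<longlonglongrightarrow> f x"
  shows "Cc_approximable p f"
proof (rule Cc_approximable_limit[OF f])
  fix e :: real assume "0 < e"
  have "(\<lambda>i. \<integral>\<^sup>+x. ennreal (\<bar>f x - g i x\<bar> ^ p) \<partial>lborel) \<longlonglongrightarrow> (\<integral>\<^sup>+x. ennreal 0 \<partial>(lborel::'a measure))"
  proof (rule nn_integral_dominated_convergence[where w = "\<lambda>x. ennreal (2 ^ p) * ennreal (\<bar>f x\<bar> ^ p)"])
    have "\<bar>f x - g j x\<bar> ^ p \<le> (2 * \<bar>f x\<bar>) ^ p" for j x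
      using le[of j x] by (intro power_mono) auto
    then show "AE x in lborel. ennreal (\<bar>f x - g j x\<bar> ^ p) \<le> ennreal (2 ^ p) * ennreal (\<bar>f x\<bar> ^ p)" for j
      by (intro AE_I2) (auto simp: ennreal_mult'[symmetric] power_mult_distrib intro!: ennreal_leI)
    show "(\<integral>\<^sup>+x. ennreal (2 ^ p) * ennreal (\<bar>f x\<bar> ^ p) \<partial>lborel) < \<infinity>"
      using fin by (subst nn_integral_cmult) (auto simp: ennreal_mult_less_top)
    have "(\<lambda>i. \<bar>f x - g i x\<bar> ^ p) \<longlonglongrightarrow> \<bar>f x - f x\<bar> ^ p" for x
      by (intro tendsto_intros lim)
    then show "AE x in lborel. (\<lambda>i. ennreal (\<bar>f x - g i x\<bar> ^ p)) \<longlonglongrightarrow> ennreal 0"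
      using \<open>0 < p\<close> by (intro AE_I2 tendsto_ennrealI) (auto simp: zero_power)
  qed auto
  then have "\<forall>\<^sub>F i in sequentially. (\<integral>\<^sup>+x. ennreal (\<bar>f x - g i x\<bar> ^ p) \<partial>lborel) < ennreal e"
    using \<open>0 < e\<close> by (intro order_tendstoD(2)) auto
  then obtain i where "(\<integral>\<^sup>+x. ennreal (\<bar>f x - g i x\<bar> ^ p) \<partial>lborel) < ennreal e"
    by (auto simp: eventually_sequentially)
  then show "\<exists>g. g \<in> borel_measurable borel \<and> Cc_approximable p g \<and>
           (\<integral>\<^sup>+x. ennreal (\<bar>f x - g x\<bar> ^ p) \<partial>lborel) \<le> ennreal e"
    using ap by (intro exI[of _ "g i"]) auto
qed

lemma Cc_approximable_nonneg:
  fixes f :: "'a::euclidean_space \<Rightarrow> real"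
  assumes "f \<in> borel_measurable borel" "\<And>x. 0 \<le> f x" "(\<integral>\<^sup>+x. ennreal (\<bar>f x\<bar> ^ p) \<partial>lborel) < \<infinity>" "0 < p"
  shows "Cc_approximable p f"
  using assms(1-3)
proof (induction rule: borel_measurable_induct_real)
  case (set A)
  show ?case
  proof (rule Cc_approximable_dominated[OF _ set(2) assms(4)])
    have [measurable]: "A \<in> sets borel" using set by simp
    show "indicat_real A \<in> borel_measurable borel" by simp
    show "indicat_real (A \<inter> ball 0 (real i)) \<in> borel_measurable borel" for i
      by (intro borel_measurable_indicator sets.Int) auto
    show "Cc_approximable p (indicat_real (A \<inter> ball 0 (real i)))" for i
      by (rule Cc_approximable_bounded_indicator[OF _ _ assms(4), where R = "real i"]) auto
    show "\<bar>indicat_real (A \<inter> ball 0 (real i)) x\<bar> \<le> \<bar>indicat_real A x\<bar>" for i x by (auto simp: indicator_def)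
    fix x :: 'a
    obtain n :: nat where n: "norm x < real n" using reals_Archimedean2 by blast
    have "\<forall>\<^sub>F i in sequentially. indicat_real (A \<inter> ball 0 (real i)) x = indicat_real A x"
      using n by (intro eventually_sequentiallyI[of n]) (auto simp: indicator_def)
    then show "(\<lambda>i. indicat_real (A \<inter> ball 0 (real i)) x) \<longlonglongrightarrow> indicat_real A x"
      by (rule tendsto_eventually)
  qed
next
  case (mult u c)
  show ?case
  proof (cases "c = 0")
    case True
    then show ?thesis using \<open>0 < p\<close>
      unfolding Cc_approximable_def by (intro allI impI exI[of _ "\<lambda>_. 0"]) (auto simp: zero_power)
  next
    case False
    then have c: "0 < c" using mult by auto
    have [measurable]: "u \<in> borel_measurable borel" using mult by auto
    have "(\<integral>\<^sup>+x. ennreal (\<bar>c * u x\<bar> ^ p) \<partial>lborel) = ennreal (c ^ p) * (\<integral>\<^sup>+x. ennreal (\<bar>u x\<bar> ^ p) \<partial>lborel)"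
      using c by (subst nn_integral_cmult[symmetric]) (auto simp: abs_mult power_mult_distrib ennreal_mult')
    then have "(\<integral>\<^sup>+x. ennreal (\<bar>u x\<bar> ^ p) \<partial>lborel) < \<infinity>"
      using mult(5) c by (auto simp: ennreal_mult_less_top)
    then have "Cc_approximable p u" by (rule mult.IH)
    from Cc_approximable_lincomb[OF _ _ this this, of c 0] mult show ?thesis by auto
  qed
next
  case (add u v)
  have [measurable]: "u \<in> borel_measurable borel" "v \<in> borel_measurable borel" using add by auto
  have "(\<integral>\<^sup>+x. ennreal (\<bar>u x\<bar> ^ p) \<partial>lborel) \<le> (\<integral>\<^sup>+x. ennreal (\<bar>v x + u x\<bar> ^ p) \<partial>lborel)"
       "(\<integral>\<^sup>+x. ennreal (\<bar>v x\<bar> ^ p) \<partial>lborel) \<le> (\<integral>\<^sup>+x. ennreal (\<bar>v x + u x\<bar> ^ p) \<partial>lborel)"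
    using add(2,4) by (auto intro!: nn_integral_mono ennreal_leI power_mono)
  then have "Cc_approximable p u" "Cc_approximable p v"
    using add by (auto intro: le_less_trans)
  from Cc_approximable_lincomb[OF _ _ this, of 1 1] show ?case by (simp add: add.commute)
next
  case (seq U)
  have lim: "(\<lambda>i. U i x) \<longlonglongrightarrow> f x" for x using seq.hyps by auto
  have le: "U i x \<le> f x" for i x
    using \<open>incseq U\<close> lim[of x] by (intro incseq_le) (auto simp: incseq_def le_fun_def)
  have [measurable]: "U i \<in> borel_measurable borel" for i using seq.hyps by auto
  show ?case
  proof (rule Cc_approximable_dominated[OF assms(1,3,4), where g = U])
    fix i
    have "(\<integral>\<^sup>+x. ennreal (\<bar>U i x\<bar> ^ p) \<partial>lborel) \<le> (\<integral>\<^sup>+x. ennreal (\<bar>f x\<bar> ^ p) \<partial>lborel)"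
      using le seq.hyps(2) assms(2) by (auto intro!: nn_integral_mono ennreal_leI power_mono)
    then show "Cc_approximable p (U i)" using seq.IH[of i] assms(3) by (auto intro: le_less_trans)
    show "\<bar>U i x\<bar> \<le> \<bar>f x\<bar>" for x using le[of i x] seq.hyps(2)[of i x] by auto
  qed (use lim in auto)
qed

text \<open>
  The approximable functions contain the indicators and are closed under linear combinations and
  dominated limits, hence contain every function with finite \<open>L\<^sup>p\<close> norm.
\<close>
lemma Cc_dense_Lp:
  fixes f :: "'a::euclidean_space \<Rightarrow> real"
  assumes [measurable]: "f \<in> borel_measurable borel" and fin: "(\<integral>\<^sup>+x. ennreal (\<bar>f x\<bar> ^ p) \<partial>lborel) < \<infinity>" and p: "0 < p"
  shows "Cc_approximable p f"
proof -
  have "(\<integral>\<^sup>+x. ennreal (\<bar>max 0 (f x)\<bar> ^ p) \<partial>lborel) \<le> (\<integral>\<^sup>+x. ennreal (\<bar>f x\<bar> ^ p) \<partial>lborel)"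
       "(\<integral>\<^sup>+x. ennreal (\<bar>max 0 (- f x)\<bar> ^ p) \<partial>lborel) \<le> (\<integral>\<^sup>+x. ennreal (\<bar>f x\<bar> ^ p) \<partial>lborel)"
    by (auto intro!: nn_integral_mono ennreal_leI power_mono)
  then have "Cc_approximable p (\<lambda>x. max 0 (f x))" "Cc_approximable p (\<lambda>x. max 0 (- f x))"
    using fin p by (auto intro!: Cc_approximable_nonneg intro: le_less_trans)
  from Cc_approximable_lincomb[OF _ _ this, of 1 "-1"]
  have "Cc_approximable p (\<lambda>x. max 0 (f x) - max 0 (- f x))" by simp
  moreover have "(\<lambda>x. max 0 (f x) - max 0 (- f x)) = f" by auto
  ultimately show ?thesis by simp
qed

section \<open>The magnetic inequality on a circle\<close>


lemma nn_integral_angular: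
  assumes [measurable]: "f \<in> borel_measurable borel"
  shows "(\<integral>\<^sup>+t. f t \<partial>angular_measure) = (\<integral>\<^sup>+t. f t * indicator {0..2 * pi} t \<partial>lborel)"
proof -
  have "(\<integral>\<^sup>+t. f t \<partial>angular_measure) = (\<integral>\<^sup>+t. indicator {0<..<2 * pi} t * f t \<partial>lborel)"
    unfolding angular_measure_def by (rule nn_integral_density) auto
  also have "\<dots> = (\<integral>\<^sup>+t. f t * indicator {0..2 * pi} t \<partial>lborel)"
  proof (rule nn_integral_cong_AE)
    show "AE t in lborel. indicator {0<..<2 * pi} t * f t = f t * indicator {0..2 * pi} t"
      using AE_lborel_singleton[of 0] AE_lborel_singleton[of "2 * pi"]
      by eventually_elim (auto simp: indicator_def)
  qed
  finally show ?thesis .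
qed

lemma nn_integral_angular_continuous:
  assumes f: "continuous_on UNIV f" and nn: "\<And>t. 0 \<le> f t"
  shows "(\<integral>\<^sup>+t. ennreal (f t) \<partial>angular_measure) = ennreal (integral {0..2 * pi} f)"
proof -
  have [measurable]: "f \<in> borel_measurable borel" using f by (rule borel_measurable_continuous_onI)
  have "(f has_integral integral {0..2 * pi} f) {0..2 * pi}"
    by (intro integrable_integral integrable_continuous_real continuous_on_subset[OF f]) auto
  from nn_integral_has_integral_lebesgue'[OF _ this] nn show ?thesis
    by (subst nn_integral_angular) auto
qed

lemma integral_angular_continuous:
  fixes c :: "real \<Rightarrow> real"
  assumes c: "continuous_on UNIV c"
  shows "integrable angular_measure c" "(LINT s|angular_measure. c s) = integral {0..2 * pi} c"
proof -
  have [measurable]: "c \<in> borel_measurable borel" using c by (rule borel_measurable_continuous_onI)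
  have dens: "angular_measure = density lborel (\<lambda>t. ennreal (indicator {0<..<2 * pi} t))"
    by (simp add: angular_measure_def ennreal_indicator)
  have si: "set_integrable lborel {0<..<2 * pi} c"
    by (rule set_integrable_subset[OF borel_integrable_atLeastAtMost'[of 0 "2 * pi"]])
       (auto intro: continuous_on_subset[OF c])
  then show "integrable angular_measure c"
    unfolding dens by (subst integrable_density) (auto simp: set_integrable_def)
  have "(LINT s|angular_measure. c s) = (LINT s:{0<..<2 * pi}|lborel. c s)"
    unfolding dens by (subst integral_density) (auto simp: set_lebesgue_integral_def)
  also have "\<dots> = integral {0<..<2 * pi} c" by (rule set_borel_integral_eq_integral(2)[OF si])
  also have "\<dots> = integral {0..2 * pi} c" by (rule integral_open_interval_real[symmetric])
  finally show "(LINT s|angular_measure. c s) = integral {0..2 * pi} c" .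
qed

text \<open>
  Put \<open>g(t) = w(t) exp(-i \<integral>\<^sub>0\<^sup>t c)\<close>. Then \<open>|g'| = |w' - i c w|\<close>, so both bounds are instances of
  \<open>|g(t) - g(0)| \<le> \<integral>|g'|\<close>. In the second one \<open>t = 2\<pi>\<close>: periodicity of \<open>w\<close> leaves the holonomy factor as
  the only difference between the end values of \<open>g\<close>.
\<close>
lemma gauge_transform_bounds:
  fixes w w' :: "real \<Rightarrow> complex" and c :: "real \<Rightarrow> real"
  assumes c: "continuous_on UNIV c" and w: "\<And>t. (w has_vector_derivative w' t) (at t)"
    and w': "continuous_on UNIV w'" and per: "w (2 * pi) = w 0"
  defines "I \<equiv> integral {0..2 * pi} (\<lambda>s. norm (w' s - \<i> * c s * w s))"
  shows "t \<in> {0..2 * pi} \<Longrightarrow> norm (w t) \<le> norm (w 0) + I"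
    and "norm (w 0) * norm (cis (- integral {0..2 * pi} c) - 1) \<le> I"
proof -
  define P where "P t = integral {0..t} c" for t
  have wc: "continuous_on UNIV w"
    using w by (auto intro!: continuous_at_imp_continuous_on has_vector_derivative_continuous)
  have P: "(P has_vector_derivative c t) (at t within {0..2 * pi})" if "t \<in> {0..2 * pi}" for t
    unfolding P_def by (rule integral_has_vector_derivative[OF continuous_on_subset[OF c] that]) auto
  define g where "g t = w t * cis (- P t)" for t
  define h where "h t = (w' t - \<i> * c t * w t) * cis (- P t)" for t
  have g: "(g has_vector_derivative h t) (at t within {0..2 * pi})" if "t \<in> {0..2 * pi}" for t
  proof -
    have "((\<lambda>t. cis (- P t)) has_vector_derivative (- c t) *\<^sub>R (\<i> * cis (- P t))) (at t within {0..2 * pi})"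
      using P[OF that] unfolding has_vector_derivative_def
      by (auto intro!: derivative_eq_intros simp: scaleR_conv_of_real)
    from has_vector_derivative_mult[OF has_vector_derivative_at_within[OF w] this]
    show ?thesis unfolding g_def h_def
      by (simp add: algebra_simps scaleR_conv_of_real)
  qed
  have Pc: "continuous_on {0..2 * pi} P"
    using P by (rule continuous_on_vector_derivative)
  have hn: "norm (h t) = norm (w' t - \<i> * c t * w t)" for t by (simp add: h_def norm_mult)
  have nc: "continuous_on UNIV (\<lambda>s. norm (w' s - \<i> * c s * w s))"
    by (intro continuous_intros c wc w')
  have main: "norm (g t - g 0) \<le> I" if t: "t \<in> {0..2 * pi}" for t
  proof -
    have hi: "(h has_integral (g t - g 0)) {0..t}"
    proof (rule fundamental_theorem_of_calculus)
      fix s assume "s \<in> {0..t}"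
      then show "(g has_vector_derivative h s) (at s within {0..t})"
        using t by (intro has_vector_derivative_within_subset[OF g]) auto
    qed (use t in auto)
    have ni: "(\<lambda>s. norm (w' s - \<i> * c s * w s)) integrable_on {a..b}" for a b
      by (intro integrable_continuous_real continuous_on_subset[OF nc]) auto
    have "norm (g t - g 0) = norm (integral {0..t} h)" using hi by (simp add: integral_unique)
    also have "\<dots> \<le> integral {0..t} (\<lambda>s. norm (w' s - \<i> * c s * w s))"
      using hi ni by (intro integral_norm_bound_integral) (auto simp: hn integrable_on_def)
    also have "\<dots> \<le> I" unfolding I_def
      using t by (intro integral_subset_le ni) auto
    finally show ?thesis .
  qed
  have g0: "g 0 = w 0" by (simp add: g_def P_def)
  { assume t: "t \<in> {0..2 * pi}"
    have "norm (w t) = norm (g t)" by (simp add: g_def norm_mult)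
    also have "\<dots> \<le> norm (g 0) + norm (g t - g 0)" by (metis add.commute norm_triangle_sub)
    finally show "norm (w t) \<le> norm (w 0) + I" using main[OF t] g0 by simp }
  have "norm (w 0) * norm (cis (- integral {0..2 * pi} c) - 1) = norm (g (2 * pi) - g 0)"
    unfolding norm_mult[symmetric] g0 by (simp add: g_def per P_def right_diff_distrib)
  also have "\<dots> \<le> I" using main by auto
  finally show "norm (w 0) * norm (cis (- integral {0..2 * pi} c) - 1) \<le> I" .
qed

text \<open>
  For almost every circle the potential is merely integrable. Both sides of the bounds depend
  continuously on the potential in \<open>L\<^sup>1\<close>, so it may be replaced by continuous functions.
\<close>
lemma gauge_transform_bounds_L1:
  fixes w w' :: "real \<Rightarrow> complex" and a :: "real \<Rightarrow> real"
  assumes a: "integrable angular_measure a" and am [measurable]: "a \<in> borel_measurable borel"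
    and w: "\<And>t. (w has_vector_derivative w' t) (at t)"
    and w': "continuous_on UNIV w'" and per: "w (2 * pi) = w 0"
    and D: "(\<integral>\<^sup>+s. ennreal (norm (w' s - \<i> * a s * w s)) \<partial>angular_measure) \<le> ennreal D" and D0: "0 \<le> D"
  shows "t \<in> {0..2 * pi} \<Longrightarrow> norm (w t) \<le> norm (w 0) + D"
    and "norm (w 0) * norm (cis (- (LINT s|angular_measure. a s)) - 1) \<le> D"
proof -
  have wc: "continuous_on UNIV w"
    using w by (auto intro!: continuous_at_imp_continuous_on has_vector_derivative_continuous)
  have [measurable]: "w \<in> borel_measurable borel" "w' \<in> borel_measurable borel"
    using wc w' by (auto intro: borel_measurable_continuous_onI)
  have "bounded (w ` {0..2 * pi})"
    by (intro compact_imp_bounded compact_continuous_image continuous_on_subset[OF wc]) auto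
  then obtain W where W: "\<And>t. t \<in> {0..2 * pi} \<Longrightarrow> norm (w t) \<le> W" "0 \<le> W"
    unfolding bounded_pos by (metis image_eqI less_imp_le)
  define f where "f t = a t * indicator {0..2 * pi} t" for t
  have [measurable]: "f \<in> borel_measurable borel" unfolding f_def by measurable
  have "(\<integral>\<^sup>+x. ennreal (\<bar>f x\<bar> ^ 1) \<partial>lborel) = (\<integral>\<^sup>+x. ennreal \<bar>a x\<bar> \<partial>angular_measure)"
    by (subst nn_integral_angular) (auto simp: f_def indicator_def intro!: nn_integral_cong)
  also have "\<dots> < \<infinity>" using a by (auto simp: integrable_iff_bounded)
  finally have ap: "Cc_approximable 1 f" by (intro Cc_dense_Lp) auto
  have key: "t \<in> {0..2 * pi} \<longrightarrow> norm (w t) \<le> norm (w 0) + (D + W * e)"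
      "\<exists>x. \<bar>x - (LINT s|angular_measure. a s)\<bar> \<le> e \<and> norm (w 0) * norm (cis (- x) - 1) \<le> D + W * e"
      if "0 < e" for e
  proof -
    obtain c where c: "continuous_on UNIV c" and ce: "(\<integral>\<^sup>+x. ennreal (\<bar>f x - c x\<bar> ^ 1) \<partial>lborel) \<le> ennreal e"
      using ap \<open>0 < e\<close> unfolding Cc_approximable_def by meson
    have [measurable]: "c \<in> borel_measurable borel" using c by (rule borel_measurable_continuous_onI)
    have ac: "(\<integral>\<^sup>+s. ennreal \<bar>a s - c s\<bar> \<partial>angular_measure) \<le> ennreal e"
    proof -
      have "(\<integral>\<^sup>+s. ennreal \<bar>a s - c s\<bar> \<partial>angular_measure) = (\<integral>\<^sup>+s. ennreal \<bar>a s - c s\<bar> * indicator {0..2 * pi} s \<partial>lborel)"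
        by (subst nn_integral_angular) auto
      also have "\<dots> \<le> (\<integral>\<^sup>+x. ennreal (\<bar>f x - c x\<bar> ^ 1) \<partial>lborel)"
        by (intro nn_integral_mono) (auto simp: f_def indicator_def)
      finally show ?thesis using ce by simp
    qed
    define I where "I = integral {0..2 * pi} (\<lambda>s. norm (w' s - \<i> * c s * w s))"
    have Inn: "0 \<le> I" unfolding I_def by (intro integral_nonneg integrable_continuous_real) (auto intro!: continuous_intros continuous_on_subset[OF c] continuous_on_subset[OF wc] continuous_on_subset[OF w'])
    have "ennreal I = (\<integral>\<^sup>+s. ennreal (norm (w' s - \<i> * c s * w s)) \<partial>angular_measure)"
      unfolding I_def by (rule nn_integral_angular_continuous[symmetric]) (auto intro!: continuous_intros c wc w')
    also have "\<dots> \<le> (\<integral>\<^sup>+s. ennreal (norm (w' s - \<i> * a s * w s)) + ennreal W * ennreal \<bar>a s - c s\<bar> \<partial>angular_measure)"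
    proof (rule nn_integral_mono_AE)
      from AE_angular show "AE s in angular_measure. ennreal (norm (w' s - \<i> * c s * w s))
          \<le> ennreal (norm (w' s - \<i> * a s * w s)) + ennreal W * ennreal \<bar>a s - c s\<bar>"
      proof eventually_elim
        case (elim s)
        have "w' s - \<i> * c s * w s = (w' s - \<i> * a s * w s) + \<i> * of_real (a s - c s) * w s"
          by (simp add: algebra_simps)
        then have "norm (w' s - \<i> * c s * w s) \<le> norm (w' s - \<i> * a s * w s) + norm (\<i> * of_real (a s - c s) * w s)"
          by (metis norm_triangle_ineq)
        also have "norm (\<i> * of_real (a s - c s) * w s) = norm (w s) * \<bar>a s - c s\<bar>"
          by (simp only: norm_mult norm_of_real) simp
        also have "\<dots> \<le> W * \<bar>a s - c s\<bar>" using W(1)[of s] elim by (intro mult_right_mono) auto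
        finally show ?case using W(2)
          by (simp add: ennreal_mult'[symmetric] ennreal_plus[symmetric] ennreal_leI del: ennreal_plus)
      qed
    qed
    also have "\<dots> = (\<integral>\<^sup>+s. ennreal (norm (w' s - \<i> * a s * w s)) \<partial>angular_measure)
        + ennreal W * (\<integral>\<^sup>+s. ennreal \<bar>a s - c s\<bar> \<partial>angular_measure)"
      by (subst nn_integral_add) (auto simp: nn_integral_cmult)
    also have "\<dots> \<le> ennreal (D) + ennreal W * ennreal e"
      using D ac by (intro add_mono mult_left_mono) auto
    also have "\<dots> = ennreal (D + W * e)" using W(2) \<open>0 < e\<close> D0 by (simp add: ennreal_mult)
    finally have I: "I \<le> D + W * e" using W(2) \<open>0 < e\<close> D0 by (subst (asm) ennreal_le_iff) auto
    show "t \<in> {0..2 * pi} \<longrightarrow> norm (w t) \<le> norm (w 0) + (D + W * e)"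
      using gauge_transform_bounds(1)[OF c w w' per] I unfolding I_def by fastforce
    have "\<bar>(LINT s|angular_measure. a s) - (LINT s|angular_measure. c s)\<bar> \<le> e"
    proof -
      have "ennreal (norm (LINT s|angular_measure. (a s - c s))) \<le> (\<integral>\<^sup>+s. ennreal (norm (a s - c s)) \<partial>angular_measure)"
        by (rule integral_norm_bound_ennreal) (use a integral_angular_continuous[OF c] in auto)
      also have "\<dots> \<le> ennreal e" using ac by simp
      finally show ?thesis using a integral_angular_continuous[OF c] \<open>0 < e\<close> by simp
    qed
    moreover have "norm (w 0) * norm (cis (- (LINT s|angular_measure. c s)) - 1) \<le> D + W * e"
      using gauge_transform_bounds(2)[OF c w w' per] I integral_angular_continuous[OF c] unfolding I_def by simp
    ultimately show "\<exists>x. \<bar>x - (LINT s|angular_measure. a s)\<bar> \<le> e \<and> norm (w 0) * norm (cis (- x) - 1) \<le> D + W * e"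
      by (intro exI[of _ "LINT s|angular_measure. c s"]) (simp add: abs_minus_commute)
  qed
  show "norm (w t) \<le> norm (w 0) + D" if "t \<in> {0..2 * pi}"
  proof (rule field_le_epsilon)
    fix e :: real assume "0 < e"
    then have "W * (e / (W + 1)) \<le> e" using W(2) by (simp add: field_simps)
    with key(1)[of "e / (W + 1)"] that \<open>0 < e\<close> W(2) show "norm (w t) \<le> norm (w 0) + D + e" by auto
  qed
  define X where "X = (LINT s|angular_measure. a s)"
  obtain x where x: "\<And>n::nat. \<bar>x n - X\<bar> \<le> 1 / Suc n \<and> norm (w 0) * norm (cis (- x n) - 1) \<le> D + W * (1 / Suc n)"
    unfolding X_def using key(2)[of "1 / real (Suc _)"] by (metis of_nat_0_less_iff zero_less_Suc zero_less_divide_1_iff)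
  have "(\<lambda>n. 1 / real (Suc n)) \<longlonglongrightarrow> 0" using LIMSEQ_inverse_real_of_nat by (simp add: inverse_eq_divide)
  then have lim0: "(\<lambda>n. D + W * (1 / real (Suc n))) \<longlonglongrightarrow> D + W * 0" by (intro tendsto_intros)
  have "(\<lambda>n. x n - X) \<longlonglongrightarrow> 0"
    by (rule Lim_null_comparison[OF _ \<open>(\<lambda>n. 1 / real (Suc n)) \<longlonglongrightarrow> 0\<close>]) (use x in auto)
  then have "x \<longlonglongrightarrow> X" by (rule LIM_zero_cancel)
  then have "(\<lambda>n. norm (w 0) * norm (cis (- x n) - 1)) \<longlonglongrightarrow> norm (w 0) * norm (cis (- X) - 1)"
    by (intro tendsto_intros)
  from LIMSEQ_le[OF this lim0] x show "norm (w 0) * norm (cis (- (LINT s|angular_measure. a s)) - 1) \<le> D"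
    unfolding X_def by auto
qed

lemma norm_cis_diff_one: "norm (cis x - 1) = 2 * \<bar>sin (x / 2)\<bar>"
proof -
  have "(norm (cis x - 1))\<^sup>2 = (cos x - 1)\<^sup>2 + (sin x)\<^sup>2" by (simp add: cmod_power2)
  also have "\<dots> = 2 - 2 * cos x"
    using sin_cos_squared_add[of x] by (simp add: power2_diff)
  also have "\<dots> = (2 * \<bar>sin (x / 2)\<bar>)\<^sup>2"
    using cos_double_sin[of "x / 2"] by (simp add: power_mult_distrib)
  finally show ?thesis by (subst (asm) power2_eq_iff_nonneg) auto
qed

text \<open>
  Reduce \<open>\<Phi>\<close> modulo its nearest integer, which leaves a distance between \<open>\<epsilon>\<close> and \<open>1/2\<close>, where the sine
  increases.
\<close>
lemma abs_sin_pi_lower: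
  assumes "0 < \<epsilon>" "\<epsilon> < 1/2" and far: "\<And>k::int. \<epsilon> \<le> \<bar>of_int k - \<Phi>\<bar>"
  shows "sin (pi * \<epsilon>) \<le> \<bar>sin (pi * \<Phi>)\<bar>"
proof -
  define k where "k = round \<Phi>"
  define d where "d = \<Phi> - of_int k"
  have d: "\<epsilon> \<le> \<bar>d\<bar>" "\<bar>d\<bar> \<le> 1/2"
    using far[of k] of_int_round_abs_le[of \<Phi>] by (auto simp: d_def k_def abs_minus_commute)
  have "\<bar>sin (pi * \<Phi>)\<bar> = \<bar>sin (pi * d)\<bar>"
  proof -
    have "pi * \<Phi> = pi * d + of_int k * pi" by (simp add: d_def algebra_simps)
    then have "sin (pi * \<Phi>) = sin (pi * d) * cos (of_int k * pi) + cos (pi * d) * sin (of_int k * pi)"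
      by (simp add: sin_add)
    moreover have "sin (of_int k * pi) = 0" by (simp add: sin_int_times_real mult.commute)
    moreover have "\<bar>cos (of_int k * pi)\<bar> = 1"
      using sin_cos_squared_add[of "of_int k * pi"] \<open>sin (of_int k * pi) = 0\<close> by (auto simp: power2_eq_1_iff)
    ultimately show ?thesis by (simp add: abs_mult)
  qed
  also have "\<dots> = \<bar>sin (pi * \<bar>d\<bar>)\<bar>" by (simp add: abs_if)
  also have "\<dots> \<ge> sin (pi * \<bar>d\<bar>)" by simp
  also have "sin (pi * \<bar>d\<bar>) \<ge> sin (pi * \<epsilon>)"
  proof (rule sin_monotone_2pi_le)
    show "- (pi / 2) \<le> pi * \<epsilon>" using assms(1) pi_gt_zero by (smt (verit) mult_pos_pos divide_pos_pos)
  qed (use d assms(1,2) in auto)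
  finally show ?thesis .
qed

text \<open>
  With circulation \<open>2\<pi>\<Phi>\<close>, the holonomy factor differs from \<open>1\<close> by \<open>2|sin(\<pi>\<Phi>)|\<close>, which is bounded below when \<open>\<Phi>\<close> stays away from
  the integers. The gauge bounds then control the supremum of \<open>|w|\<close> by the \<open>L\<^sup>1\<close> norm of the covariant
  derivative, and the Cauchy-Schwarz inequality turns this into an \<open>L\<^sup>2\<close> estimate.
\<close>
lemma circle_inequality:
  fixes w w' :: "real \<Rightarrow> complex" and a :: "real \<Rightarrow> real"
  assumes \<epsilon>: "0 < \<epsilon>" "\<epsilon> < 1/2"
    and a: "integrable angular_measure a" and am [measurable]: "a \<in> borel_measurable borel"
    and w: "\<And>t. (w has_vector_derivative w' t) (at t)"
    and w': "continuous_on UNIV w'" and per: "w (2 * pi) = w 0"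
    and far: "\<And>k::int. \<epsilon> \<le> \<bar>of_int k - (LINT s|angular_measure. a s) / (2 * pi)\<bar>"
  shows "(\<integral>\<^sup>+s. ennreal ((norm (w s))\<^sup>2) \<partial>angular_measure)
    \<le> ennreal ((2 * pi * (1 / (2 * sin (pi * \<epsilon>)) + 1))\<^sup>2) * (\<integral>\<^sup>+s. ennreal ((norm (w' s - \<i> * a s * w s))\<^sup>2) \<partial>angular_measure)"
proof -
  define \<eta> where "\<eta> = 2 * sin (pi * \<epsilon>)"
  have \<eta>: "0 < \<eta>" unfolding \<eta>_def using \<epsilon> by (auto intro!: sin_gt_zero)
  have wc: "continuous_on UNIV w"
    using w by (auto intro!: continuous_at_imp_continuous_on has_vector_derivative_continuous)
  have [measurable]: "w \<in> borel_measurable borel" "w' \<in> borel_measurable borel"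
    using wc w' by (auto intro: borel_measurable_continuous_onI)
  define F where "F s = norm (w' s - \<i> * a s * w s)" for s
  have [measurable]: "F \<in> borel_measurable borel" unfolding F_def by measurable
  have F0: "0 \<le> F s" for s by (simp add: F_def)
  have tot: "emeasure angular_measure UNIV = ennreal (2 * pi)"
    by (simp add: angular_measure_def emeasure_density)
  define Q where "Q = (\<integral>\<^sup>+s. ennreal ((F s)\<^sup>2) \<partial>angular_measure)"
  show ?thesis
  proof (cases "Q = \<infinity>")
    case True
    have "ennreal ((2 * pi * (1 / (2 * sin (pi * \<epsilon>)) + 1))\<^sup>2) \<noteq> 0"
    proof -
      have "0 < 2 * pi * (1 / (2 * sin (pi * \<epsilon>)) + 1)"
        using \<eta> unfolding \<eta>_def by (intro mult_pos_pos add_pos_pos) auto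
      then show ?thesis by (smt (verit) ennreal_eq_0_iff zero_less_power)
    qed
    then show ?thesis using True unfolding Q_def F_def by (simp add: ennreal_mult_top)
  next
    case False
    then obtain q where q: "Q = ennreal q" "0 \<le> q" by (cases Q) auto
    have "(\<integral>\<^sup>+s. ennreal (F s) \<partial>angular_measure)\<^sup>2 \<le> (\<integral>\<^sup>+s. (ennreal (F s))\<^sup>2 \<partial>angular_measure) * (\<integral>\<^sup>+s. 1\<^sup>2 \<partial>angular_measure)"
      using Cauchy_Schwarz_nn_integral[of "\<lambda>s. ennreal (F s)" angular_measure "\<lambda>_. 1"] by simp
    also have "\<dots> = ennreal (2 * pi * q)"
      using q F0 tot unfolding Q_def by (simp add: ennreal_power ennreal_mult mult.commute)
    finally have CS: "(\<integral>\<^sup>+s. ennreal (F s) \<partial>angular_measure)\<^sup>2 \<le> ennreal (2 * pi * q)" .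
    define D where "D = sqrt (2 * pi * q)"
    have D: "0 \<le> D" "D\<^sup>2 = 2 * pi * q" using q by (auto simp: D_def)
    have "(\<integral>\<^sup>+s. ennreal (F s) \<partial>angular_measure) \<le> ennreal D"
    proof (rule ccontr)
      assume "\<not> ?thesis"
      then have lt: "ennreal D < (\<integral>\<^sup>+s. ennreal (F s) \<partial>angular_measure)" by simp
      show False
      proof (cases "\<integral>\<^sup>+s. ennreal (F s) \<partial>angular_measure")
        case (real x)
        then have "D < x" using lt D(1) by (simp add: ennreal_less_iff)
        then have "D\<^sup>2 < x\<^sup>2" using D(1) by (intro power_strict_mono) auto
        moreover have "x\<^sup>2 \<le> D\<^sup>2" using CS real unfolding D(2)[symmetric] by (simp add: ennreal_power)
        ultimately show False by simp
      next
        case top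
        then show False using CS by (simp add: top_unique)
      qed
    qed
    note gt = gauge_transform_bounds_L1[OF a am w w' per this[unfolded F_def] D(1)]
    have "\<eta> \<le> norm (cis (- (LINT s|angular_measure. a s)) - 1)"
      using abs_sin_pi_lower[OF \<epsilon> far] unfolding norm_cis_diff_one \<eta>_def by simp
    then have "norm (w 0) * \<eta> \<le> D"
      using gt(2) by (meson mult_left_mono norm_ge_zero order_trans)
    then have "norm (w 0) \<le> D / \<eta>" using \<eta> by (simp add: field_simps)
    then have b: "norm (w t) \<le> (1 / \<eta> + 1) * D" if "t \<in> {0..2 * pi}" for t
      using gt(1)[OF that] by (simp add: algebra_simps)
    have "(\<integral>\<^sup>+s. ennreal ((norm (w s))\<^sup>2) \<partial>angular_measure) \<le> (\<integral>\<^sup>+s. ennreal (((1 / \<eta> + 1) * D)\<^sup>2) \<partial>angular_measure)"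
    proof (rule nn_integral_mono_AE)
      from AE_angular show "AE s in angular_measure. ennreal ((norm (w s))\<^sup>2) \<le> ennreal (((1 / \<eta> + 1) * D)\<^sup>2)"
        by eventually_elim (intro ennreal_leI power_mono b; auto)
    qed
    also have "\<dots> = ennreal (((1 / \<eta> + 1) * D)\<^sup>2) * ennreal (2 * pi)" by (simp add: tot)
    also have "\<dots> = ennreal (((1 / \<eta> + 1) * D)\<^sup>2 * (2 * pi))" by (simp add: ennreal_mult')
    also have "((1 / \<eta> + 1) * D)\<^sup>2 * (2 * pi) = (2 * pi * (1 / \<eta> + 1))\<^sup>2 * q"
      unfolding power_mult_distrib D(2) by (simp add: power2_eq_square)
    also have "ennreal \<dots> = ennreal ((2 * pi * (1 / \<eta> + 1))\<^sup>2) * ennreal q"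
      by (rule ennreal_mult') (use q in auto)
    finally show ?thesis unfolding q(1)[symmetric] Q_def F_def \<eta>_def .
  qed
qed

section \<open>Construction of test functions\<close>



text \<open>
  The factors \<open>(1 / s)\<^sup>n\<close> make the family closed under differentiation up to linear combinations; the
  member \<open>n = 0\<close> is the standard smooth function that vanishes on the negative half-line.
\<close>
definition flat :: "nat \<Rightarrow> real \<Rightarrow> real" where
  "flat n s = (if s \<le> 0 then 0 else (1 / s) ^ n * exp (- (1 / s)))"

lemma flat_nonneg: "0 \<le> flat n s"
  by (simp add: flat_def)

lemma flat_0_le_one: "flat 0 s \<le> 1"
  by (simp add: flat_def)

lemma flat_tendsto_0: "(flat n \<longlongrightarrow> 0) (at 0)"
proof (rule filterlim_split_at_real)
  show "(flat n \<longlongrightarrow> 0) (at_left 0)"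
    by (rule tendsto_eventually) (auto simp: eventually_at_filter flat_def)
  have "((\<lambda>s::real. (inverse s) ^ n / exp (inverse s)) \<longlongrightarrow> 0) (at_right 0)"
    by (rule filterlim_compose[OF tendsto_power_div_exp_0 filterlim_inverse_at_top_right])
  then show "(flat n \<longlongrightarrow> 0) (at_right 0)"
    by (rule Lim_transform_eventually)
       (auto simp: eventually_at_filter flat_def exp_minus field_simps)
qed

lemma flat_deriv: "(flat n has_real_derivative flat (n + 2) s - n * flat (n + 1) s) (at s)"
proof -
  consider "s < 0" | "s = 0" | "0 < s" by linarith
  then show ?thesis
  proof cases
    case 1
    have "((\<lambda>_. 0) has_real_derivative 0) (at s)" by simp
    then have "(flat n has_real_derivative 0) (at s)"
      by (rule has_field_derivative_transform_within_open[of _ _ _ "{..<0}"]) (use 1 in \<open>auto simp: flat_def\<close>)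
    then show ?thesis using 1 by (simp add: flat_def)
  next
    case 2
    have "((\<lambda>h. (flat n (0 + h) - flat n 0) / h) \<longlongrightarrow> 0) (at 0)"
      by (rule Lim_transform_eventually[OF flat_tendsto_0[of "Suc n"]])
         (auto simp: eventually_at_filter flat_def)
    then show ?thesis using 2 by (simp add: DERIV_def flat_def)
  next
    case 3
    have "((\<lambda>s. (1 / s) ^ n * exp (- (1 / s))) has_real_derivative
        (real n * (1 / s) ^ (n - 1) * (- 1 / s\<^sup>2)) * exp (- (1 / s)) + (1 / s) ^ n * (exp (- (1 / s)) * (1 / s\<^sup>2))) (at s)"
      using 3 by (auto intro!: derivative_eq_intros simp: power2_eq_square)
    also have "(real n * (1 / s) ^ (n - 1) * (- 1 / s\<^sup>2)) * exp (- (1 / s)) + (1 / s) ^ n * (exp (- (1 / s)) * (1 / s\<^sup>2))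
        = flat (n + 2) s - n * flat (n + 1) s"
      using 3 by (cases n) (auto simp: flat_def power2_eq_square field_simps)
    finally show ?thesis
      by (rule has_field_derivative_transform_within_open[of _ _ _ "{0<..}"]) (use 3 in \<open>auto simp: flat_def\<close>)
  qed
qed

lemma partial_deriv_eq: "(f has_derivative f') (at x) \<Longrightarrow> partial_deriv k f x = f' (axis k 1)"
  by (simp add: partial_deriv_def frechet_derivative_at[symmetric])

text \<open>
  All these functions are smooth because the set is closed under partial derivatives. The rule
  \<open>primitive\<close> admits antiderivatives of members, which is how the radial cutoffs with a prescribed
  derivative enter.
\<close>
inductive_set smooth_algebra :: "(real^2 \<Rightarrow> real) set" where
  const: "(\<lambda>_. c) \<in> smooth_algebra"
| coord: "(\<lambda>x. x $ k) \<in> smooth_algebra"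
| add: "f \<in> smooth_algebra \<Longrightarrow> g \<in> smooth_algebra \<Longrightarrow> (\<lambda>x. f x + g x) \<in> smooth_algebra"
| mult: "f \<in> smooth_algebra \<Longrightarrow> g \<in> smooth_algebra \<Longrightarrow> (\<lambda>x. f x * g x) \<in> smooth_algebra"
| flat: "f \<in> smooth_algebra \<Longrightarrow> (\<lambda>x. flat n (f x)) \<in> smooth_algebra"
| primitive: "(\<forall>x. T differentiable (at x)) \<Longrightarrow> (\<forall>k. partial_deriv k T \<in> smooth_algebra) \<Longrightarrow> T \<in> smooth_algebra"

lemma smooth_algebra_closed:
  assumes "f \<in> smooth_algebra"
  shows "(\<forall>x. f differentiable (at x)) \<and> (\<forall>k. partial_deriv k f \<in> smooth_algebra)"
  using assms
proof induction
  case (const c)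
  have "partial_deriv k (\<lambda>_. c) = (\<lambda>_. 0 :: real)" for k :: 2
    by (rule ext) (rule partial_deriv_eq[where f' = "\<lambda>_. 0", OF has_derivative_const])
  then show ?case by (auto intro: smooth_algebra.const)
next
  case (coord j)
  have d: "((\<lambda>x::real^2. x $ j) has_derivative (\<lambda>x. x $ j)) (at x)" for x
    by (rule bounded_linear.has_derivative[OF bounded_linear_vec_nth has_derivative_ident])
  have "partial_deriv k (\<lambda>x. x $ j) = (\<lambda>_. axis k 1 $ j :: real)" for k :: 2
    by (rule ext) (rule partial_deriv_eq[OF d])
  then show ?case using d by (auto intro: smooth_algebra.const simp: differentiable_def)
next
  case (add f g)
  have D: "(f has_derivative frechet_derivative f (at x)) (at x)" "(g has_derivative frechet_derivative g (at x)) (at x)" for x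
    using add.IH by (auto simp: frechet_derivative_works)
  have "partial_deriv k (\<lambda>x. f x + g x) = (\<lambda>x. partial_deriv k f x + partial_deriv k g x)" for k
    by (rule ext) (simp add: partial_deriv_eq[OF has_derivative_add[OF D]] partial_deriv_eq[OF D(1)] partial_deriv_eq[OF D(2)])
  then show ?case using add.IH by (auto intro!: smooth_algebra.add derivative_intros)
next
  case (mult f g)
  have D: "(f has_derivative frechet_derivative f (at x)) (at x)" "(g has_derivative frechet_derivative g (at x)) (at x)" for x
    using mult.IH by (auto simp: frechet_derivative_works)
  have "partial_deriv k (\<lambda>x. f x * g x) = (\<lambda>x. f x * partial_deriv k g x + partial_deriv k f x * g x)" for k
    by (rule ext) (simp add: partial_deriv_eq[OF has_derivative_mult[OF D]] partial_deriv_eq[OF D(1)] partial_deriv_eq[OF D(2)])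
  then show ?case using mult by (auto intro!: smooth_algebra.add smooth_algebra.mult derivative_intros)
next
  case (flat f n)
  have D: "(f has_derivative frechet_derivative f (at x)) (at x)" for x
    using flat.IH by (auto simp: frechet_derivative_works)
  have DF: "((\<lambda>x. flat n (f x)) has_derivative (\<lambda>h. (flat (n + 2) (f x) - n * flat (n + 1) (f x)) * frechet_derivative f (at x) h)) (at x)" for x
    using has_derivative_compose[OF D flat_deriv[unfolded has_field_derivative_def]] by simp
  have "partial_deriv k (\<lambda>x. flat n (f x)) = (\<lambda>x. (flat (n + 2) (f x) + (- real n) * flat (n + 1) (f x)) * partial_deriv k f x)" for k
    by (rule ext) (simp add: partial_deriv_eq[OF DF] partial_deriv_eq[OF D])
  moreover have "(\<lambda>x. (flat (n + 2) (f x) + (- real n) * flat (n + 1) (f x)) * partial_deriv k f x) \<in> smooth_algebra" for k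
    using flat by (intro smooth_algebra.intros(1-5)) auto
  ultimately show ?case using DF by (auto simp: differentiable_def)
next
  case (primitive T)
  then show ?case by auto
qed

lemma smooth_algebra_C_k: "f \<in> smooth_algebra \<Longrightarrow> C_k m f"
proof (induction m arbitrary: f)
  case 0
  then show ?case
    using smooth_algebra_closed[OF 0] by (auto intro!: continuous_at_imp_continuous_on differentiable_imp_continuous_within)
next
  case (Suc m)
  then show ?case using smooth_algebra_closed[OF Suc.prems] by auto
qed

lemma smooth_algebra_test_function:
  assumes f: "f \<in> smooth_algebra" and R: "\<And>x. R < norm x \<Longrightarrow> f x = 0"
  shows "f \<in> test_functions"
proof -
  have "support_on UNIV f \<subseteq> cball 0 R"
    using R by (force simp: support_on_def not_le[symmetric])
  then have "bounded (closure (support_on UNIV f))"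
    by (meson bounded_cball bounded_closure bounded_subset)
  then show ?thesis
    using smooth_algebra_C_k[OF f] by (simp add: test_functions_def compact_eq_bounded_closed)
qed

lemma smooth_algebra_norm_square: "(\<lambda>x. (norm (x - a))\<^sup>2) \<in> smooth_algebra"
proof -
  have "(\<lambda>x. (x $ 1 + - (a $ 1)) * (x $ 1 + - (a $ 1)) + (x $ 2 + - (a $ 2)) * (x $ 2 + - (a $ 2))) \<in> smooth_algebra"
    by (intro smooth_algebra.intros(1-4))
  moreover have "(\<lambda>x. (x $ 1 + - (a $ 1)) * (x $ 1 + - (a $ 1)) + (x $ 2 + - (a $ 2)) * (x $ 2 + - (a $ 2))) = (\<lambda>x. (norm (x - a))\<^sup>2)"
    by (simp add: norm_vec2 power2_eq_square)
  ultimately show ?thesis by simp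
qed

section \<open>Circulation and flux\<close>


text \<open>
  Open intervals are stable under intersection and generate the Borel sets, so the integral over every
  Borel set vanishes.
\<close>
lemma AE_zero_if_interval_integrals_zero:
  fixes f :: "real \<Rightarrow> real"
  assumes "sigma_finite_measure M" and M [measurable_cong]: "sets M = sets borel" and f: "integrable M f"
    and zero: "\<And>a b. (LINT x:{a<..<b}|M. f x) = 0"
  shows "AE x in M. f x = 0"
proof (rule sigma_finite_measure.density_zero[OF assms(1) f])
  fix E assume "E \<in> sets M"
  define G where "G = range (\<lambda>(a, b). {a<..<b::real})"
  have Eb: "E \<in> sets borel" using \<open>E \<in> sets M\<close> M by simp
  have "borel = sigma UNIV G"
    using borel_eq_box[where 'a = real] by (simp add: G_def box_real)
  then have "sets borel = sets (sigma UNIV G)" by (rule arg_cong)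
  then have borelG: "sets borel = sigma_sets UNIV G" by simp
  have spM: "space M = UNIV" using sets_eq_imp_space_eq[OF M] by simp
  have sub: "X \<in> sets M" if "X \<in> sigma_sets UNIV G" for X using that borelG M by simp
  have si: "set_integrable M X f" if "X \<in> sets M" for X
    using f that unfolding set_integrable_def by (rule integrable_mult_indicator[rotated])
  have Int: "Int_stable G"
  proof (rule Int_stableI)
    fix X Y assume "X \<in> G" "Y \<in> G"
    then obtain a b c d where "X = {a<..<b}" "Y = {c<..<d}" by (auto simp: G_def)
    then have "X \<inter> Y = {max a c<..<min b d}" by auto
    then show "X \<inter> Y \<in> G" by (auto simp: G_def)
  qed
  have tot: "(LINT x|M. f x) = 0"
  proof (rule LIMSEQ_unique)
    show "(\<lambda>n. LINT x:{- real n<..<real n}|M. f x) \<longlonglongrightarrow> 0" using zero by simp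
    show "(\<lambda>n. LINT x:{- real n<..<real n}|M. f x) \<longlonglongrightarrow> (LINT x|M. f x)"
      unfolding set_lebesgue_integral_def
    proof (rule integral_dominated_convergence[where w = "\<lambda>x. \<bar>f x\<bar>"])
      show "AE x in M. (\<lambda>n. indicat_real {- real n<..<real n} x *\<^sub>R f x) \<longlonglongrightarrow> f x"
      proof (rule AE_I2)
        fix x
        obtain n :: nat where n: "\<bar>x\<bar> < real n" using reals_Archimedean2 by blast
        show "(\<lambda>n. indicat_real {- real n<..<real n} x *\<^sub>R f x) \<longlonglongrightarrow> f x"
          by (rule tendsto_eventually, rule eventually_sequentiallyI[of n]) (use n in \<open>auto simp: indicator_def\<close>)
      qed
    qed (use f in \<open>auto simp: indicator_def intro!: borel_measurable_integrable integrable_mult_indicator[unfolded real_scaleR_def]\<close>)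
  qed
  have "E \<in> sigma_sets UNIV G" using Eb borelG by simp
  have "G \<subseteq> Pow UNIV" by simp
  from Int this \<open>E \<in> sigma_sets UNIV G\<close> show "set_lebesgue_integral M E f = 0"
  proof (induction rule: sigma_sets_induct_disjoint)
    case (basic A)
    then show ?case using zero by (auto simp: G_def)
  next
    case empty
    show ?case by (simp add: set_lebesgue_integral_def)
  next
    case (compl A)
    have "(LINT x:UNIV - A|M. f x) + (LINT x:A|M. f x) = (LINT x:(UNIV - A) \<union> A|M. f x)"
      using sub[OF compl(1)] spM sets.compl_sets[OF sub[OF compl(1)]]
      by (intro set_integral_Un[symmetric] si) auto
    also have "\<dots> = (LINT x|M. f x)" by (simp add: set_lebesgue_integral_def)
    finally show ?case using tot compl by simp
  next
    case (union A)
    have "\<And>i. A i \<in> sets M" using union(2) sub by auto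
    then have "(LINT x:(\<Union>i. A i)|M. f x) = (\<Sum>i. (LINT x:(A i)|M. f x))"
      using union(1) by (intro lebesgue_integral_countable_add si) (auto simp: disjoint_family_on_def)
    then show ?case using union by simp
  qed
qed


text \<open>
  \<open>|x|\<close> times the component of the potential along the circle through \<open>x\<close>: its integral over the angle
  is the circulation.
\<close>
definition tangential :: "(real^2 \<Rightarrow> real^2) \<Rightarrow> real^2 \<Rightarrow> real" where
  "tangential A x = x $ 1 * A x $ 2 - x $ 2 * A x $ 1"

interpretation lborel_radial: pair_sigma_finite "lborel :: (real^2) measure" radial_measure ..

lemma integral_polar:
  fixes f :: "real^2 \<Rightarrow> real"
  assumes f: "integrable lborel f"
  shows "integrable radial_measure (\<lambda>r. LINT t|angular_measure. f (polar_pt (r, t)))"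
    and "AE r in radial_measure. integrable angular_measure (\<lambda>t. f (polar_pt (r, t)))"
    and "(LINT r|radial_measure. LINT t|angular_measure. f (polar_pt (r, t))) = (LINT x|lborel. f x)"
proof -
  have [measurable]: "f \<in> borel_measurable borel" using f by auto
  have "integrable (distr (radial_measure \<Otimes>\<^sub>M angular_measure) borel polar_pt) f"
    using f by (subst lborel_eq_distr_pol[symmetric])
  then have i: "integrable (radial_measure \<Otimes>\<^sub>M angular_measure) (\<lambda>z. f (polar_pt z))"
    by (subst (asm) integrable_distr_eq) auto
  show "integrable radial_measure (\<lambda>r. LINT t|angular_measure. f (polar_pt (r, t)))"
    using polar.integrable_fst'[OF i] .
  show "AE r in radial_measure. integrable angular_measure (\<lambda>t. f (polar_pt (r, t)))"
    using polar.AE_integrable_fst'[OF i] .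
  have "(LINT r|radial_measure. LINT t|angular_measure. f (polar_pt (r, t))) = (LINT z|(radial_measure \<Otimes>\<^sub>M angular_measure). f (polar_pt z))"
    using polar.integral_fst'[OF i] .
  also have "\<dots> = (LINT x|lborel. f x)"
    by (subst lborel_eq_distr_pol) (simp add: integral_distr)
  finally show "(LINT r|radial_measure. LINT t|angular_measure. f (polar_pt (r, t))) = (LINT x|lborel. f x)" .
qed

text \<open>
  Fubini's theorem for \<open>B(x) W(r)\<close> on the set \<open>|x| \<le> r\<close>: a weighted average of fluxes is the integral of
  the field against a radial function.
\<close>
lemma flux_layer_cake:
  fixes B :: "real^2 \<Rightarrow> real" and W :: "real \<Rightarrow> real"
  assumes [measurable]: "B \<in> borel_measurable borel" "W \<in> borel_measurable borel"
    and B: "\<And>R. set_integrable lborel (cball 0 R) B" and W: "\<And>r. \<bar>W r\<bar> \<le> M * indicator {a<..<b} r"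
  shows "integrable radial_measure (\<lambda>r. W r * (LINT x:cball 0 r|lborel. B x))"
    and "(LINT r|radial_measure. W r * (LINT x:cball 0 r|lborel. B x))
      = (LINT x|lborel. B x * (LINT r|radial_measure. W r * indicator {norm x..} r))"
proof -
  define k where "k x r = B x * (W r * indicator {norm x..} r)" for x :: "real^2" and r
  have M0: "0 \<le> M * indicator {a<..<b} r" for r using W[of r] by linarith
  have km [measurable]: "case_prod k \<in> borel_measurable (lborel \<Otimes>\<^sub>M radial_measure)"
  proof -
    have "(\<lambda>z. B (fst z) * (W (snd z) * (if norm (fst z) \<le> snd z then 1 else 0))) \<in> borel_measurable (lborel \<Otimes>\<^sub>M radial_measure)"
      by measurable
    also have "(\<lambda>z. B (fst z) * (W (snd z) * (if norm (fst z) \<le> snd z then 1 else 0))) = case_prod k"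
      by (auto simp: k_def indicator_def fun_eq_iff)
    finally show ?thesis .
  qed
  have [measurable]: "(\<lambda>x. indicat_real (cball 0 b) x * B x) \<in> borel_measurable borel"
    by (intro borel_measurable_times borel_measurable_indicator) auto
  have fin1: "(\<integral>\<^sup>+x. ennreal (\<bar>indicator (cball 0 b) x * B x\<bar>) \<partial>lborel) < \<infinity>"
    using B[of b] unfolding set_integrable_def integrable_iff_bounded by (simp add: abs_mult)
  have fin2: "(\<integral>\<^sup>+r. ennreal (M * indicator {a<..<b} r) \<partial>radial_measure) < \<infinity>"
  proof -
    have "(\<integral>\<^sup>+r. ennreal (M * indicator {a<..<b} r) \<partial>radial_measure) \<le> (\<integral>\<^sup>+r. ennreal (\<bar>b\<bar> * \<bar>M\<bar>) * indicator {a<..<b} r \<partial>lborel)"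
      unfolding radial_measure_def
    proof (subst nn_integral_density; (intro nn_integral_mono)?)
      fix r :: real
      show "ennreal r * indicator {0<..} r * ennreal (M * indicator {a<..<b} r) \<le> ennreal (\<bar>b\<bar> * \<bar>M\<bar>) * indicator {a<..<b} r"
      proof (cases "0 < r \<and> a < r \<and> r < b")
        case True
        have "\<bar>W r\<bar> \<le> M" using W[of r] True by simp
        then have M: "0 \<le> M" by linarith
        then have "r * M \<le> \<bar>b\<bar> * \<bar>M\<bar>" using True by (intro mult_mono) auto
        then show ?thesis using True M by (simp add: ennreal_mult'[symmetric] ennreal_leI)
      qed (auto simp: indicator_def)
    qed auto
    also have "\<dots> < \<infinity>"
      by (cases "a \<le> b") (auto simp: nn_integral_cmult_indicator ennreal_mult_less_top)
    finally show ?thesis .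
  qed
  have int: "integrable (lborel \<Otimes>\<^sub>M radial_measure) (case_prod k)"
  proof (rule integrableI_bounded[OF km])
    have "(\<integral>\<^sup>+z. ennreal (norm (case_prod k z)) \<partial>(lborel \<Otimes>\<^sub>M radial_measure))
        = (\<integral>\<^sup>+x. \<integral>\<^sup>+r. ennreal (norm (k x r)) \<partial>radial_measure \<partial>lborel)"
      by (subst radial.nn_integral_fst[symmetric]) auto
    also have "\<dots> \<le> (\<integral>\<^sup>+x. \<integral>\<^sup>+r. ennreal (\<bar>indicator (cball 0 b) x * B x\<bar>) * ennreal (M * indicator {a<..<b} r) \<partial>radial_measure \<partial>lborel)"
    proof (intro nn_integral_mono)
      fix x :: "real^2" and r :: real
      have "norm (k x r) \<le> \<bar>indicator (cball 0 b) x * B x\<bar> * (M * indicator {a<..<b} r)"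
      proof (cases "norm x \<le> r \<and> r < b")
        case True
        then show ?thesis using W[of r] by (auto simp: k_def abs_mult indicator_def intro!: mult_left_mono split: if_splits)
      next
        case False
        then show ?thesis using W[of r] M0[of r] by (auto simp: k_def abs_mult indicator_def split: if_splits)
      qed
      then show "ennreal (norm (k x r)) \<le> ennreal (\<bar>indicator (cball 0 b) x * B x\<bar>) * ennreal (M * indicator {a<..<b} r)"
        by (subst ennreal_mult'[symmetric]) (auto intro: ennreal_leI)
    qed
    also have "\<dots> = (\<integral>\<^sup>+x. ennreal (\<bar>indicator (cball 0 b) x * B x\<bar>) * (\<integral>\<^sup>+r. ennreal (M * indicator {a<..<b} r) \<partial>radial_measure) \<partial>lborel)"
      by (intro nn_integral_cong nn_integral_cmult) auto
    also have "\<dots> = (\<integral>\<^sup>+x. ennreal (\<bar>indicator (cball 0 b) x * B x\<bar>) \<partial>lborel) * (\<integral>\<^sup>+r. ennreal (M * indicator {a<..<b} r) \<partial>radial_measure)"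
      by (rule nn_integral_multc) auto
    also have "\<dots> < \<infinity>" using fin1 fin2 by (simp add: ennreal_mult_less_top)
    finally show "(\<integral>\<^sup>+z. ennreal (norm (case_prod k z)) \<partial>(lborel \<Otimes>\<^sub>M radial_measure)) < \<infinity>" .
  qed
  have eq: "W r * (LINT x:cball 0 r|lborel. B x) = (LINT x|lborel. k x r)" for r
  proof -
    have "(LINT x|lborel. k x r) = (LINT x|lborel. W r * (indicat_real (cball 0 r) x *\<^sub>R B x))"
      by (intro Bochner_Integration.integral_cong) (auto simp: k_def indicator_def)
    then show ?thesis by (simp add: set_lebesgue_integral_def)
  qed
  show "integrable radial_measure (\<lambda>r. W r * (LINT x:cball 0 r|lborel. B x))"
    unfolding eq using lborel_radial.integrable_snd[OF int] by simp
  show "(LINT r|radial_measure. W r * (LINT x:cball 0 r|lborel. B x))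
      = (LINT x|lborel. B x * (LINT r|radial_measure. W r * indicator {norm x..} r))"
    unfolding eq using lborel_radial.Fubini_integral[OF int] by (simp add: k_def)
qed

lemma circulation_integral:
  fixes A :: "real^2 \<Rightarrow> real^2" and W :: "real \<Rightarrow> real"
  assumes [measurable]: "tangential A \<in> borel_measurable borel" "W \<in> borel_measurable borel"
    and A: "\<And>R. set_integrable lborel (cball 0 R) (tangential A)" and W: "\<And>r. \<bar>W r\<bar> \<le> M * indicator {a<..<b} r"
  shows "integrable radial_measure (\<lambda>r. W r * (LINT t|angular_measure. tangential A (polar_pt (r, t))))"
    and "(LINT r|radial_measure. W r * (LINT t|angular_measure. tangential A (polar_pt (r, t))))
      = (LINT x|lborel. W (norm x) * tangential A x)"
proof -
  have "integrable lborel (\<lambda>x. M *\<^sub>R (indicator (cball 0 b) x *\<^sub>R tangential A x))"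
    using A[of b] unfolding set_integrable_def by (rule integrable_scaleR_right)
  then have int: "integrable lborel (\<lambda>x. W (norm x) * tangential A x)"
  proof (rule Bochner_Integration.integrable_bound)
    show "AE x in lborel. norm (W (norm x) * tangential A x) \<le> norm (M *\<^sub>R indicat_real (cball 0 b) x *\<^sub>R tangential A x)"
    proof (rule AE_I2)
      fix x :: "real^2"
      have "\<bar>W (norm x)\<bar> \<le> \<bar>M\<bar> * indicator (cball 0 b) x"
      proof (cases "norm x \<in> {a<..<b}")
        case True
        then show ?thesis using W[of "norm x"] by (simp add: indicator_def)
      next
        case False
        then show ?thesis using W[of "norm x"] by (auto simp: indicator_def)
      qed
      then have "\<bar>W (norm x)\<bar> * \<bar>tangential A x\<bar> \<le> \<bar>M\<bar> * indicator (cball 0 b) x * \<bar>tangential A x\<bar>"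
        by (rule mult_right_mono) simp
      then show "norm (W (norm x) * tangential A x) \<le> norm (M *\<^sub>R indicat_real (cball 0 b) x *\<^sub>R tangential A x)"
        by (simp add: abs_mult)
    qed
  qed measurable
  note ip = integral_polar[OF int]
  note AEpos = AE_radial_pos
  have AEeq: "AE r in radial_measure. (LINT t|angular_measure. W (norm (polar_pt (r, t))) * tangential A (polar_pt (r, t)))
     = W r * (LINT t|angular_measure. tangential A (polar_pt (r, t)))"
    using AEpos by eventually_elim simp
  have m: "(\<lambda>r. W r * (LINT t|angular_measure. tangential A (polar_pt (r, t)))) \<in> borel_measurable radial_measure"
    by measurable
  show "integrable radial_measure (\<lambda>r. W r * (LINT t|angular_measure. tangential A (polar_pt (r, t))))"
    using ip(1) AEeq m by (subst integrable_cong_AE[symmetric, OF borel_measurable_integrable[OF ip(1)]]) auto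
  show "(LINT r|radial_measure. W r * (LINT t|angular_measure. tangential A (polar_pt (r, t))))
      = (LINT x|lborel. W (norm x) * tangential A x)"
    unfolding ip(3)[symmetric] using AEeq
    by (intro integral_cong_AE[symmetric] m borel_measurable_integrable[OF ip(1)])
qed

text \<open>
  A radial test function whose derivative in \<open>|x|\<^sup>2\<close> is the prescribed bump \<open>-\<eta>\<close>, supported in the annulus
  \<open>a < |x| < b\<close>. The last conjunct writes it in the form to which the layer cake formula applies.
\<close>
lemma radial_cutoff_test_function:
  fixes n a b :: real
  assumes ab: "0 < a" "a < b" and n: "0 < n"
  defines "\<eta> \<equiv> \<lambda>s. flat 0 (n * ((s - a\<^sup>2) * (b\<^sup>2 - s)))"
  shows "\<exists>\<phi> :: real^2 \<Rightarrow> real. \<phi> \<in> test_functions \<and>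
    (\<forall>x k. partial_deriv k \<phi> x = - (2 * \<eta> ((norm x)\<^sup>2) * x $ k)) \<and>
    (\<forall>x. \<phi> x = (LINT r|radial_measure. 2 * \<eta> (r\<^sup>2) * indicator {norm x..} r))"
proof -
  define c d where "c = a\<^sup>2" and "d = b\<^sup>2"
  have cd: "0 < c" "c < d" using ab by (auto simp: c_def d_def intro: power_strict_mono)
  have flat_cont: "continuous_on UNIV (flat 0)"
    by (intro continuous_at_imp_continuous_on ballI DERIV_isCont[OF flat_deriv])
  have \<eta>c: "continuous_on UNIV \<eta>"
    unfolding \<eta>_def
    by (rule continuous_on_compose2[OF flat_cont]) (auto intro!: continuous_intros)
  have \<eta>0: "\<eta> s = 0" if "s \<notin> {c<..<d}" for s
  proof -
    have "(s - c) * (d - s) \<le> 0" using that cd by (auto simp: not_less mult_nonpos_nonneg mult_nonneg_nonpos)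
    then show ?thesis using n by (auto simp: \<eta>_def flat_def c_def d_def mult_le_0_iff)
  qed
  \<comment> \<open>Starting at \<open>-1\<close> makes \<open>\<Psi>\<close> differentiable on both sides of \<open>0\<close>, the value of \<open>|x|\<^sup>2\<close> at the origin.\<close>
  define \<Psi> where "\<Psi> s = integral {-1..s} \<eta>" for s
  have \<Psi>: "(\<Psi> has_real_derivative \<eta> s) (at s)" if "0 \<le> s" for s
  proof -
    have "(\<Psi> has_real_derivative \<eta> s) (at s within {-1..s + 1})"
      unfolding \<Psi>_def using that by (intro integral_has_real_derivative continuous_on_subset[OF \<eta>c]) auto
    then show ?thesis using that by (subst (asm) at_within_Icc_at) auto
  qed
  have \<Psi>d: "\<Psi> s = \<Psi> d" if "d \<le> s" for s
  proof -
    have int: "\<eta> integrable_on {x..y}" for x y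
      by (intro integrable_continuous_real continuous_on_subset[OF \<eta>c]) auto
    have "integral {-1..d} \<eta> + integral {d..s} \<eta> = integral {-1..s} \<eta>"
      using that cd by (intro Henstock_Kurzweil_Integration.integral_combine int) auto
    moreover have "integral {d..s} \<eta> = integral {d..s} (\<lambda>_. 0)"
      by (intro integral_cong) (auto intro!: \<eta>0)
    ultimately show ?thesis by (simp add: \<Psi>_def)
  qed
  define \<phi> where "\<phi> x = \<Psi> d - \<Psi> ((norm x)\<^sup>2)" for x :: "real^2"
  have dn: "((\<lambda>x::real^2. (norm x)\<^sup>2) has_derivative (\<lambda>h. 2 * (x \<bullet> h))) (at x)" for x
    unfolding power2_norm_eq_inner by (auto intro!: derivative_eq_intros simp: inner_commute)
  have d\<phi>: "(\<phi> has_derivative (\<lambda>h. - (\<eta> ((norm x)\<^sup>2) * (2 * (x \<bullet> h))))) (at x)" for x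
    unfolding \<phi>_def using has_derivative_compose[OF dn \<Psi>[unfolded has_field_derivative_def], of x]
    by (auto intro!: derivative_eq_intros)
  have pd: "partial_deriv k \<phi> x = - (2 * \<eta> ((norm x)\<^sup>2) * x $ k)" for k x
    using partial_deriv_eq[OF d\<phi>, of k x] by (simp add: inner_axis)
  have alg: "(\<lambda>x. (- 2) * (flat 0 (n * (((norm (x - 0))\<^sup>2 + (- a\<^sup>2)) * (b\<^sup>2 + (- 1) * (norm (x - 0))\<^sup>2))) * x $ k)) \<in> smooth_algebra" for k
    by (intro smooth_algebra.intros(1-5) smooth_algebra_norm_square)
  have "\<phi> \<in> smooth_algebra"
  proof (rule smooth_algebra.primitive; intro allI)
    show "\<phi> differentiable (at x)" for x using d\<phi> by (auto simp: differentiable_def)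
    fix k
    have "partial_deriv k \<phi> = (\<lambda>x. (- 2) * (flat 0 (n * (((norm (x - 0))\<^sup>2 + (- a\<^sup>2)) * (b\<^sup>2 + (- 1) * (norm (x - 0))\<^sup>2))) * x $ k))"
      by (simp add: fun_eq_iff pd \<eta>_def)
    then show "partial_deriv k \<phi> \<in> smooth_algebra" using alg by simp
  qed
  then have test: "\<phi> \<in> test_functions"
  proof (rule smooth_algebra_test_function[where R = b])
    fix x :: "real^2" assume "b < norm x"
    then have "d \<le> (norm x)\<^sup>2" using ab unfolding d_def by (intro power_mono) auto
    then show "\<phi> x = 0" unfolding \<phi>_def using \<Psi>d[of "(norm x)\<^sup>2"] by simp
  qed
  have layer: "\<phi> x = (LINT r|radial_measure. 2 * \<eta> (r\<^sup>2) * indicator {norm x..} r)" for x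
  proof -
    define \<rho> where "\<rho> = norm x"
    have \<rho>: "0 \<le> \<rho>" by (simp add: \<rho>_def)
    have [measurable]: "\<eta> \<in> borel_measurable borel" using \<eta>c by (rule borel_measurable_continuous_onI)
    have rad: "radial_measure = density lborel (\<lambda>r. ennreal (r * indicator {0<..} r))"
      unfolding radial_measure_def by (intro arg_cong[where f = "density lborel"]) (auto simp: indicator_def fun_eq_iff)
    have cI: "continuous_on S (\<lambda>r. 2 * r * \<eta> (r\<^sup>2))" for S
      by (intro continuous_intros continuous_on_compose2[OF \<eta>c]) auto
    have "(LINT r|radial_measure. 2 * \<eta> (r\<^sup>2) * indicator {\<rho>..} r) = (LINT r|lborel. (r * indicator {0<..} r) *\<^sub>R (2 * \<eta> (r\<^sup>2) * indicator {\<rho>..} r))"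
      unfolding rad by (rule integral_density) (auto simp: indicator_def)
    also have "\<dots> = (LINT r:{\<rho>..max \<rho> b}|lborel. 2 * r * \<eta> (r\<^sup>2))"
      unfolding set_lebesgue_integral_def
    proof (intro Bochner_Integration.integral_cong refl)
      fix r :: real
      have "\<eta> (r\<^sup>2) = 0" if "b < r"
      proof -
        have "d \<le> r\<^sup>2" using that ab unfolding d_def by (intro power_mono) auto
        then show ?thesis by (intro \<eta>0) auto
      qed
      then show "(r * indicator {0<..} r) *\<^sub>R (2 * \<eta> (r\<^sup>2) * indicator {\<rho>..} r) = indicat_real {\<rho>..max \<rho> b} r *\<^sub>R (2 * r * \<eta> (r\<^sup>2))"
        using \<rho> by (cases "r = 0") (auto simp: indicator_def max_def split: if_splits)
    qed
    also have "\<dots> = integral {\<rho>..max \<rho> b} (\<lambda>r. 2 * r * \<eta> (r\<^sup>2))"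
      by (intro set_borel_integral_eq_integral borel_integrable_atLeastAtMost' cI)
    also have "\<dots> = \<Psi> ((max \<rho> b)\<^sup>2) - \<Psi> (\<rho>\<^sup>2)"
    proof (rule integral_unique, rule fundamental_theorem_of_calculus)
      fix r assume "r \<in> {\<rho>..max \<rho> b}"
      have "((\<lambda>r. \<Psi> (r\<^sup>2)) has_real_derivative (2 * r * \<eta> (r\<^sup>2))) (at r)"
      proof -
        have "((\<lambda>r. r\<^sup>2) has_real_derivative 2 * r) (at r)" by (auto intro!: derivative_eq_intros)
        from DERIV_chain2[of \<Psi> "\<eta> (r\<^sup>2)" "\<lambda>r. r\<^sup>2" r, OF \<Psi> this] show ?thesis by (simp add: mult.commute)
      qed
      then show "((\<lambda>r. \<Psi> (r\<^sup>2)) has_vector_derivative 2 * r * \<eta> (r\<^sup>2)) (at r within {\<rho>..max \<rho> b})"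
        by (simp add: has_real_derivative_iff_has_vector_derivative has_vector_derivative_at_within)
    qed simp
    also have "\<Psi> ((max \<rho> b)\<^sup>2) = \<Psi> d"
      using ab unfolding d_def by (intro \<Psi>d[unfolded d_def] power_mono) auto
    finally show ?thesis by (simp add: \<phi>_def \<rho>_def)
  qed
  show ?thesis using test pd layer by (intro exI[of _ \<phi>] conjI allI)
qed

text \<open>
  Testing the weak curl with the radial cutoffs equates the averages of flux and circulation with the
  weights \<open>\<eta>\<^sub>n(r\<^sup>2)\<close>. As \<open>n\<close> grows these weights tend to the indicator of the interval.
\<close>
lemma circulation_eq_flux_annulus:
  fixes A :: "real^2 \<Rightarrow> real^2" and B :: "real^2 \<Rightarrow> real"
  assumes tm [measurable]: "tangential A \<in> borel_measurable borel" and Bm [measurable]: "B \<in> borel_measurable borel"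
    and A: "\<And>R. set_integrable lborel (cball 0 R) (tangential A)" and B: "\<And>R. set_integrable lborel (cball 0 R) B"
    and curl: "\<And>\<phi> :: real^2 \<Rightarrow> real. \<phi> \<in> test_functions \<Longrightarrow> (LINT x|lborel. B x * \<phi> x) =
        - (LINT x|lborel. A x $ 2 * partial_deriv 1 \<phi> x - A x $ 1 * partial_deriv 2 \<phi> x)"
    and ab: "0 < a" "a < b"
  defines "f \<equiv> \<lambda>r. (LINT x:cball 0 r|lborel. B x) - (LINT t|angular_measure. tangential A (polar_pt (r, t)))"
  shows "set_integrable radial_measure {a<..<b} f" and "(LINT r:{a<..<b}|radial_measure. f r) = 0"
proof -
  have Wi: "integrable radial_measure (\<lambda>r. W r * f r)"
      "(LINT r|radial_measure. W r * f r) = (LINT x|lborel. B x * (LINT r|radial_measure. W r * indicator {norm x..} r))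
         - (LINT x|lborel. W (norm x) * tangential A x)"
    if W [measurable]: "W \<in> borel_measurable borel" and bd: "\<And>r. \<bar>W r\<bar> \<le> M * indicator {a<..<b} r" for W M
    using flux_layer_cake[OF Bm W B bd] circulation_integral[OF tm W A bd]
    unfolding f_def by (auto simp: right_diff_distrib)
  show si: "set_integrable radial_measure {a<..<b} f"
    using Wi(1)[of "indicator {a<..<b}" 1] by (simp add: set_integrable_def)
  \<comment> \<open>The factor \<open>n + 1\<close> drives \<open>\<eta> n\<close> to the indicator of the annulus, since \<open>flat 0 s\<close> tends to \<open>1\<close> as \<open>s\<close> tends to infinity.\<close>
  define \<eta> where "\<eta> n s = flat 0 (real (Suc n) * ((s - a\<^sup>2) * (b\<^sup>2 - s)))" for n :: nat and s :: real
  have \<eta>m [measurable]: "\<eta> n \<in> borel_measurable borel" for n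
    unfolding \<eta>_def flat_def by measurable
  have pos: "0 < (r\<^sup>2 - a\<^sup>2) * (b\<^sup>2 - r\<^sup>2) \<longleftrightarrow> r \<in> {a<..<b}" if "0 < r" for r
  proof -
    have "(r\<^sup>2 - a\<^sup>2) * (b\<^sup>2 - r\<^sup>2) = (r - a) * (b - r) * ((r + a) * (b + r))"
      by (simp add: power2_eq_square algebra_simps)
    moreover have "0 < (r + a) * (b + r)" using that ab by (intro mult_pos_pos) auto
    ultimately have "0 < (r\<^sup>2 - a\<^sup>2) * (b\<^sup>2 - r\<^sup>2) \<longleftrightarrow> 0 < (r - a) * (b - r)"
      by (simp only: zero_less_mult_iff[of "(r - a) * (b - r)"]) auto
    then show ?thesis using ab by (auto simp: zero_less_mult_iff)
  qed
  define W where "W n r = 2 * \<eta> n (r\<^sup>2) * indicator {0<..} r" for n r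
  have [measurable]: "W n \<in> borel_measurable borel" for n unfolding W_def by measurable
  have Wb: "\<bar>W n r\<bar> \<le> 2 * indicator {a<..<b} r" for n r
  proof (cases "r \<in> {a<..<b}")
    case True
    then show ?thesis using flat_nonneg[of 0] flat_0_le_one by (auto simp: W_def \<eta>_def indicator_def abs_mult)
  next
    case False
    have "\<eta> n (r\<^sup>2) = 0" if "0 < r"
    proof -
      have "(r\<^sup>2 - a\<^sup>2) * (b\<^sup>2 - r\<^sup>2) \<le> 0" using pos[OF that] False by auto
      then show ?thesis by (auto simp: \<eta>_def flat_def mult_le_0_iff)
    qed
    then show ?thesis using False by (auto simp: W_def indicator_def)
  qed
  note AEpos = AE_radial_pos
  have zero: "(LINT r|radial_measure. W n r * f r) = 0" for n
  proof -
    have "\<exists>\<phi> :: real^2 \<Rightarrow> real. \<phi> \<in> test_functions \<and>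
      (\<forall>x k. partial_deriv k \<phi> x = - (2 * \<eta> n ((norm x)\<^sup>2) * x $ k)) \<and>
      (\<forall>x. \<phi> x = (LINT r|radial_measure. 2 * \<eta> n (r\<^sup>2) * indicator {norm x..} r))"
      unfolding \<eta>_def by (rule radial_cutoff_test_function[OF ab of_nat_0_less_iff[THEN iffD2, OF zero_less_Suc]])
    then obtain \<phi> :: "real^2 \<Rightarrow> real" where \<phi>: "\<phi> \<in> test_functions"
      "\<And>x k. partial_deriv k \<phi> x = - (2 * \<eta> n ((norm x)\<^sup>2) * x $ k)"
      "\<And>x. \<phi> x = (LINT r|radial_measure. 2 * \<eta> n (r\<^sup>2) * indicator {norm x..} r)"
      by blast
    have 1: "(LINT r|radial_measure. W n r * indicator {norm x..} r) = \<phi> x" for x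
      unfolding \<phi>(3) using AEpos by (intro integral_cong_AE) (auto simp: W_def)
    have 2: "A x $ 2 * partial_deriv 1 \<phi> x - A x $ 1 * partial_deriv 2 \<phi> x = - (W n (norm x) * tangential A x)" for x
      unfolding \<phi>(2) by (cases "x = 0") (auto simp: W_def tangential_def algebra_simps)
    show ?thesis
      using Wi(2)[OF _ Wb[of n]] curl[OF \<phi>(1)] unfolding 1 2 by simp
  qed
  have "(\<lambda>n. LINT r|radial_measure. W n r * f r) \<longlonglongrightarrow> (LINT r|radial_measure. 2 * (indicator {a<..<b} r * f r))"
  proof (rule integral_dominated_convergence[where w = "\<lambda>r. 2 * \<bar>indicator {a<..<b} r * f r\<bar>"])
    have i: "integrable radial_measure (\<lambda>r. indicator {a<..<b} r * f r)" using si by (simp add: set_integrable_def)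
    show "integrable radial_measure (\<lambda>r. 2 * \<bar>indicator {a<..<b} r * f r\<bar>)" using i by auto
    show "(\<lambda>r. 2 * (indicator {a<..<b} r * f r)) \<in> borel_measurable radial_measure" using i by auto
    show "(\<lambda>r. W n r * f r) \<in> borel_measurable radial_measure" for n using Wi(1)[OF _ Wb[of n]] by auto
    show "AE r in radial_measure. norm (W n r * f r) \<le> 2 * \<bar>indicator {a<..<b} r * f r\<bar>" for n
    proof (rule AE_I2)
      fix r
      show "norm (W n r * f r) \<le> 2 * \<bar>indicator {a<..<b} r * f r\<bar>"
        using mult_right_mono[OF Wb[of n r] abs_ge_zero[of "f r"]] by (simp add: abs_mult)
    qed
    show "AE r in radial_measure. (\<lambda>n. W n r * f r) \<longlonglongrightarrow> 2 * (indicator {a<..<b} r * f r)"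
      using AEpos
    proof eventually_elim
      case (elim r)
      show ?case
      proof (cases "r \<in> {a<..<b}")
        case True
        define q where "q = (r\<^sup>2 - a\<^sup>2) * (b\<^sup>2 - r\<^sup>2)"
        have q: "0 < q" using pos[OF elim] True by (simp add: q_def)
        have "(\<lambda>n. exp (- (1 / q * inverse (real (Suc n))))) \<longlonglongrightarrow> exp (- (1 / q * 0))"
          by (intro tendsto_intros LIMSEQ_inverse_real_of_nat)
        moreover have "\<eta> n (r\<^sup>2) = exp (- (1 / q * inverse (real (Suc n))))" for n
        proof -
          have "\<eta> n (r\<^sup>2) = flat 0 (real (Suc n) * q)" by (simp add: \<eta>_def q_def)
          moreover have "0 < real (Suc n) * q" using q by (intro mult_pos_pos) auto
          ultimately show ?thesis by (simp add: flat_def inverse_eq_divide mult.commute del: of_nat_Suc)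
        qed
        ultimately have "(\<lambda>n. \<eta> n (r\<^sup>2)) \<longlonglongrightarrow> 1" by simp
        then have "(\<lambda>n. 2 * \<eta> n (r\<^sup>2) * 1 * f r) \<longlonglongrightarrow> 2 * 1 * 1 * f r" by (intro tendsto_intros)
        then show ?thesis using True elim by (simp add: W_def indicator_def)
      next
        case False
        then have "W n r = 0" for n using Wb[of n r] by simp
        then show ?thesis using False by simp
      qed
    qed
  qed
  then have "(LINT r|radial_measure. 2 * (indicator {a<..<b} r * f r)) = 0"
    unfolding zero by (simp add: LIMSEQ_const_iff)
  then show "(LINT r:{a<..<b}|radial_measure. f r) = 0"
    by (simp add: set_lebesgue_integral_def)
qed

lemma borel_representative:
  fixes A :: "real^'n::finite \<Rightarrow> 'b::euclidean_space"
  assumes "A \<in> borel_measurable lebesgue"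
  obtains A' where "A' \<in> borel_measurable borel" "AE x in lborel. A x = A' x"
proof -
  have "\<exists>g\<in>borel_measurable lborel. AE x in lborel. A x \<bullet> b = g x" for b
    by (rule completion_ex_borel_measurable_real) (use assms in measurable)
  then obtain g where g: "\<And>b. g b \<in> borel_measurable lborel" "\<And>b. AE x in lborel. A x \<bullet> b = g b x" by metis
  show thesis
  proof
    have [measurable]: "g b \<in> borel_measurable borel" for b using g(1)[of b] by simp
    show "(\<lambda>x. \<Sum>b\<in>Basis. g b x *\<^sub>R b) \<in> borel_measurable borel" by measurable
    have "AE x in lborel. \<forall>b\<in>Basis. A x \<bullet> b = g b x" using g(2) by (intro AE_finite_allI) auto
    then show "AE x in lborel. A x = (\<Sum>b\<in>Basis. g b x *\<^sub>R b)"
    proof eventually_elim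
      case (elim x)
      then have "(\<Sum>b\<in>Basis. g b x *\<^sub>R b) = (\<Sum>b\<in>Basis. (A x \<bullet> b) *\<^sub>R b)" by (intro sum.cong) auto
      then show ?case by (simp add: euclidean_representation)
    qed
  qed
qed

lemma set_integrable_borel_representative:
  fixes f g :: "real^'n::finite \<Rightarrow> 'b::{banach,second_countable_topology}"
  assumes "set_integrable lebesgue C f" and [measurable]: "g \<in> borel_measurable borel" "C \<in> sets borel"
    and "AE x in lborel. f x = g x"
  shows "set_integrable lborel C g"
proof -
  have gi: "(\<lambda>x. indicator C x *\<^sub>R g x) \<in> borel_measurable lborel" by measurable
  have "AE x in lebesgue. indicator C x *\<^sub>R f x = indicator C x *\<^sub>R g x"
    using AE_completion[OF assms(4)] by eventually_elim simp
  then have "integrable lebesgue (\<lambda>x. indicator C x *\<^sub>R g x)"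
    using assms(1) measurable_completion[OF gi] unfolding set_integrable_def
    by (subst integrable_cong_AE[symmetric]) (auto intro: borel_measurable_integrable)
  then show ?thesis using gi by (simp add: set_integrable_def integrable_completion)
qed

lemma borel_measurable_vec_nth [measurable (raw)]:
  fixes f :: "'a \<Rightarrow> 'b::euclidean_space^'n::finite"
  assumes "f \<in> borel_measurable M"
  shows "(\<lambda>x. f x $ k) \<in> borel_measurable M"
  by (rule borel_measurable_continuous_on[OF _ assms, of "\<lambda>y. y $ k"]) (intro continuous_intros)

lemma abs_tangential_le: "\<bar>tangential A x\<bar> \<le> 2 * norm x * norm (A x)"
proof -
  have "\<bar>x $ i * A x $ j\<bar> \<le> norm x * norm (A x)" for i j
    unfolding abs_mult by (intro mult_mono component_le_norm_cart) auto
  then have "\<bar>tangential A x\<bar> \<le> norm x * norm (A x) + norm x * norm (A x)"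
    unfolding tangential_def by (intro order_trans[OF abs_triangle_ineq4] add_mono)
  then show ?thesis by simp
qed

text \<open>
  Stokes' theorem on almost every disc, for a potential whose curl exists only in the weak sense.
\<close>
lemma circulation_eq_flux:
  fixes A A' :: "real^2 \<Rightarrow> real^2" and B :: "real^2 \<Rightarrow> real"
  assumes A: "A \<in> L2_loc" and curl: "is_curl B A"
    and A'm [measurable]: "A' \<in> borel_measurable borel" and AA': "AE x in lborel. A x = A' x"
  shows "AE r in radial_measure. integrable angular_measure (\<lambda>t. tangential A' (polar_pt (r, t))) \<and>
     (LINT t|angular_measure. tangential A' (polar_pt (r, t))) = 2 * pi * flux B r"
proof -
  have BL: "B \<in> L1_loc" using curl by (simp add: is_curl_def)
  then have Bl: "B \<in> borel_measurable lebesgue" by (simp add: L1_loc_def)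
  obtain B' where B'm [measurable]: "B' \<in> borel_measurable borel" and BB': "AE x in lborel. B x = B' x"
    using borel_representative[OF Bl] .
  have B': "set_integrable lborel (cball 0 R) B'" for R
    by (rule set_integrable_borel_representative[OF _ B'm _ BB']) (use BL in \<open>auto simp: L1_loc_def\<close>)
  have A'2: "set_integrable lborel (cball 0 R) (\<lambda>x. (norm (A' x))\<^sup>2)" for R
  proof (rule set_integrable_borel_representative)
    show "set_integrable lebesgue (cball 0 R) (\<lambda>x. (norm (A x))\<^sup>2)" using A by (simp add: L2_loc_def)
    show "AE x in lborel. (norm (A x))\<^sup>2 = (norm (A' x))\<^sup>2" using AA' by eventually_elim simp
  qed auto
  have tm [measurable]: "tangential A' \<in> borel_measurable borel" unfolding tangential_def by measurable
  have tA: "set_integrable lborel (cball 0 R) (tangential A')" for R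
    unfolding set_integrable_def
  proof (rule Bochner_Integration.integrable_bound)
    have "integrable lborel (\<lambda>x. \<bar>R\<bar> *\<^sub>R (indicator (cball (0::real^2) R) x *\<^sub>R 1 + indicator (cball 0 R) x *\<^sub>R (norm (A' x))\<^sup>2))"
    proof (intro integrable_scaleR_right Bochner_Integration.integrable_add)
      show "integrable lborel (\<lambda>x. indicat_real (cball (0::real^2) R) x *\<^sub>R (1::real))"
        using emeasure_lborel_cball_finite[of "0::real^2" R] by (simp add: integrable_real_indicator)
      show "integrable lborel (\<lambda>x. indicat_real (cball (0::real^2) R) x *\<^sub>R (norm (A' x))\<^sup>2)"
        using A'2[of R] unfolding set_integrable_def .
    qed
    then show "integrable lborel (\<lambda>x. \<bar>R\<bar> * (indicator (cball (0::real^2) R) x * (1 + (norm (A' x))\<^sup>2)))"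
      by (simp add: distrib_left)
    show "AE x in lborel. norm (indicat_real (cball 0 R) x *\<^sub>R tangential A' x) \<le> norm (\<bar>R\<bar> * (indicator (cball (0::real^2) R) x * (1 + (norm (A' x))\<^sup>2)))"
    proof (rule AE_I2)
      fix x :: "real^2"
      show "norm (indicat_real (cball 0 R) x *\<^sub>R tangential A' x) \<le> norm (\<bar>R\<bar> * (indicator (cball (0::real^2) R) x * (1 + (norm (A' x))\<^sup>2)))"
      proof (cases "x \<in> cball 0 R")
        case True
        then have x: "norm x \<le> \<bar>R\<bar>" by auto
        have "\<bar>tangential A' x\<bar> \<le> norm x * (2 * 1 * norm (A' x))" using abs_tangential_le[of A' x] by simp
        also have "\<dots> \<le> \<bar>R\<bar> * (1\<^sup>2 + (norm (A' x))\<^sup>2)"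
          using x sum_squares_bound[of 1 "norm (A' x)"] by (intro mult_mono) auto
        finally show ?thesis using True by (simp add: abs_mult)
      qed simp
    qed
  qed (use tm in \<open>auto intro!: borel_measurable_times borel_measurable_indicator\<close>)
  have curl': "(LINT x|lborel. B' x * \<phi> x) =
        - (LINT x|lborel. A' x $ 2 * partial_deriv 1 \<phi> x - A' x $ 1 * partial_deriv 2 \<phi> x)"
    if \<phi>: "\<phi> \<in> test_functions" for \<phi> :: "real^2 \<Rightarrow> real"
  proof -
    have C: "C_k 1 \<phi>" "C_k 0 \<phi>" using \<phi> unfolding test_functions_def by auto
    then have "continuous_on UNIV \<phi>" "\<And>k. continuous_on UNIV (partial_deriv k \<phi>)" by auto
    then have [measurable]: "\<phi> \<in> borel_measurable borel" "\<And>k. partial_deriv k \<phi> \<in> borel_measurable borel"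
      by (auto intro: borel_measurable_continuous_onI)
    have m: "(\<lambda>x. B' x * \<phi> x) \<in> borel_measurable lborel"
      "(\<lambda>x. A' x $ 2 * partial_deriv 1 \<phi> x - A' x $ 1 * partial_deriv 2 \<phi> x) \<in> borel_measurable lborel" by measurable
    have [measurable]: "A \<in> borel_measurable lebesgue" using A by (simp add: L2_loc_def)
    have [measurable]: "\<phi> \<in> borel_measurable lebesgue" "\<And>k. partial_deriv k \<phi> \<in> borel_measurable lebesgue"
      by (auto intro: measurable_completion)
    note Bl [measurable]
    have "(LINT x|lborel. B' x * \<phi> x) = (LINT x|lebesgue. B' x * \<phi> x)" using m by (simp add: integral_completion)
    also have "\<dots> = (LINT x|lebesgue. B x * \<phi> x)"
    proof (rule integral_cong_AE)
      show "AE x in lebesgue. B' x * \<phi> x = B x * \<phi> x" using AE_completion[OF BB'] by eventually_elim simp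
    qed (use measurable_completion[OF m(1)] in auto)
    also have "\<dots> = - (LINT x|lebesgue. A x $ 2 * partial_deriv 1 \<phi> x - A x $ 1 * partial_deriv 2 \<phi> x)"
      using curl \<phi> unfolding is_curl_def by blast
    also have "(LINT x|lebesgue. A x $ 2 * partial_deriv 1 \<phi> x - A x $ 1 * partial_deriv 2 \<phi> x)
        = (LINT x|lebesgue. A' x $ 2 * partial_deriv 1 \<phi> x - A' x $ 1 * partial_deriv 2 \<phi> x)"
    proof (rule integral_cong_AE)
      show "AE x in lebesgue. A x $ 2 * partial_deriv 1 \<phi> x - A x $ 1 * partial_deriv 2 \<phi> x
          = A' x $ 2 * partial_deriv 1 \<phi> x - A' x $ 1 * partial_deriv 2 \<phi> x"
        using AE_completion[OF AA'] by eventually_elim simp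
      have "(\<lambda>x. A x $ k) \<in> borel_measurable lebesgue" for k
      by measurable
      then show "(\<lambda>x. A x $ 2 * partial_deriv 1 \<phi> x - A x $ 1 * partial_deriv 2 \<phi> x) \<in> borel_measurable lebesgue"
        by (intro borel_measurable_diff borel_measurable_times) auto
    qed (use measurable_completion[OF m(2)] in auto)
    also have "\<dots> = (LINT x|lborel. A' x $ 2 * partial_deriv 1 \<phi> x - A' x $ 1 * partial_deriv 2 \<phi> x)"
      using m by (simp add: integral_completion)
    finally show ?thesis .
  qed
  define f where "f r = (LINT x:cball 0 r|lborel. B' x) - (LINT t|angular_measure. tangential A' (polar_pt (r, t)))" for r
  have fl: "(LINT x:cball 0 r|lborel. B' x) = 2 * pi * flux B r" for r
  proof -
    have "(LINT x:cball 0 r|lborel. B' x) = (LINT x|lebesgue. indicat_real (cball 0 r) x *\<^sub>R B' x)"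
      unfolding set_lebesgue_integral_def
      by (subst integral_completion) (auto intro!: borel_measurable_times borel_measurable_indicator)
    also have "\<dots> = (LINT x:cball 0 r|lebesgue. B x)"
      unfolding set_lebesgue_integral_def
    proof (rule integral_cong_AE)
      show "AE x in lebesgue. indicat_real (cball 0 r) x *\<^sub>R B' x = indicat_real (cball 0 r) x *\<^sub>R B x"
        using AE_completion[OF BB'] by eventually_elim simp
      show "(\<lambda>x. indicat_real (cball 0 r) x *\<^sub>R B' x) \<in> borel_measurable lebesgue"
        by (intro measurable_completion borel_measurable_scaleR borel_measurable_indicator) auto
      show "(\<lambda>x. indicat_real (cball 0 r) x *\<^sub>R B x) \<in> borel_measurable lebesgue"
        by (intro borel_measurable_scaleR borel_measurable_indicator Bl) auto
    qed
    finally show ?thesis by (simp add: flux_def)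
  qed
  note AEpos = AE_radial_pos
  have "AE r in radial_measure. integrable angular_measure (\<lambda>t. tangential A' (polar_pt (r, t))) \<and> f r = 0"
  proof -
    \<comment> \<open>The identity holds on each annulus \<open>a m < r < b m\<close>, and these exhaust all radii.\<close>
    define a b where "a m = 1 / real (m + 1)" and "b m = real (m + 2)" for m :: nat
    have ab: "0 < a m" "a m < b m" for m by (auto simp: a_def b_def field_simps add_pos_nonneg)
    have "AE r in radial_measure. indicator {a m<..<b m} r * f r = 0" for m
    proof (rule AE_zero_if_interval_integrals_zero)
      show "sigma_finite_measure radial_measure" by (rule sigma_finite_radial)
      show "integrable radial_measure (\<lambda>r. indicat_real {a m<..<b m} r * f r)"
        using circulation_eq_flux_annulus(1)[OF tm B'm tA B' curl' ab(1)[of m] ab(2)[of m]]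
        unfolding set_integrable_def f_def by simp
      fix c d
      define c' d' where "c' = max c (a m)" and "d' = min d (b m)"
      have "(LINT x:{c<..<d}|radial_measure. indicat_real {a m<..<b m} x * f x) = (LINT x:{c'<..<d'}|radial_measure. f x)"
        unfolding set_lebesgue_integral_def
        by (intro Bochner_Integration.integral_cong) (auto simp: indicator_def c'_def d'_def)
      also have "\<dots> = 0"
      proof (cases "c' < d'")
        case True
        have "0 < c'" using ab(1)[of m] by (simp add: c'_def)
        from circulation_eq_flux_annulus(2)[OF tm B'm tA B' curl' this True] show ?thesis unfolding f_def .
      next
        case False
        then have "{c'<..<d'} = {}" by auto
        then show ?thesis by (simp add: set_lebesgue_integral_def)
      qed
      finally show "(LINT x:{c<..<d}|radial_measure. indicat_real {a m<..<b m} x * f x) = 0" .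
    qed simp
    then have 1: "AE r in radial_measure. \<forall>m. indicator {a m<..<b m} r * f r = 0" by (subst AE_all_countable) auto
    have "AE r in radial_measure. integrable angular_measure (\<lambda>t. indicat_real (cball 0 (real m)) (polar_pt (r, t)) *\<^sub>R tangential A' (polar_pt (r, t)))" for m
      using tA[of "real m"] unfolding set_integrable_def by (rule integral_polar(2))
    then have 2: "AE r in radial_measure. \<forall>m. integrable angular_measure (\<lambda>t. indicat_real (cball 0 (real m)) (polar_pt (r, t)) *\<^sub>R tangential A' (polar_pt (r, t)))"
      by (subst AE_all_countable) auto
    from 1 2 AEpos show ?thesis
    proof eventually_elim
      case (elim r)
      obtain m1 :: nat where m1: "r < real m1" using reals_Archimedean2 by blast
      obtain m2 :: nat where m2: "1 / r < real m2" using reals_Archimedean2 by blast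
      define m where "m = max m1 m2"
      have "1 / r < real (m + 1)" using m2 by (auto simp: m_def)
      then have "r \<in> {a m<..<b m}"
        using m1 elim(3) by (auto simp: a_def b_def m_def field_simps)
      then have "f r = 0" using elim(1) by (auto dest: spec[of _ m])
      moreover have "integrable angular_measure (\<lambda>t. tangential A' (polar_pt (r, t)))"
        using elim(2)[rule_format, of m1] elim(3) m1 by simp
      ultimately show ?case by simp
    qed
  qed
  then show ?thesis
    by eventually_elim (simp add: f_def fl)
qed

section \<open>Radial estimates on an interval\<close>


lemma nn_integral_radial:
  assumes [measurable]: "f \<in> borel_measurable borel"
  shows "(\<integral>\<^sup>+r. f r \<partial>radial_measure) = (\<integral>\<^sup>+r. ennreal r * indicator {0<..} r * f r \<partial>lborel)"
  unfolding radial_measure_def by (rule nn_integral_density) auto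

text \<open>
  Integrate the derivative of \<open>(r\<^sup>2 - \<alpha>\<^sup>2) p(r)\<close> over \<open>(\<alpha>, t)\<close>; the term with \<open>p'\<close> is split between \<open>p\<close> and \<open>d\<^sup>2\<close>.
  The weight vanishes at \<open>\<alpha>\<close>, so no boundary term appears there, and because it is quadratic in \<open>r\<close> the
  constants stay bounded at \<open>\<alpha> = 0\<close>, where a direct estimate of \<open>p(t) - p(r)\<close> in the energy would produce a
  logarithm of \<open>r\<close>.
\<close>
lemma radial_interval_bound:
  fixes p p' d :: "real \<Rightarrow> real"
  assumes p: "\<And>r. (p has_real_derivative p' r) (at r)" and p'c: "continuous_on UNIV p'"
    and p0: "\<And>r. 0 \<le> p r" and d [measurable]: "d \<in> borel_measurable borel"
    and dM: "\<And>r. 0 \<le> d r" "\<And>r. d r \<le> M" and pd: "\<And>r. \<bar>p' r\<bar> \<le> 2 * sqrt (p r) * d r"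
    and t: "0 \<le> \<alpha>" "\<alpha> < t"
  shows "(\<integral>\<^sup>+r. ennreal (p r) * indicator {\<alpha><..<t} r \<partial>radial_measure)
    \<le> ennreal ((t\<^sup>2 - \<alpha>\<^sup>2) * p t) + ennreal (4 * (t - \<alpha>)\<^sup>2) * (\<integral>\<^sup>+r. ennreal ((d r)\<^sup>2) * indicator {\<alpha><..<t} r \<partial>radial_measure)"
proof -
  have pc: "continuous_on UNIV p" using p by (auto intro!: continuous_at_imp_continuous_on DERIV_isCont)
  have [measurable]: "p \<in> borel_measurable borel" using pc by (rule borel_measurable_continuous_onI)
  have conv: "(\<integral>\<^sup>+r. ennreal (f r) * indicator {\<alpha><..<t} r \<partial>radial_measure) = ennreal (integral {\<alpha>..t} (\<lambda>r. r * f r))"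
    if "(\<lambda>r. r * f r) integrable_on {\<alpha>..t}" "\<And>r. 0 \<le> f r" "f \<in> borel_measurable borel" for f
  proof -
    have "(\<integral>\<^sup>+r. ennreal (f r) * indicator {\<alpha><..<t} r \<partial>radial_measure) = (\<integral>\<^sup>+r. ennreal (r * f r) * indicator {\<alpha><..<t} r \<partial>lborel)"
      using that(3) t by (subst nn_integral_radial) (auto intro!: nn_integral_cong simp: indicator_def ennreal_mult')
    also have "\<dots> = (\<integral>\<^sup>+r. ennreal (r * f r) * indicator {\<alpha>..t} r \<partial>lborel)"
    proof (rule nn_integral_cong_AE)
      show "AE r in lborel. ennreal (r * f r) * indicator {\<alpha><..<t} r = ennreal (r * f r) * indicator {\<alpha>..t} r"
        using AE_lborel_singleton[of \<alpha>] AE_lborel_singleton[of t]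
        by eventually_elim (auto simp: indicator_def)
    qed
    also have "\<dots> = ennreal (integral {\<alpha>..t} (\<lambda>r. r * f r))"
      by (rule nn_integral_has_integral_lebesgue'[OF _ integrable_integral[OF that(1)]]) (use that t in auto)
    finally show ?thesis .
  qed
  have ip: "(\<lambda>r. r * p r) integrable_on {\<alpha>..t}"
    by (intro integrable_continuous_real continuous_intros continuous_on_subset[OF pc]) auto
  have "set_integrable lborel {\<alpha>..t} (\<lambda>r. r * (d r)\<^sup>2)"
    unfolding set_integrable_def
  proof (rule integrableI_bounded_set[where A = "{\<alpha>..t}" and B = "t * M\<^sup>2"])
    show "AE x\<in>{\<alpha>..t} in lborel. norm (indicat_real {\<alpha>..t} x *\<^sub>R (x * (d x)\<^sup>2)) \<le> t * M\<^sup>2"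
      using dM t by (intro AE_I2) (auto simp: abs_mult intro!: mult_mono power_mono)
    show "emeasure lborel {\<alpha>..t} < \<infinity>" using t by simp
  qed auto
  then have id: "(\<lambda>r. r * (d r)\<^sup>2) integrable_on {\<alpha>..t}" by (rule set_borel_integral_eq_integral(1))
  have ftc: "((\<lambda>r. r * p r + (r\<^sup>2 - \<alpha>\<^sup>2) / 2 * p' r) has_integral ((t\<^sup>2 - \<alpha>\<^sup>2) / 2 * p t - (\<alpha>\<^sup>2 - \<alpha>\<^sup>2) / 2 * p \<alpha>)) {\<alpha>..t}"
    using t by (intro fundamental_theorem_of_calculus)
      (auto simp: has_real_derivative_iff_has_vector_derivative[symmetric] power2_eq_square
            intro!: derivative_eq_intros DERIV_subset[OF p])
  have pw: "r * p r \<le> 2 * (r * p r + (r\<^sup>2 - \<alpha>\<^sup>2) / 2 * p' r) + 4 * (t - \<alpha>)\<^sup>2 * (r * (d r)\<^sup>2)" if r: "r \<in> {\<alpha>..t}" for r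
  proof -
    have ra: "0 \<le> r - \<alpha>" "0 \<le> r + \<alpha>" "r + \<alpha> \<le> 2 * r" "r - \<alpha> \<le> t - \<alpha>" using r t by auto
    have "\<bar>(r\<^sup>2 - \<alpha>\<^sup>2) * p' r\<bar> = (r + \<alpha>) * (r - \<alpha>) * \<bar>p' r\<bar>"
      using ra by (simp add: abs_mult power2_eq_square square_diff_square_factored)
    also have "\<dots> \<le> (2 * r) * (t - \<alpha>) * (2 * sqrt (p r) * d r)"
      using ra pd dM p0 r t by (intro mult_mono) auto
    also have "\<dots> = r * (2 * sqrt (p r) * (2 * (t - \<alpha>) * d r))" by simp
    also have "\<dots> \<le> r * ((sqrt (p r))\<^sup>2 + (2 * (t - \<alpha>) * d r)\<^sup>2)"
      using r t by (intro mult_left_mono sum_squares_bound) auto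
    also have "\<dots> = r * p r + 4 * (t - \<alpha>)\<^sup>2 * (r * (d r)\<^sup>2)"
    proof -
      have "(2 * (t - \<alpha>) * d r)\<^sup>2 = 4 * (t - \<alpha>)\<^sup>2 * (d r)\<^sup>2"
        unfolding power_mult_distrib by simp
      then show ?thesis using p0[of r] by (simp add: distrib_left)
    qed
    finally have 1: "- ((r\<^sup>2 - \<alpha>\<^sup>2) * p' r) \<le> r * p r + 4 * (t - \<alpha>)\<^sup>2 * (r * (d r)\<^sup>2)"
      by (simp only: abs_le_iff)
    have 2: "2 * (r * p r + (r\<^sup>2 - \<alpha>\<^sup>2) / 2 * p' r) = 2 * (r * p r) + (r\<^sup>2 - \<alpha>\<^sup>2) * p' r"
      by (simp add: distrib_left)
    show ?thesis using 1 unfolding 2 by linarith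
  qed
  have "integral {\<alpha>..t} (\<lambda>r. r * p r) \<le> 2 * ((t\<^sup>2 - \<alpha>\<^sup>2) / 2 * p t - (\<alpha>\<^sup>2 - \<alpha>\<^sup>2) / 2 * p \<alpha>) + 4 * (t - \<alpha>)\<^sup>2 * integral {\<alpha>..t} (\<lambda>r. r * (d r)\<^sup>2)"
    by (rule has_integral_le[OF integrable_integral[OF ip] has_integral_add[OF has_integral_mult_right[OF ftc] has_integral_mult_right[OF integrable_integral[OF id]]]])
      (rule pw)
  also have "2 * ((t\<^sup>2 - \<alpha>\<^sup>2) / 2 * p t - (\<alpha>\<^sup>2 - \<alpha>\<^sup>2) / 2 * p \<alpha>) = (t\<^sup>2 - \<alpha>\<^sup>2) * p t" by simp
  finally have fin: "integral {\<alpha>..t} (\<lambda>r. r * p r) \<le> (t\<^sup>2 - \<alpha>\<^sup>2) * p t + 4 * (t - \<alpha>)\<^sup>2 * integral {\<alpha>..t} (\<lambda>r. r * (d r)\<^sup>2)" .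
  have "0 \<le> integral {\<alpha>..t} (\<lambda>r. r * (d r)\<^sup>2)" using t by (intro integral_nonneg id) auto
  moreover have "0 \<le> (t\<^sup>2 - \<alpha>\<^sup>2) * p t" using t p0 by (intro mult_nonneg_nonneg) auto
  ultimately show ?thesis
    using fin id ip p0 by (simp add: conv ennreal_mult'[symmetric] ennreal_plus[symmetric] ennreal_leI del: ennreal_plus)
qed

text \<open>
  The left side does not depend on \<open>t\<close>, so the preceding bound may be averaged over \<open>t\<close> in the adjacent
  interval; its boundary term becomes the integral of \<open>p\<close> there.
\<close>
lemma radial_interval_average:
  fixes p p' d :: "real \<Rightarrow> real"
  assumes p: "\<And>r. (p has_real_derivative p' r) (at r)" and p'c: "continuous_on UNIV p'"
    and p0: "\<And>r. 0 \<le> p r" and d [measurable]: "d \<in> borel_measurable borel"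
    and dM: "\<And>r. 0 \<le> d r" "\<And>r. d r \<le> M" and pd: "\<And>r. \<bar>p' r\<bar> \<le> 2 * sqrt (p r) * d r"
    and t: "0 \<le> \<alpha>" "\<alpha> < \<beta>" "\<beta> < \<gamma>"
  shows "(\<integral>\<^sup>+r. ennreal (p r) * indicator {\<alpha><..<\<beta>} r \<partial>radial_measure)
    \<le> ennreal (2 * (\<gamma> - \<alpha>) / (\<gamma> - \<beta>)) * (\<integral>\<^sup>+r. ennreal (p r) * indicator {\<beta><..<\<gamma>} r \<partial>radial_measure)
      + ennreal (4 * (\<gamma> - \<alpha>)\<^sup>2) * (\<integral>\<^sup>+r. ennreal ((d r)\<^sup>2) * indicator {\<alpha><..<\<gamma>} r \<partial>radial_measure)"
proof -
  have pc: "continuous_on UNIV p" using p by (auto intro!: continuous_at_imp_continuous_on DERIV_isCont)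
  have [measurable]: "p \<in> borel_measurable borel" using pc by (rule borel_measurable_continuous_onI)
  define X where "X = (\<integral>\<^sup>+r. ennreal (p r) * indicator {\<alpha><..<\<beta>} r \<partial>radial_measure)"
  define Y where "Y = ennreal (4 * (\<gamma> - \<alpha>)\<^sup>2) * (\<integral>\<^sup>+r. ennreal ((d r)\<^sup>2) * indicator {\<alpha><..<\<gamma>} r \<partial>radial_measure)"
  define Z where "Z = (\<integral>\<^sup>+r. ennreal (p r) * indicator {\<beta><..<\<gamma>} r \<partial>radial_measure)"
  have le: "X \<le> ennreal (2 * (\<gamma> - \<alpha>)) * ennreal (s * p s) + Y" if s: "s \<in> {\<beta><..<\<gamma>}" for s
  proof -
    have "X \<le> (\<integral>\<^sup>+r. ennreal (p r) * indicator {\<alpha><..<s} r \<partial>radial_measure)"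
      unfolding X_def using s by (intro nn_integral_mono mult_left_mono) (auto simp: indicator_def)
    also have "\<dots> \<le> ennreal ((s\<^sup>2 - \<alpha>\<^sup>2) * p s) + ennreal (4 * (s - \<alpha>)\<^sup>2) * (\<integral>\<^sup>+r. ennreal ((d r)\<^sup>2) * indicator {\<alpha><..<s} r \<partial>radial_measure)"
      using s t by (intro radial_interval_bound[OF p p'c p0 d dM pd]) auto
    also have "\<dots> \<le> ennreal (2 * (\<gamma> - \<alpha>) * (s * p s)) + Y"
      unfolding Y_def
    proof (rule add_mono)
      have "s\<^sup>2 - \<alpha>\<^sup>2 = (s - \<alpha>) * (s + \<alpha>)" by (simp add: power2_eq_square algebra_simps)
      also have "\<dots> \<le> (\<gamma> - \<alpha>) * (2 * s)" using s t by (intro mult_mono) auto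
      finally have "(s\<^sup>2 - \<alpha>\<^sup>2) * p s \<le> (\<gamma> - \<alpha>) * (2 * s) * p s"
        using p0[of s] by (rule mult_right_mono)
      then show "ennreal ((s\<^sup>2 - \<alpha>\<^sup>2) * p s) \<le> ennreal (2 * (\<gamma> - \<alpha>) * (s * p s))"
        by (intro ennreal_leI) (simp add: algebra_simps)
      have "4 * (s - \<alpha>)\<^sup>2 \<le> 4 * (\<gamma> - \<alpha>)\<^sup>2" using s t by (intro mult_left_mono power_mono) auto
      then show "ennreal (4 * (s - \<alpha>)\<^sup>2) * (\<integral>\<^sup>+r. ennreal ((d r)\<^sup>2) * indicator {\<alpha><..<s} r \<partial>radial_measure)
        \<le> ennreal (4 * (\<gamma> - \<alpha>)\<^sup>2) * (\<integral>\<^sup>+r. ennreal ((d r)\<^sup>2) * indicator {\<alpha><..<\<gamma>} r \<partial>radial_measure)"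
        using s by (intro mult_mono ennreal_leI nn_integral_mono mult_left_mono) (auto simp: indicator_def)
    qed
    finally show ?thesis using s t by (simp add: ennreal_mult')
  qed
  have "X * ennreal (\<gamma> - \<beta>) = (\<integral>\<^sup>+s. X * indicator {\<beta><..<\<gamma>} s \<partial>lborel)"
    using t by (simp add: nn_integral_cmult_indicator)
  also have "\<dots> \<le> (\<integral>\<^sup>+s. ennreal (2 * (\<gamma> - \<alpha>)) * (ennreal (s * p s) * indicator {\<beta><..<\<gamma>} s) + Y * indicator {\<beta><..<\<gamma>} s \<partial>lborel)"
    using le by (intro nn_integral_mono) (auto simp: indicator_def)
  also have "\<dots> = ennreal (2 * (\<gamma> - \<alpha>)) * (\<integral>\<^sup>+s. ennreal (s * p s) * indicator {\<beta><..<\<gamma>} s \<partial>lborel) + Y * ennreal (\<gamma> - \<beta>)"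
    using t by (subst nn_integral_add) (auto simp: nn_integral_cmult nn_integral_cmult_indicator)
  also have "(\<integral>\<^sup>+s. ennreal (s * p s) * indicator {\<beta><..<\<gamma>} s \<partial>lborel) = Z"
    unfolding Z_def using t by (subst nn_integral_radial) (auto intro!: nn_integral_cong simp: indicator_def ennreal_mult')
  finally have main: "X * ennreal (\<gamma> - \<beta>) \<le> ennreal (2 * (\<gamma> - \<alpha>)) * Z + Y * ennreal (\<gamma> - \<beta>)" .
  have inv: "ennreal (\<gamma> - \<beta>) * ennreal (1 / (\<gamma> - \<beta>)) = 1"
    using t by (subst ennreal_mult'[symmetric]) auto
  have "X = X * (ennreal (\<gamma> - \<beta>) * ennreal (1 / (\<gamma> - \<beta>)))" using inv by simp
  also have "\<dots> = X * ennreal (\<gamma> - \<beta>) * ennreal (1 / (\<gamma> - \<beta>))" by (simp add: mult.assoc)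
  also have "\<dots> \<le> (ennreal (2 * (\<gamma> - \<alpha>)) * Z + Y * ennreal (\<gamma> - \<beta>)) * ennreal (1 / (\<gamma> - \<beta>))"
    using main by (rule mult_right_mono) auto
  also have "\<dots> = ennreal (2 * (\<gamma> - \<alpha>)) * ennreal (1 / (\<gamma> - \<beta>)) * Z + Y * (ennreal (\<gamma> - \<beta>) * ennreal (1 / (\<gamma> - \<beta>)))"
    by (simp add: algebra_simps)
  also have "ennreal (2 * (\<gamma> - \<alpha>)) * ennreal (1 / (\<gamma> - \<beta>)) = ennreal (2 * (\<gamma> - \<alpha>) / (\<gamma> - \<beta>))"
    using t by (subst ennreal_mult'[symmetric]) auto
  finally show ?thesis unfolding inv X_def Y_def Z_def by simp
qed

text \<open>
  The one-dimensional estimate on each ray, integrated over the angle.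
\<close>
lemma annulus_bound:
  fixes P d :: "real^2 \<Rightarrow> real" and g :: "real^2 \<Rightarrow> real^2"
  assumes P: "\<And>x. (P has_derivative (\<lambda>h. g x \<bullet> h)) (at x)" and g: "continuous_on UNIV g"
    and P0: "\<And>x. 0 \<le> P x" and d [measurable]: "d \<in> borel_measurable borel"
    and dM: "\<And>x. 0 \<le> d x" "\<And>x. d x \<le> M" and gd: "\<And>x. norm (g x) \<le> 2 * sqrt (P x) * d x"
    and t: "0 \<le> \<alpha>" "\<alpha> < \<beta>" "\<beta> < \<gamma>"
  shows "(\<integral>\<^sup>+x. ennreal (P x) * indicator {\<alpha><..<\<beta>} (norm x) \<partial>lborel)
    \<le> ennreal (2 * (\<gamma> - \<alpha>) / (\<gamma> - \<beta>)) * (\<integral>\<^sup>+x. ennreal (P x) * indicator {\<beta><..<\<gamma>} (norm x) \<partial>lborel)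
      + ennreal (4 * (\<gamma> - \<alpha>)\<^sup>2) * (\<integral>\<^sup>+x. ennreal ((d x)\<^sup>2) * indicator {\<alpha><..<\<gamma>} (norm x) \<partial>lborel)"
proof -
  have Pc: "continuous_on UNIV P" using P by (auto intro!: continuous_at_imp_continuous_on has_derivative_continuous)
  have [measurable]: "P \<in> borel_measurable borel" using Pc by (rule borel_measurable_continuous_onI)
  have polm [measurable]: "(\<lambda>r. polar_pt (r, s)) \<in> borel_measurable borel" "(\<lambda>s. polar_pt (r, s)) \<in> borel_measurable borel" for r s
    by (auto intro!: measurable_compose[OF _ borel_measurable_pol] borel_measurable_Pair)
  have rad: "(\<integral>\<^sup>+r. ennreal (f (polar_pt (r, s))) * indicator {a<..<b} (norm (polar_pt (r, s))) \<partial>radial_measure)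
      = (\<integral>\<^sup>+r. ennreal (f (polar_pt (r, s))) * indicator {a<..<b} r \<partial>radial_measure)"
    if [measurable]: "f \<in> borel_measurable borel" and "0 \<le> a" for f :: "real^2 \<Rightarrow> real" and a b s
    by (subst (1 2) nn_integral_radial) (auto intro!: nn_integral_cong simp: indicator_def)
  have one: "(\<integral>\<^sup>+r. ennreal (P (polar_pt (r, s))) * indicator {\<alpha><..<\<beta>} (norm (polar_pt (r, s))) \<partial>radial_measure)
    \<le> ennreal (2 * (\<gamma> - \<alpha>) / (\<gamma> - \<beta>)) * (\<integral>\<^sup>+r. ennreal (P (polar_pt (r, s))) * indicator {\<beta><..<\<gamma>} (norm (polar_pt (r, s))) \<partial>radial_measure)
      + ennreal (4 * (\<gamma> - \<alpha>)\<^sup>2) * (\<integral>\<^sup>+r. ennreal ((d (polar_pt (r, s)))\<^sup>2) * indicator {\<alpha><..<\<gamma>} (norm (polar_pt (r, s))) \<partial>radial_measure)" for s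
  proof -
    define e where "e = plane_pt (cos s, sin s)"
    have pe: "polar_pt (r, s) = r *\<^sub>R e" for r by (rule vec2_eqI) (auto simp: e_def)
    have ne: "norm e = 1" by (simp add: norm_vec2 e_def)
    have "((\<lambda>r. P (r *\<^sub>R e)) has_derivative (\<lambda>h. g (r *\<^sub>R e) \<bullet> (h *\<^sub>R e))) (at r)" for r
      by (rule has_derivative_compose[OF _ P]) (auto intro!: derivative_eq_intros)
    then have der: "((\<lambda>r. P (r *\<^sub>R e)) has_real_derivative (g (r *\<^sub>R e) \<bullet> e)) (at r)" for r
      by (rule has_derivative_imp_has_field_derivative) simp
    have cg: "continuous_on UNIV (\<lambda>r. g (r *\<^sub>R e) \<bullet> e)"
      by (intro continuous_intros continuous_on_compose2[OF g]) auto
    have bd: "\<bar>g (r *\<^sub>R e) \<bullet> e\<bar> \<le> 2 * sqrt (P (r *\<^sub>R e)) * d (r *\<^sub>R e)" for r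
      using Cauchy_Schwarz_ineq2[of "g (r *\<^sub>R e)" e] gd[of "r *\<^sub>R e"] by (simp add: ne)
    have [measurable]: "(\<lambda>r. d (r *\<^sub>R e)) \<in> borel_measurable borel" by measurable
    have t': "0 \<le> \<beta>" "0 \<le> \<alpha>" using t by auto
    show ?thesis
      unfolding rad[OF \<open>P \<in> borel_measurable borel\<close> t'(1)] rad[OF \<open>P \<in> borel_measurable borel\<close> t'(2)]
        rad[of "\<lambda>x. (d x)\<^sup>2", OF borel_measurable_power[OF d] t'(2)]
      unfolding pe
      by (rule radial_interval_average[OF der cg P0 _ dM bd t]) measurable
  qed
  define N where "N f a b s = (\<integral>\<^sup>+r. ennreal (f (polar_pt (r, s))) * indicator {a<..<b} (norm (polar_pt (r, s))) \<partial>radial_measure)"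
    for f :: "real^2 \<Rightarrow> real" and a b s
  have N: "N f a b \<in> borel_measurable angular_measure"
      "(\<integral>\<^sup>+x. ennreal (f x) * indicator {a<..<b} (norm x) \<partial>lborel) = (\<integral>\<^sup>+s. N f a b s \<partial>angular_measure)"
    if [measurable]: "f \<in> borel_measurable borel" for f a b
  proof -
    show "N f a b \<in> borel_measurable angular_measure" unfolding N_def by measurable
    show "(\<integral>\<^sup>+x. ennreal (f x) * indicator {a<..<b} (norm x) \<partial>lborel) = (\<integral>\<^sup>+s. N f a b s \<partial>angular_measure)"
      unfolding N_def by (rule nn_integral_polar(2)) measurable
  qed
  have dm: "(\<lambda>x. (d x)\<^sup>2) \<in> borel_measurable borel" by measurable
  have "(\<integral>\<^sup>+s. N P \<alpha> \<beta> s \<partial>angular_measure) \<le> (\<integral>\<^sup>+s. ennreal (2 * (\<gamma> - \<alpha>) / (\<gamma> - \<beta>)) * N P \<beta> \<gamma> s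
      + ennreal (4 * (\<gamma> - \<alpha>)\<^sup>2) * N (\<lambda>x. (d x)\<^sup>2) \<alpha> \<gamma> s \<partial>angular_measure)"
    unfolding N_def by (intro nn_integral_mono one)
  also have "\<dots> = ennreal (2 * (\<gamma> - \<alpha>) / (\<gamma> - \<beta>)) * (\<integral>\<^sup>+s. N P \<beta> \<gamma> s \<partial>angular_measure)
      + ennreal (4 * (\<gamma> - \<alpha>)\<^sup>2) * (\<integral>\<^sup>+s. N (\<lambda>x. (d x)\<^sup>2) \<alpha> \<gamma> s \<partial>angular_measure)"
    using N(1)[OF \<open>P \<in> borel_measurable borel\<close>] N(1)[OF dm]
    by (subst nn_integral_add) (auto simp: nn_integral_cmult)
  finally show ?thesis
    unfolding N(2)[OF \<open>P \<in> borel_measurable borel\<close>] N(2)[OF dm] .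
qed

section \<open>Continuously differentiable functions and the diamagnetic inequality\<close>

text \<open>
  This class contains the test functions and also the mollified and cut off approximants of Sobolev
  functions, so that the main estimates need to be proved only once.
\<close>
definition C1_compact :: "(real^2 \<Rightarrow> complex) set" where
  "C1_compact = {u. (\<forall>x. u differentiable (at x)) \<and> (\<forall>k. continuous_on UNIV (partial_deriv k u)) \<and>
      (\<exists>R. \<forall>x. R < norm x \<longrightarrow> u x = 0)}"

text \<open>
  The gradient of \<open>|u|\<^sup>2\<close>.
\<close>
definition grad_sq :: "(real^2 \<Rightarrow> complex) \<Rightarrow> real^2 \<Rightarrow> real^2" where
  "grad_sq u x = (\<chi> k. 2 * (u x \<bullet> partial_deriv k u x))"

text \<open>
  The length of \<open>\<nabla>|u|\<close>, with the value \<open>0\<close> where \<open>u\<close> vanishes; there \<open>\<nabla>|u|\<^sup>2\<close> vanishes as well, so the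
  identity \<open>|\<nabla>|u|\<^sup>2| = 2 |u| |\<nabla>|u||\<close> holds everywhere.
\<close>
definition grad_abs :: "(real^2 \<Rightarrow> complex) \<Rightarrow> real^2 \<Rightarrow> real" where
  "grad_abs u x = (if u x = 0 then 0 else norm (grad_sq u x) / (2 * norm (u x)))"

lemma C1_has_derivative:
  fixes u :: "real^2 \<Rightarrow> 'b::real_normed_vector"
  assumes "u differentiable (at x)"
  shows "(u has_derivative (\<lambda>h. h $ 1 *\<^sub>R partial_deriv 1 u x + h $ 2 *\<^sub>R partial_deriv 2 u x)) (at x)"
proof -
  let ?D = "frechet_derivative u (at x)"
  have D: "(u has_derivative ?D) (at x)" using assms by (simp add: frechet_derivative_works)
  interpret linear ?D using D by (rule has_derivative_linear)
  have "?D h = h $ 1 *\<^sub>R partial_deriv 1 u x + h $ 2 *\<^sub>R partial_deriv 2 u x" for h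
  proof -
    have "h = h $ 1 *\<^sub>R axis 1 1 + h $ 2 *\<^sub>R axis 2 1" by (rule vec2_eqI) (auto simp: axis_def)
    then have "?D h = ?D (h $ 1 *\<^sub>R axis 1 1 + h $ 2 *\<^sub>R axis 2 1)" by simp
    then show ?thesis by (simp add: add scale partial_deriv_def)
  qed
  then have "?D = (\<lambda>h. h $ 1 *\<^sub>R partial_deriv 1 u x + h $ 2 *\<^sub>R partial_deriv 2 u x)" by (rule ext)
  with D show ?thesis by simp
qed

lemma C1_compactD:
  assumes "u \<in> C1_compact"
  shows "u differentiable (at x)" "continuous_on UNIV (partial_deriv k u)" "continuous_on UNIV u"
  using assms by (auto simp: C1_compact_def intro!: continuous_at_imp_continuous_on differentiable_imp_continuous_within)

lemma grad_sq_derivative: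
  assumes u: "u \<in> C1_compact"
  shows "((\<lambda>x. (norm (u x))\<^sup>2) has_derivative (\<lambda>h. grad_sq u x \<bullet> h)) (at x)"
    and "continuous_on UNIV (grad_sq u)"
proof -
  have "((\<lambda>x. u x \<bullet> u x) has_derivative (\<lambda>h. u x \<bullet> (h $ 1 *\<^sub>R partial_deriv 1 u x + h $ 2 *\<^sub>R partial_deriv 2 u x)
      + (h $ 1 *\<^sub>R partial_deriv 1 u x + h $ 2 *\<^sub>R partial_deriv 2 u x) \<bullet> u x)) (at x)"
    by (rule has_derivative_inner[OF C1_has_derivative C1_has_derivative]) (rule C1_compactD[OF u])+
  then show "((\<lambda>x. (norm (u x))\<^sup>2) has_derivative (\<lambda>h. grad_sq u x \<bullet> h)) (at x)"
    unfolding power2_norm_eq_inner grad_sq_def inner_vec_def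
    by (simp add: sum_2 inner_add_left inner_add_right inner_commute algebra_simps)
  show "continuous_on UNIV (grad_sq u)"
    unfolding grad_sq_def by (intro continuous_on_vec_lambda continuous_intros C1_compactD[OF u])
qed

lemma norm_grad_sq: "norm (grad_sq u x) = 2 * norm (u x) * grad_abs u x"
proof (cases "u x = 0")
  case True
  then have "grad_sq u x = 0" by (intro vec2_eqI) (auto simp: grad_sq_def)
  then show ?thesis using True by simp
qed (simp add: grad_abs_def)

lemma grad_abs_nonneg: "0 \<le> grad_abs u x"
  by (simp add: grad_abs_def)

text \<open>
  The diamagnetic inequality. For a real potential \<open>i A u\<close> is orthogonal to \<open>u\<close>, so the potential may be inserted
  in \<open>Re (cnj u \<nabla>u)\<close> without changing it.
\<close>
lemma grad_abs_le_magnetic: "grad_abs u x \<le> norm (magnetic_gradient A u (grad u) x)"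
proof (cases "u x = 0")
  case False
  let ?m = "magnetic_gradient A u (grad u) x"
  have le: "\<bar>u x \<bullet> partial_deriv k u x\<bar> \<le> norm (u x) * norm (?m $ k)" for k
  proof -
    have ii: "\<i> * (\<i> * z) = - z" for z by (simp add: mult.assoc[symmetric])
    have "?m $ k = \<i> * (partial_deriv k u x - \<i> * of_real (A x $ k) * u x)"
      by (simp add: magnetic_gradient_def grad_def right_diff_distrib mult.assoc ii)
    then have n: "norm (?m $ k) = norm (partial_deriv k u x - \<i> * of_real (A x $ k) * u x)"
      by (simp only: norm_mult) simp
    have "u x \<bullet> (\<i> * of_real (A x $ k) * u x) = 0" by (simp add: inner_complex_def)
    then have "u x \<bullet> partial_deriv k u x = u x \<bullet> (partial_deriv k u x - \<i> * of_real (A x $ k) * u x)"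
      by (simp add: inner_diff_right)
    also have "\<bar>\<dots>\<bar> \<le> norm (u x) * norm (?m $ k)" unfolding n by (rule Cauchy_Schwarz_ineq2)
    finally show ?thesis .
  qed
  have "norm (grad_sq u x) = norm (\<chi> k. 2 * (u x \<bullet> partial_deriv k u x))" by (simp add: grad_sq_def)
  also have "\<dots> \<le> norm ((2 * norm (u x)) *\<^sub>R (\<chi> k. norm (?m $ k)))"
    using le by (intro norm_le_componentwise_cart) (auto simp: abs_mult)
  also have "\<dots> = 2 * norm (u x) * norm ?m"
    by (simp add: norm_vec_def[of ?m] norm_vec_def[of "\<chi> k. norm (?m $ k)"])
  finally show ?thesis using False by (simp add: grad_abs_def field_simps)
qed (simp add: grad_abs_def)

lemma magnetic_gradient_zero: "magnetic_gradient (\<lambda>_. 0) u G x = (\<chi> k. \<i> * G x $ k)"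
  by (simp add: magnetic_gradient_def)

lemma norm_i_vec: "norm (\<chi> k. \<i> * z $ k :: complex^'n::finite) = norm z"
  by (simp add: norm_vec_def norm_mult)

lemma grad_abs_le_grad: "grad_abs u x \<le> norm (grad u x)"
  using grad_abs_le_magnetic[of u x "\<lambda>_. 0"] by (simp add: magnetic_gradient_zero norm_i_vec[of "grad u x"])

lemma continuous_grad: "u \<in> C1_compact \<Longrightarrow> continuous_on UNIV (grad u)"
  unfolding grad_def by (intro continuous_on_vec_lambda C1_compactD)

lemma C1_compact_support:
  assumes "u \<in> C1_compact"
  obtains R where "\<And>x. R < norm x \<Longrightarrow> u x = 0" "\<And>x. R < norm x \<Longrightarrow> grad u x = 0"
proof -
  obtain R where R: "\<And>x. R < norm x \<Longrightarrow> u x = 0" using assms by (auto simp: C1_compact_def)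
  have "grad u x = 0" if x: "R < norm x" for x
  proof -
    have "open {x::real^2. R < norm x}" by (intro open_Collect_less continuous_intros)
    from has_derivative_transform_within_open[OF has_derivative_const[of "0::complex"] this, of x u] x R
    have "(u has_derivative (\<lambda>_. 0)) (at x)" by auto
    then show ?thesis by (intro vec2_eqI) (auto simp: grad_def partial_deriv_eq)
  qed
  with R that show thesis by blast
qed

lemma C1_compact_bounded:
  assumes u: "u \<in> C1_compact"
  obtains M where "0 \<le> M" "\<And>x. norm (u x) \<le> M" "\<And>x. norm (grad u x) \<le> M"
proof -
  obtain R where R: "\<And>x. R < norm x \<Longrightarrow> u x = 0" "\<And>x. R < norm x \<Longrightarrow> grad u x = 0"
    by (rule C1_compact_support[OF u]) (rule that)
  have "bounded (u ` cball 0 R)" "bounded (grad u ` cball 0 R)"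
    using continuous_grad[OF u] C1_compactD(3)[OF u]
    by (auto intro!: compact_imp_bounded compact_continuous_image intro: continuous_on_subset)
  then obtain a b where "\<forall>y\<in>u ` cball 0 R. norm y \<le> a" "\<forall>y\<in>grad u ` cball 0 R. norm y \<le> b"
    unfolding bounded_iff by blast
  then have ab: "\<And>x. x \<in> cball 0 R \<Longrightarrow> norm (u x) \<le> a" "\<And>x. x \<in> cball 0 R \<Longrightarrow> norm (grad u x) \<le> b"
    by auto
  show thesis
  proof (rule that[of "max 0 (max a b)"])
    fix x
    show "norm (u x) \<le> max 0 (max a b)" "norm (grad u x) \<le> max 0 (max a b)"
      using ab[of x] R[of x] by (cases "R < norm x"; force)+
  qed simp
qed

lemma borel_measurable_C1:
  assumes u: "u \<in> C1_compact"
  shows "u \<in> borel_measurable borel" "partial_deriv k u \<in> borel_measurable borel" "grad u \<in> borel_measurable borel"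
    "grad_sq u \<in> borel_measurable borel" "grad_abs u \<in> borel_measurable borel"
proof -
  show [measurable]: "u \<in> borel_measurable borel" "partial_deriv k u \<in> borel_measurable borel" "grad u \<in> borel_measurable borel"
    "grad_sq u \<in> borel_measurable borel"
    using C1_compactD[OF u] continuous_grad[OF u] grad_sq_derivative(2)[OF u] by (auto intro!: borel_measurable_continuous_onI)
  show "grad_abs u \<in> borel_measurable borel" unfolding grad_abs_def by measurable
qed

abbreviation magnetic_energy ::
    "(real^2 \<Rightarrow> real^2) \<Rightarrow> (real^2 \<Rightarrow> complex) \<Rightarrow> (real^2 \<Rightarrow> complex^2) \<Rightarrow> ennreal" where
  "magnetic_energy A u G \<equiv> (\<integral>\<^sup>+x. ennreal ((norm (magnetic_gradient A u G x))\<^sup>2) \<partial>lborel)"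

lemma borel_measurable_magnetic_gradient:
  assumes A: "A \<in> borel_measurable M" and u: "u \<in> borel_measurable M" and G: "G \<in> borel_measurable M"
  shows "magnetic_gradient A u G \<in> borel_measurable M"
proof -
  note [measurable] = A u G
  have m: "(\<lambda>x. \<i> * G x $ k + of_real (A x $ k) * u x) \<in> borel_measurable M" for k by measurable
  show ?thesis
  proof (subst borel_measurable_euclidean_space, intro ballI)
    fix b :: "complex^2" assume "b \<in> Basis"
    then obtain k c where b: "b = axis k c" by (auto simp: Basis_vec_def)
    have "(\<lambda>x. magnetic_gradient A u G x \<bullet> b) = (\<lambda>x. (\<i> * G x $ k + of_real (A x $ k) * u x) \<bullet> c)"
      unfolding b inner_axis by (simp add: magnetic_gradient_def)
    then show "(\<lambda>x. magnetic_gradient A u G x \<bullet> b) \<in> borel_measurable M"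
      using borel_measurable_inner[OF m borel_measurable_const] by simp
  qed
qed

text \<open>
  A bad annulus \<open>\<alpha> < |x| < \<beta>\<close> is controlled by the good annulus of proportional width that follows it.
  Throughout both, \<open>1 + |x|\<close> is comparable with \<open>1 + \<alpha>\<close>, because \<open>\<beta> - \<alpha> \<le> K (1 + \<alpha>)\<close>; so the weights may be
  treated as constants.
\<close>
lemma weighted_annulus_bound:
  assumes u: "u \<in> C1_compact" and K: "1 \<le> K" and ab: "0 \<le> \<alpha>" "\<alpha> < \<beta>" "\<beta> - \<alpha> \<le> K * (1 + \<alpha>)"
  defines "\<gamma> \<equiv> \<beta> + (\<beta> - \<alpha>) / K"
  shows "(\<integral>\<^sup>+x. ennreal ((norm (u x))\<^sup>2 / (1 + (norm x)\<^sup>2)) * indicator {\<alpha><..<\<beta>} (norm x) \<partial>lborel)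
    \<le> ennreal (4 * (K + 1) * (K + 2)\<^sup>2) * (\<integral>\<^sup>+x. ennreal ((norm (u x))\<^sup>2 / (norm x)\<^sup>2) * indicator {\<beta><..<\<gamma>} (norm x) \<partial>lborel)
      + ennreal (8 * (K + 1)\<^sup>2) * (\<integral>\<^sup>+x. ennreal ((grad_abs u x)\<^sup>2) * indicator {\<alpha><..<\<gamma>} (norm x) \<partial>lborel)"
proof -
  note [measurable] = borel_measurable_C1[OF u]
  obtain M where "0 \<le> M" "\<And>x. norm (u x) \<le> M" and M: "\<And>x. norm (grad u x) \<le> M"
    by (rule C1_compact_bounded[OF u]) (rule that)
  define L where "L = \<beta> - \<alpha>"
  have L: "0 < L" "L \<le> K * (1 + \<alpha>)" using ab by (auto simp: L_def)
  have g: "\<beta> < \<gamma>" "\<gamma> - \<beta> = L / K" "\<gamma> - \<alpha> = L * (K + 1) / K" using L K by (auto simp: \<gamma>_def L_def field_simps)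
  have gle: "\<gamma> - \<alpha> \<le> (K + 1) * (1 + \<alpha>)"
  proof -
    have "L / K * (K + 1) \<le> (1 + \<alpha>) * (K + 1)" using L K by (intro mult_right_mono) (auto simp: field_simps)
    then show ?thesis unfolding g by (simp add: mult.commute)
  qed
  have a1: "0 < 1 + \<alpha>" using ab by simp
  have "(\<integral>\<^sup>+x. ennreal ((norm (u x))\<^sup>2) * indicator {\<alpha><..<\<beta>} (norm x) \<partial>lborel)
    \<le> ennreal (2 * (\<gamma> - \<alpha>) / (\<gamma> - \<beta>)) * (\<integral>\<^sup>+x. ennreal ((norm (u x))\<^sup>2) * indicator {\<beta><..<\<gamma>} (norm x) \<partial>lborel)
      + ennreal (4 * (\<gamma> - \<alpha>)\<^sup>2) * (\<integral>\<^sup>+x. ennreal ((grad_abs u x)\<^sup>2) * indicator {\<alpha><..<\<gamma>} (norm x) \<partial>lborel)"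
    by (rule annulus_bound[OF grad_sq_derivative[OF u], where M = M])
       (use ab g grad_abs_nonneg order_trans[OF grad_abs_le_grad M] in \<open>auto simp: norm_grad_sq\<close>)
  also have "2 * (\<gamma> - \<alpha>) / (\<gamma> - \<beta>) = 2 * (K + 1)" unfolding g using L K by (simp add: field_simps)
  finally have base: "(\<integral>\<^sup>+x. ennreal ((norm (u x))\<^sup>2) * indicator {\<alpha><..<\<beta>} (norm x) \<partial>lborel)
    \<le> ennreal (2 * (K + 1)) * (\<integral>\<^sup>+x. ennreal ((norm (u x))\<^sup>2) * indicator {\<beta><..<\<gamma>} (norm x) \<partial>lborel)
      + ennreal (4 * (\<gamma> - \<alpha>)\<^sup>2) * (\<integral>\<^sup>+x. ennreal ((grad_abs u x)\<^sup>2) * indicator {\<alpha><..<\<gamma>} (norm x) \<partial>lborel)" .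
  define c where "c = 2 / (1 + \<alpha>)\<^sup>2"
  have c: "0 \<le> c" by (simp add: c_def)
  have "(\<integral>\<^sup>+x. ennreal ((norm (u x))\<^sup>2 / (1 + (norm x)\<^sup>2)) * indicator {\<alpha><..<\<beta>} (norm x) \<partial>lborel)
    \<le> (\<integral>\<^sup>+x. ennreal c * (ennreal ((norm (u x))\<^sup>2) * indicator {\<alpha><..<\<beta>} (norm x)) \<partial>lborel)"
  proof (rule nn_integral_mono)
    fix x :: "real^2"
    show "ennreal ((norm (u x))\<^sup>2 / (1 + (norm x)\<^sup>2)) * indicator {\<alpha><..<\<beta>} (norm x) \<le> ennreal c * (ennreal ((norm (u x))\<^sup>2) * indicator {\<alpha><..<\<beta>} (norm x))"
    proof (cases "norm x \<in> {\<alpha><..<\<beta>}")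
      case True
      have "(1 + \<alpha>)\<^sup>2 \<le> (1 + norm x)\<^sup>2" using True ab by (intro power_mono) auto
      also have "\<dots> \<le> 2 * (1 + (norm x)\<^sup>2)" using sum_squares_bound[of 1 "norm x"] by (simp add: power2_sum)
      finally have "(norm (u x))\<^sup>2 * (1 + \<alpha>)\<^sup>2 \<le> (norm (u x))\<^sup>2 * (2 * (1 + (norm x)\<^sup>2))" by (rule mult_left_mono) simp
      then have "(norm (u x))\<^sup>2 / (1 + (norm x)\<^sup>2) \<le> c * (norm (u x))\<^sup>2"
      proof -
        have "a / y \<le> 2 / z * a" if "a * z \<le> a * (2 * y)" "0 < y" "0 < z" for a y z :: real
          using that by (simp add: field_simps)
        from this[OF \<open>(norm (u x))\<^sup>2 * (1 + \<alpha>)\<^sup>2 \<le> (norm (u x))\<^sup>2 * (2 * (1 + (norm x)\<^sup>2))\<close>] show ?thesis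
          using a1 by (simp add: c_def add_pos_nonneg)
      qed
      then show ?thesis using True c by (simp add: ennreal_mult'[symmetric] ennreal_leI)
    qed simp
  qed
  also have "\<dots> = ennreal c * (\<integral>\<^sup>+x. ennreal ((norm (u x))\<^sup>2) * indicator {\<alpha><..<\<beta>} (norm x) \<partial>lborel)"
    by (rule nn_integral_cmult) measurable
  also have "\<dots> \<le> ennreal c * (ennreal (2 * (K + 1)) * (\<integral>\<^sup>+x. ennreal ((norm (u x))\<^sup>2) * indicator {\<beta><..<\<gamma>} (norm x) \<partial>lborel)
      + ennreal (4 * (\<gamma> - \<alpha>)\<^sup>2) * (\<integral>\<^sup>+x. ennreal ((grad_abs u x)\<^sup>2) * indicator {\<alpha><..<\<gamma>} (norm x) \<partial>lborel))"
    by (rule mult_left_mono[OF base]) simp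
  also have "\<dots> = (\<integral>\<^sup>+x. ennreal (c * (2 * (K + 1))) * (ennreal ((norm (u x))\<^sup>2) * indicator {\<beta><..<\<gamma>} (norm x)) \<partial>lborel)
      + ennreal (c * (4 * (\<gamma> - \<alpha>)\<^sup>2)) * (\<integral>\<^sup>+x. ennreal ((grad_abs u x)\<^sup>2) * indicator {\<alpha><..<\<gamma>} (norm x) \<partial>lborel)"
    by (subst nn_integral_cmult, measurable) (simp only: distrib_left[of "ennreal c"] mult.assoc ennreal_mult'[OF c])
  also have "\<dots> \<le> (\<integral>\<^sup>+x. ennreal (4 * (K + 1) * (K + 2)\<^sup>2) * (ennreal ((norm (u x))\<^sup>2 / (norm x)\<^sup>2) * indicator {\<beta><..<\<gamma>} (norm x)) \<partial>lborel)
      + ennreal (8 * (K + 1)\<^sup>2) * (\<integral>\<^sup>+x. ennreal ((grad_abs u x)\<^sup>2) * indicator {\<alpha><..<\<gamma>} (norm x) \<partial>lborel)"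
  proof (rule add_mono)
    show "(\<integral>\<^sup>+x. ennreal (c * (2 * (K + 1))) * (ennreal ((norm (u x))\<^sup>2) * indicator {\<beta><..<\<gamma>} (norm x)) \<partial>lborel)
       \<le> (\<integral>\<^sup>+x. ennreal (4 * (K + 1) * (K + 2)\<^sup>2) * (ennreal ((norm (u x))\<^sup>2 / (norm x)\<^sup>2) * indicator {\<beta><..<\<gamma>} (norm x)) \<partial>lborel)"
    proof (rule nn_integral_mono)
      fix x :: "real^2"
      show "ennreal (c * (2 * (K + 1))) * (ennreal ((norm (u x))\<^sup>2) * indicator {\<beta><..<\<gamma>} (norm x))
        \<le> ennreal (4 * (K + 1) * (K + 2)\<^sup>2) * (ennreal ((norm (u x))\<^sup>2 / (norm x)\<^sup>2) * indicator {\<beta><..<\<gamma>} (norm x))"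
      proof (cases "norm x \<in> {\<beta><..<\<gamma>}")
        case True
        have n0: "0 < norm x" using True ab by auto
        have "norm x \<le> (K + 2) * (1 + \<alpha>)" using True gle ab by (auto simp: algebra_simps)
        then have "(norm x)\<^sup>2 \<le> ((K + 2) * (1 + \<alpha>))\<^sup>2" by (intro power_mono) auto
        then have "(norm x)\<^sup>2 \<le> (K + 2)\<^sup>2 * (1 + \<alpha>)\<^sup>2" by (simp only: power_mult_distrib)
        moreover have "1 / s \<le> T / m" if "m \<le> T * s" "0 < m" "0 < s" for m s T :: real
          using that by (simp add: field_simps)
        ultimately have "1 / (1 + \<alpha>)\<^sup>2 \<le> (K + 2)\<^sup>2 / (norm x)\<^sup>2"
          using a1 n0 by simp
        then have "4 * (K + 1) * (norm (u x))\<^sup>2 * (1 / (1 + \<alpha>)\<^sup>2) \<le> 4 * (K + 1) * (norm (u x))\<^sup>2 * ((K + 2)\<^sup>2 / (norm x)\<^sup>2)"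
          using K by (intro mult_left_mono) auto
        then have "c * (2 * (K + 1)) * (norm (u x))\<^sup>2 \<le> 4 * (K + 1) * (K + 2)\<^sup>2 * ((norm (u x))\<^sup>2 / (norm x)\<^sup>2)"
          by (simp add: c_def algebra_simps add_divide_distrib)
        then show ?thesis using True c K by (simp add: ennreal_mult'[symmetric] ennreal_leI)
      qed simp
    qed
    have "(\<gamma> - \<alpha>)\<^sup>2 \<le> ((K + 1) * (1 + \<alpha>))\<^sup>2" using gle g ab by (intro power_mono) auto
    then have "c * (4 * (\<gamma> - \<alpha>)\<^sup>2) \<le> 8 * (K + 1)\<^sup>2"
      using a1 by (simp add: c_def divide_le_eq power_mult_distrib)
    then show "ennreal (c * (4 * (\<gamma> - \<alpha>)\<^sup>2)) * (\<integral>\<^sup>+x. ennreal ((grad_abs u x)\<^sup>2) * indicator {\<alpha><..<\<gamma>} (norm x) \<partial>lborel)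
       \<le> ennreal (8 * (K + 1)\<^sup>2) * (\<integral>\<^sup>+x. ennreal ((grad_abs u x)\<^sup>2) * indicator {\<alpha><..<\<gamma>} (norm x) \<partial>lborel)"
      by (intro mult_right_mono ennreal_leI) auto
  qed
  finally show ?thesis by (subst (asm) nn_integral_cmult) measurable
qed

section \<open>The Hardy inequality\<close>



text \<open>
  The circle inequality for \<open>t \<mapsto> u(r cos t, r sin t)\<close>. Its covariant derivative is \<open>r\<close> times the tangential
  component of the magnetic gradient, up to a factor of modulus one.
\<close>
lemma angular_bound:
  assumes u: "u \<in> C1_compact" and \<epsilon>: "0 < \<epsilon>" "\<epsilon> < 1/2" and r: "0 < r"
    and [measurable]: "A \<in> borel_measurable borel"
    and int: "integrable angular_measure (\<lambda>t. tangential A (polar_pt (r, t)))"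
    and far: "\<And>k::int. \<epsilon> \<le> \<bar>of_int k - (LINT t|angular_measure. tangential A (polar_pt (r, t))) / (2 * pi)\<bar>"
  shows "(\<integral>\<^sup>+t. ennreal ((norm (u (polar_pt (r, t))))\<^sup>2 / (norm (polar_pt (r, t)))\<^sup>2) \<partial>angular_measure)
    \<le> ennreal (4 * (2 * pi * (1 / (2 * sin (pi * \<epsilon>)) + 1))\<^sup>2) *
       (\<integral>\<^sup>+t. ennreal ((norm (magnetic_gradient A u (grad u) (polar_pt (r, t))))\<^sup>2) \<partial>angular_measure)"
proof -
  note [measurable] = borel_measurable_C1(1,3)[OF u]
  have mg [measurable]: "magnetic_gradient A u (grad u) \<in> borel_measurable borel"
    by (rule borel_measurable_magnetic_gradient) measurable
  define C where "C = (2 * pi * (1 / (2 * sin (pi * \<epsilon>)) + 1))\<^sup>2"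
  have C: "0 \<le> C" by (simp add: C_def)
  define w where "w t = u (polar_pt (r, t))" for t
  \<comment> \<open>The derivative of \<open>w\<close> by the chain rule.\<close>
  define w' where "w' t = (- (r * sin t)) *\<^sub>R partial_deriv 1 u (polar_pt (r, t)) + (r * cos t) *\<^sub>R partial_deriv 2 u (polar_pt (r, t))" for t
  define a where "a t = tangential A (polar_pt (r, t))" for t
  have polm [measurable]: "(\<lambda>t. polar_pt (r, t)) \<in> borel_measurable borel"
    by (auto intro!: measurable_compose[OF _ borel_measurable_pol] borel_measurable_Pair)
  have am: "a \<in> borel_measurable borel" unfolding a_def tangential_def by measurable
  have pold: "((\<lambda>t. polar_pt (r, t)) has_derivative (\<lambda>h. plane_pt (- (h * (r * sin t)), h * (r * cos t)))) (at t)" for t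
  proof (rule has_derivative_componentwise_within[THEN iffD2], intro ballI)
    fix b :: "real^2" assume "b \<in> Basis"
    then consider "b = axis 1 1" | "b = axis 2 1" by (auto simp: Basis_vec2)
    then show "((\<lambda>x. polar_pt (r, x) \<bullet> b) has_derivative (\<lambda>x. plane_pt (- (x * (r * sin t)), x * (r * cos t)) \<bullet> b)) (at t)"
      by cases (auto simp: inner_axis intro!: derivative_eq_intros)
  qed
  have polc: "continuous_on UNIV (\<lambda>t. polar_pt (r, t))"
    using pold by (auto intro!: continuous_at_imp_continuous_on has_derivative_continuous)
  have w: "(w has_vector_derivative w' t) (at t)" for t
    unfolding has_vector_derivative_def w_def w'_def
    using has_derivative_compose[OF pold C1_has_derivative[OF C1_compactD(1)[OF u]], of t]
    by (simp add: scaleR_right_diff_distrib)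
  have w'c: "continuous_on UNIV w'" unfolding w'_def
    by (intro continuous_intros continuous_on_compose2[OF C1_compactD(2)[OF u] polc]) auto
  have per: "w (2 * pi) = w 0" by (simp add: w_def polar_pt_def)
  have "(\<integral>\<^sup>+t. ennreal ((norm (w t))\<^sup>2) \<partial>angular_measure)
    \<le> ennreal C * (\<integral>\<^sup>+t. ennreal ((norm (w' t - \<i> * a t * w t))\<^sup>2) \<partial>angular_measure)"
    unfolding C_def using int far by (intro circle_inequality[OF \<epsilon> _ am w w'c per]) (auto simp: a_def[abs_def])
  also have "\<dots> \<le> ennreal C * (\<integral>\<^sup>+t. ennreal (4 * r\<^sup>2) * ennreal ((norm (magnetic_gradient A u (grad u) (polar_pt (r, t))))\<^sup>2) \<partial>angular_measure)"
  proof (intro mult_left_mono nn_integral_mono)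
    fix t
    let ?m = "magnetic_gradient A u (grad u) (polar_pt (r, t))"
    define x where "x = polar_pt (r, t)"
    have "w' t - \<i> * a t * w t = \<i> * of_real (x $ 2) * ?m $ 1 - \<i> * of_real (x $ 1) * ?m $ 2"
      by (simp add: w'_def a_def w_def x_def[symmetric] magnetic_gradient_def grad_def tangential_def)
         (simp add: x_def algebra_simps scaleR_conv_of_real)
    then have "norm (w' t - \<i> * a t * w t) \<le> norm (\<i> * of_real (x $ 2) * ?m $ 1) + norm (\<i> * of_real (x $ 1) * ?m $ 2)"
      by (metis norm_triangle_ineq4)
    also have "\<dots> = \<bar>x $ 2\<bar> * norm (?m $ 1) + \<bar>x $ 1\<bar> * norm (?m $ 2)"
      by (simp only: norm_mult norm_of_real) simp
    also have "\<dots> \<le> r * norm ?m + r * norm ?m"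
      using component_le_norm_cart[of x 1] component_le_norm_cart[of x 2] r Finite_Cartesian_Product.norm_nth_le[of ?m 1] Finite_Cartesian_Product.norm_nth_le[of ?m 2]
      by (intro add_mono mult_mono) (auto simp: x_def)
    finally have "(norm (w' t - \<i> * a t * w t))\<^sup>2 \<le> (2 * r * norm ?m)\<^sup>2" by (intro power_mono) auto
    then show "ennreal ((norm (w' t - \<i> * a t * w t))\<^sup>2) \<le> ennreal (4 * r\<^sup>2) * ennreal ((norm ?m)\<^sup>2)"
      by (simp add: ennreal_mult'[symmetric] power_mult_distrib ennreal_leI)
  qed simp
  also have "\<dots> = ennreal (C * (4 * r\<^sup>2)) * (\<integral>\<^sup>+t. ennreal ((norm (magnetic_gradient A u (grad u) (polar_pt (r, t))))\<^sup>2) \<partial>angular_measure)"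
    by (subst nn_integral_cmult) (auto simp: ennreal_mult'[OF C] mult.assoc)
  finally have main: "(\<integral>\<^sup>+t. ennreal ((norm (w t))\<^sup>2) \<partial>angular_measure) \<le> \<dots>" .
  have "(\<integral>\<^sup>+t. ennreal ((norm (u (polar_pt (r, t))))\<^sup>2 / (norm (polar_pt (r, t)))\<^sup>2) \<partial>angular_measure)
      = (\<integral>\<^sup>+t. ennreal (1 / r\<^sup>2) * ennreal ((norm (w t))\<^sup>2) \<partial>angular_measure)"
    by (intro nn_integral_cong) (simp add: w_def ennreal_mult'[symmetric])
  also have "\<dots> = ennreal (1 / r\<^sup>2) * (\<integral>\<^sup>+t. ennreal ((norm (w t))\<^sup>2) \<partial>angular_measure)"
    unfolding w_def by (rule nn_integral_cmult) measurable
  also have "\<dots> \<le> ennreal (1 / r\<^sup>2) * (ennreal (C * (4 * r\<^sup>2)) * (\<integral>\<^sup>+t. ennreal ((norm (magnetic_gradient A u (grad u) (polar_pt (r, t))))\<^sup>2) \<partial>angular_measure))"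
    by (rule mult_left_mono[OF main]) simp
  also have "\<dots> = ennreal (1 / r\<^sup>2 * (C * (4 * r\<^sup>2))) * (\<integral>\<^sup>+t. ennreal ((norm (magnetic_gradient A u (grad u) (polar_pt (r, t))))\<^sup>2) \<partial>angular_measure)"
    by (subst (2) ennreal_mult') (auto simp: mult.assoc)
  also have "1 / r\<^sup>2 * (C * (4 * r\<^sup>2)) = 4 * C" using r by simp
  finally show ?thesis unfolding C_def .
qed

text \<open>
  After enlarging \<open>K\<close> to at least \<open>1\<close>, the right neighbour \<open>(\<beta>\<^sub>i, \<beta>\<^sub>i + |I\<^sub>i| / K)\<close> of each interval lies in the gap
  before the next interval, hence consists of good radii, and these neighbours are disjoint.
\<close>
lemma flux_intervals:
  assumes "flux_condition B"
  obtains \<epsilon> K :: real and J :: "nat set" and \<alpha> \<beta> :: "nat \<Rightarrow> real"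
  where "0 < \<epsilon>" "\<epsilon> < 1/2" "1 \<le> K"
    "\<And>r. 0 < r \<Longrightarrow> r \<notin> (\<Union>j\<in>J. {\<alpha> j<..<\<beta> j}) \<Longrightarrow> \<forall>k::int. \<epsilon> \<le> \<bar>of_int k - flux B r\<bar>"
    "\<And>j. j \<in> J \<Longrightarrow> 0 \<le> \<alpha> j \<and> \<alpha> j < \<beta> j \<and> \<beta> j - \<alpha> j \<le> K * (1 + \<alpha> j)"
    "\<And>i j. i \<in> J \<Longrightarrow> j \<in> J \<Longrightarrow> i < j \<Longrightarrow> \<beta> i + (\<beta> i - \<alpha> i) / K \<le> \<alpha> j"
proof -
  from assms obtain \<epsilon> K0 :: real and N :: enat and \<alpha> \<beta> :: "nat \<Rightarrow> real" where
    \<epsilon>: "0 < \<epsilon>" "\<epsilon> < 1/2"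
    and cover: "{r. 0 < r \<and> (INF k::int. \<bar>of_int k - flux B r\<bar>) < \<epsilon>} \<subseteq> (\<Union>j\<in>{j. 1 \<le> j \<and> enat j \<le> N}. {\<alpha> j<..<\<beta> j})"
    and iv: "\<And>j. 1 \<le> j \<Longrightarrow> enat j \<le> N \<Longrightarrow> 0 \<le> \<alpha> j \<and> \<alpha> j < \<beta> j \<and> (j \<noteq> 1 \<longrightarrow> \<beta> (j - 1) < \<alpha> j) \<and>
          \<beta> j - \<alpha> j \<le> K0 * Min ({1 + \<alpha> j}
                              \<union> (if j = 1 then {} else {\<alpha> j - \<beta> (j - 1)})
                              \<union> (if enat (j + 1) \<le> N then {\<alpha> (j + 1) - \<beta> j} else {}))"
    unfolding flux_condition_def by blast
  define J where "J = {j. 1 \<le> j \<and> enat j \<le> N}"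
  define K where "K = max 1 K0"
  have down: "i \<in> J" if "j \<in> J" "1 \<le> i" "i \<le> j" for i j
    using that by (auto simp: J_def intro: order_trans[of "enat i" "enat j"])
  have I: "0 \<le> \<alpha> j" "\<alpha> j < \<beta> j" "j \<noteq> 1 \<Longrightarrow> \<beta> (j - 1) < \<alpha> j" if "j \<in> J" for j
    using iv[of j] that by (auto simp: J_def)
  have len: "\<beta> j - \<alpha> j \<le> K * (1 + \<alpha> j)" "Suc j \<in> J \<Longrightarrow> \<beta> j - \<alpha> j \<le> K * (\<alpha> (Suc j) - \<beta> j)" if j: "j \<in> J" for j
  proof -
    define S where "S = {1 + \<alpha> j} \<union> (if j = 1 then {} else {\<alpha> j - \<beta> (j - 1)})
                              \<union> (if enat (j + 1) \<le> N then {\<alpha> (j + 1) - \<beta> j} else {})"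
    have S: "finite S" "S \<noteq> {}" "1 + \<alpha> j \<in> S" by (auto simp: S_def)
    have pos: "0 < s" if "s \<in> S" for s
      using that j I[OF j] I(3)[of "Suc j"] by (auto simp: S_def J_def split: if_splits)
    have "\<beta> j - \<alpha> j \<le> K0 * Min S" using iv[of j] j unfolding S_def J_def by blast
    also have "\<dots> \<le> K * Min S" using pos[OF Min_in[OF S(1,2)]] by (intro mult_right_mono) (auto simp: K_def)
    finally have le: "\<beta> j - \<alpha> j \<le> K * s" if "s \<in> S" for s
      using Min_le[OF S(1) that] by (smt (verit) K_def mult_left_mono max.cobounded1)
    show "\<beta> j - \<alpha> j \<le> K * (1 + \<alpha> j)" by (rule le[OF S(3)])
    show "\<beta> j - \<alpha> j \<le> K * (\<alpha> (Suc j) - \<beta> j)" if "Suc j \<in> J"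
      using that by (intro le) (auto simp: S_def J_def)
  qed
  have K1: "1 \<le> K" by (simp add: K_def)
  have mono: "\<alpha> i \<le> \<alpha> j" if "i \<in> J" "j \<in> J" "i \<le> j" for i j
    using that(3,2)
  proof (induction rule: dec_induct)
    case (step n)
    have "1 \<le> i" using that(1) by (simp add: J_def)
    then have nJ: "n \<in> J" using down[OF step(4), of n] step by auto
    then show ?case using step I(2)[OF nJ] I(3)[OF step(4)] \<open>1 \<le> i\<close> by auto
  qed simp
  show thesis
  proof (rule that[OF \<epsilon> K1, of \<alpha> \<beta> J])
    fix r assume "0 < r" "r \<notin> (\<Union>j\<in>J. {\<alpha> j<..<\<beta> j})"
    then have "\<not> (INF k::int. \<bar>of_int k - flux B r\<bar>) < \<epsilon>" using cover unfolding J_def by blast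
    moreover have "(INF k::int. \<bar>of_int k - flux B r\<bar>) \<le> \<bar>of_int k - flux B r\<bar>" for k :: int
      by (intro cINF_lower bdd_belowI2[of _ 0]) auto
    ultimately show "\<forall>k::int. \<epsilon> \<le> \<bar>of_int k - flux B r\<bar>" by (meson not_less order_trans)
  next
    fix j assume "j \<in> J"
    then show "0 \<le> \<alpha> j \<and> \<alpha> j < \<beta> j \<and> \<beta> j - \<alpha> j \<le> K * (1 + \<alpha> j)" using I len by auto
  next
    fix i j assume ij: "i \<in> J" "j \<in> J" "i < j"
    then have S: "Suc i \<in> J" using down[OF ij(2), of "Suc i"] by auto
    have "(\<beta> i - \<alpha> i) / K \<le> \<alpha> (Suc i) - \<beta> i" using len(2)[OF ij(1) S] K1 by (simp add: divide_le_eq mult.commute)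
    also have "\<alpha> (Suc i) \<le> \<alpha> j" using mono[OF S ij(2)] ij(3) by simp
    finally show "\<beta> i + (\<beta> i - \<alpha> i) / K \<le> \<alpha> j" by simp
  qed
qed

lemma nn_integral_radius_disjoint_UN:
  fixes f :: "real^2 \<Rightarrow> ennreal"
  assumes [measurable]: "f \<in> borel_measurable borel" and X: "\<And>i::nat. X i \<in> sets borel" and dis: "disjoint_family X"
  shows "(\<Sum>i. \<integral>\<^sup>+x. f x * indicator (X i) (norm x) \<partial>lborel) = (\<integral>\<^sup>+x. f x * indicator (\<Union>i. X i) (norm x) \<partial>lborel)"
proof -
  note [measurable] = X
  have "(\<Sum>i. \<integral>\<^sup>+x. f x * indicator (X i) (norm x) \<partial>lborel) = (\<integral>\<^sup>+x. (\<Sum>i. f x * indicator (X i) (norm x)) \<partial>lborel)"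
    by (rule nn_integral_suminf[symmetric]) measurable
  also have "\<dots> = (\<integral>\<^sup>+x. f x * indicator (\<Union>i. X i) (norm x) \<partial>lborel)"
    using suminf_indicator[OF dis] by (simp add: ennreal_suminf_cmult)
  finally show ?thesis .
qed

text \<open>
  On circles with good radii the circle inequality gives the bound with the weight \<open>1 / |x|\<^sup>2\<close>. Each bad annulus
  is estimated by the good annulus to its right. The annuli of different indices are disjoint, so the estimates can
  be summed with one constant, whether there are finitely or infinitely many intervals.
\<close>
lemma hardy_inequality:
  assumes A: "A \<in> L2_loc" and curl: "is_curl B A" and fc: "flux_condition B"
  obtains C where "0 < C" "\<And>u. u \<in> C1_compact \<Longrightarrow>
     (\<integral>\<^sup>+x. ennreal ((norm (u x))\<^sup>2 / (1 + (norm x)\<^sup>2)) \<partial>lborel)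
      \<le> ennreal C * magnetic_energy A u (grad u)"
proof -
  have "A \<in> borel_measurable lebesgue" using A by (simp add: L2_loc_def)
  then obtain A' where A'm [measurable]: "A' \<in> borel_measurable borel" and AA': "AE x in lborel. A x = A' x"
    by (rule borel_representative)
  obtain \<epsilon> K :: real and J :: "nat set" and \<alpha> \<beta> :: "nat \<Rightarrow> real"
    where \<epsilon>: "0 < \<epsilon>" "\<epsilon> < 1/2" and K: "1 \<le> K"
    and far: "\<And>r. 0 < r \<Longrightarrow> r \<notin> (\<Union>j\<in>J. {\<alpha> j<..<\<beta> j}) \<Longrightarrow> \<forall>k::int. \<epsilon> \<le> \<bar>of_int k - flux B r\<bar>"
    and iv: "\<And>j. j \<in> J \<Longrightarrow> 0 \<le> \<alpha> j \<and> \<alpha> j < \<beta> j \<and> \<beta> j - \<alpha> j \<le> K * (1 + \<alpha> j)"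
    and sep: "\<And>i j. i \<in> J \<Longrightarrow> j \<in> J \<Longrightarrow> i < j \<Longrightarrow> \<beta> i + (\<beta> i - \<alpha> i) / K \<le> \<alpha> j"
    by (rule flux_intervals[OF fc]) (rule that)
  define \<gamma> where "\<gamma> j = \<beta> j + (\<beta> j - \<alpha> j) / K" for j
  have \<gamma>: "\<beta> j < \<gamma> j" if "j \<in> J" for j using iv[OF that] K by (auto simp: \<gamma>_def)
  define I where "I j = (if j \<in> J then {\<alpha> j<..<\<beta> j} else {})" for j
  \<comment> \<open>Bad radii \<open>I\<close>, the good radii \<open>R\<close> that pay for them, and an interval \<open>H\<close> containing both.\<close>
  define R where "R j = (if j \<in> J then {\<beta> j<..<\<gamma> j} else {})" for j
  define H where "H j = (if j \<in> J then {\<alpha> j<..<\<gamma> j} else {})" for j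
  have [measurable]: "I j \<in> sets borel" "R j \<in> sets borel" "H j \<in> sets borel" for j
    by (auto simp: I_def R_def H_def)
  have sub: "I j \<subseteq> H j" "R j \<subseteq> H j" "I j \<inter> R j = {}" for j
    using \<gamma>[of j] iv[of j] by (cases "j \<in> J"; auto simp: I_def R_def H_def)+
  have Hd: "H i \<inter> H j = {}" if "i \<noteq> j" for i j
    using sep[of i j] sep[of j i] that unfolding H_def \<gamma>_def by (cases "i < j") auto
  have dis: "disjoint_family H" "disjoint_family I" "disjoint_family R"
    using Hd sub unfolding disjoint_family_on_def by blast+
  have [measurable]: "(\<Union>j. I j) \<in> sets borel" by (rule sets.countable_UN) auto
  \<comment> \<open>The good radii.\<close>
  define G where "G = {0<..} - (\<Union>j. I j)"
  have [measurable]: "G \<in> sets borel" unfolding G_def by measurable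
  have RG: "R j \<subseteq> G" for j
  proof
    fix r assume r: "r \<in> R j"
    have "r \<notin> I i" for i using r Hd[of i j] sub by (cases "i = j") blast+
    moreover have "0 < r" using r iv by (fastforce simp: R_def split: if_splits)
    ultimately show "r \<in> G" by (auto simp: G_def)
  qed
  define C0 where "C0 = 4 * (2 * pi * (1 / (2 * sin (pi * \<epsilon>)) + 1))\<^sup>2"
  have C0: "0 \<le> C0" by (simp add: C0_def)
  define C1 where "C1 = 4 * (K + 1) * (K + 2)\<^sup>2"
  define C2 where "C2 = 8 * (K + 1)\<^sup>2"
  have C12: "0 \<le> C1" "0 \<le> C2" using K by (auto simp: C1_def C2_def)
  have AEflux: "AE r in radial_measure. integrable angular_measure (\<lambda>t. tangential A' (polar_pt (r, t))) \<and>
     (LINT t|angular_measure. tangential A' (polar_pt (r, t))) = 2 * pi * flux B r"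
    by (rule circulation_eq_flux[OF A curl A'm AA'])
  have main: "(\<integral>\<^sup>+x. ennreal ((norm (u x))\<^sup>2 / (1 + (norm x)\<^sup>2)) \<partial>lborel)
      \<le> ennreal (C0 + C1 * C0 + C2 + 1) * magnetic_energy A u (grad u)"
    if u: "u \<in> C1_compact" for u
  proof -
    note [measurable] = borel_measurable_C1[OF u]
    have mg [measurable]: "magnetic_gradient A' u (grad u) \<in> borel_measurable borel"
      by (rule borel_measurable_magnetic_gradient) measurable
    define E where "E = (\<integral>\<^sup>+x. ennreal ((norm (magnetic_gradient A' u (grad u) x))\<^sup>2) \<partial>lborel)"
    define f where "f x = ennreal ((norm (u x))\<^sup>2 / (norm x)\<^sup>2)" for x
    define h where "h x = ennreal ((norm (u x))\<^sup>2 / (1 + (norm x)\<^sup>2))" for x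
    define d where "d x = ennreal ((grad_abs u x)\<^sup>2)" for x
    have [measurable]: "f \<in> borel_measurable borel" "h \<in> borel_measurable borel" "d \<in> borel_measurable borel"
      unfolding f_def h_def d_def by measurable
    have good: "(\<integral>\<^sup>+x. f x * indicator G (norm x) \<partial>lborel) \<le> ennreal C0 * E"
    proof -
      have "(\<integral>\<^sup>+x. f x * indicator G (norm x) \<partial>lborel) = (\<integral>\<^sup>+r. \<integral>\<^sup>+t. f (polar_pt (r, t)) * indicator G (norm (polar_pt (r, t))) \<partial>angular_measure \<partial>radial_measure)"
        by (rule nn_integral_polar(1)) measurable
      also have "\<dots> \<le> (\<integral>\<^sup>+r. ennreal C0 * (\<integral>\<^sup>+t. ennreal ((norm (magnetic_gradient A' u (grad u) (polar_pt (r, t))))\<^sup>2) \<partial>angular_measure) \<partial>radial_measure)"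
      proof (rule nn_integral_mono_AE)
        note AEpos = AE_radial_pos
        show "AE r in radial_measure. (\<integral>\<^sup>+t. f (polar_pt (r, t)) * indicator G (norm (polar_pt (r, t))) \<partial>angular_measure)
          \<le> ennreal C0 * (\<integral>\<^sup>+t. ennreal ((norm (magnetic_gradient A' u (grad u) (polar_pt (r, t))))\<^sup>2) \<partial>angular_measure)"
          using AEflux AEpos
        proof eventually_elim
          case (elim r)
          show ?case
          proof (cases "r \<in> G")
            case True
            then have "r \<notin> (\<Union>j\<in>J. {\<alpha> j<..<\<beta> j})" by (auto simp: G_def I_def)
            from far[OF elim(2) this] elim(1)
            have "\<And>k::int. \<epsilon> \<le> \<bar>of_int k - (LINT t|angular_measure. tangential A' (polar_pt (r, t))) / (2 * pi)\<bar>" by simp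
            from angular_bound[OF u \<epsilon> elim(2) A'm _ this] elim(1) True elim(2)
            show ?thesis unfolding C0_def f_def by simp
          next
            case False
            then show ?thesis using elim(2) by simp
          qed
        qed
      qed
      also have "\<dots> = ennreal C0 * (\<integral>\<^sup>+r. \<integral>\<^sup>+t. ennreal ((norm (magnetic_gradient A' u (grad u) (polar_pt (r, t))))\<^sup>2) \<partial>angular_measure \<partial>radial_measure)"
        by (rule nn_integral_cmult) measurable
      also have "(\<integral>\<^sup>+r. \<integral>\<^sup>+t. ennreal ((norm (magnetic_gradient A' u (grad u) (polar_pt (r, t))))\<^sup>2) \<partial>angular_measure \<partial>radial_measure) = E"
        unfolding E_def by (rule nn_integral_polar(1)[symmetric]) measurable
      finally show ?thesis .
    qed
    have dE: "(\<integral>\<^sup>+x. d x * indicator (\<Union>j. H j) (norm x) \<partial>lborel) \<le> E"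
      unfolding E_def d_def
    proof (rule nn_integral_mono)
      fix x
      have "(grad_abs u x)\<^sup>2 \<le> (norm (magnetic_gradient A' u (grad u) x))\<^sup>2"
        by (intro power_mono grad_abs_le_magnetic grad_abs_nonneg)
      then show "ennreal ((grad_abs u x)\<^sup>2) * indicator (\<Union>j. H j) (norm x) \<le> ennreal ((norm (magnetic_gradient A' u (grad u) x))\<^sup>2)"
        by (auto simp: indicator_def intro: ennreal_leI)
    qed
    have bad1: "(\<integral>\<^sup>+x. h x * indicator (I j) (norm x) \<partial>lborel)
       \<le> ennreal C1 * (\<integral>\<^sup>+x. f x * indicator (R j) (norm x) \<partial>lborel) + ennreal C2 * (\<integral>\<^sup>+x. d x * indicator (H j) (norm x) \<partial>lborel)" for j
    proof (cases "j \<in> J")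
      case True
      then show ?thesis using iv[OF True] weighted_annulus_bound[OF u K, of "\<alpha> j" "\<beta> j"]
        by (simp add: I_def R_def H_def h_def f_def d_def C1_def C2_def \<gamma>_def)
    qed (simp add: I_def)
    have "(\<integral>\<^sup>+x. h x * indicator (\<Union>j. I j) (norm x) \<partial>lborel) = (\<Sum>j. \<integral>\<^sup>+x. h x * indicator (I j) (norm x) \<partial>lborel)"
      using dis(2) by (intro nn_integral_radius_disjoint_UN[symmetric]) auto
    also have "\<dots> \<le> (\<Sum>j. ennreal C1 * (\<integral>\<^sup>+x. f x * indicator (R j) (norm x) \<partial>lborel) + ennreal C2 * (\<integral>\<^sup>+x. d x * indicator (H j) (norm x) \<partial>lborel))"
      by (intro suminf_le bad1) auto
    also have "\<dots> = ennreal C1 * (\<Sum>j. \<integral>\<^sup>+x. f x * indicator (R j) (norm x) \<partial>lborel) + ennreal C2 * (\<Sum>j. \<integral>\<^sup>+x. d x * indicator (H j) (norm x) \<partial>lborel)"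
      by (simp add: suminf_add[symmetric] ennreal_suminf_cmult)
    also have "\<dots> = ennreal C1 * (\<integral>\<^sup>+x. f x * indicator (\<Union>j. R j) (norm x) \<partial>lborel) + ennreal C2 * (\<integral>\<^sup>+x. d x * indicator (\<Union>j. H j) (norm x) \<partial>lborel)"
      using dis by (simp add: nn_integral_radius_disjoint_UN)
    also have "\<dots> \<le> ennreal C1 * (\<integral>\<^sup>+x. f x * indicator G (norm x) \<partial>lborel) + ennreal C2 * E"
      using RG dE by (intro add_mono mult_left_mono nn_integral_mono) (auto simp: indicator_def)
    also have "\<dots> \<le> ennreal C1 * (ennreal C0 * E) + ennreal C2 * E"
      by (intro add_mono mult_left_mono good) auto
    finally have bad: "(\<integral>\<^sup>+x. h x * indicator (\<Union>j. I j) (norm x) \<partial>lborel) \<le> ennreal C1 * (ennreal C0 * E) + ennreal C2 * E" .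
    have "(\<integral>\<^sup>+x. h x \<partial>lborel) \<le> (\<integral>\<^sup>+x. f x * indicator G (norm x) + h x * indicator (\<Union>j. I j) (norm x) \<partial>lborel)"
    proof (rule nn_integral_mono_AE)
      show "AE x in lborel. h x \<le> f x * indicator G (norm x) + h x * indicator (\<Union>j. I j) (norm x)"
        using AE_lborel_singleton[of "0::real^2"]
      proof eventually_elim
        case (elim x)
        show ?case
        proof (cases "norm x \<in> (\<Union>j. I j)")
          case False
          then have "norm x \<in> G" using elim by (auto simp: G_def)
          moreover have "h x \<le> f x" unfolding h_def f_def using elim
            by (intro ennreal_leI divide_left_mono) (auto intro!: mult_pos_pos add_pos_nonneg)
          ultimately show ?thesis by (simp add: add_increasing2)
        qed (simp add: add_increasing)
      qed
    qed
    also have "\<dots> = (\<integral>\<^sup>+x. f x * indicator G (norm x) \<partial>lborel) + (\<integral>\<^sup>+x. h x * indicator (\<Union>j. I j) (norm x) \<partial>lborel)"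
      by (rule nn_integral_add) measurable
    also have "\<dots> \<le> ennreal C0 * E + (ennreal C1 * (ennreal C0 * E) + ennreal C2 * E)"
      by (rule add_mono[OF good bad])
    also have "\<dots> = ennreal (C0 + C1 * C0 + C2) * E"
      using C0 C12 by (simp add: ennreal_mult' distrib_right mult.assoc)
    also have "\<dots> \<le> ennreal (C0 + C1 * C0 + C2 + 1) * E"
      by (intro mult_right_mono ennreal_leI) auto
    also have "E = magnetic_energy A u (grad u)"
      unfolding E_def
    proof (rule nn_integral_cong_AE)
      show "AE x in lborel. ennreal ((norm (magnetic_gradient A' u (grad u) x))\<^sup>2) = ennreal ((norm (magnetic_gradient A u (grad u) x))\<^sup>2)"
        using AA' by eventually_elim (simp add: magnetic_gradient_def)
    qed
    finally show ?thesis unfolding h_def .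
  qed
  show thesis
    by (rule that[OF _ main]) (use C0 C12 in \<open>auto intro!: add_nonneg_pos add_nonneg_nonneg mult_nonneg_nonneg\<close>)
qed

section \<open>The weighted Sobolev inequality\<close>



lemma compact_support_le_integral_derivative:
  fixes F F' :: "real \<Rightarrow> real"
  assumes F: "\<And>s. (F has_real_derivative F' s) (at s)" and F': "continuous_on UNIV F'"
    and supp: "\<And>s. s \<le> - R \<Longrightarrow> F s = 0"
  shows "ennreal \<bar>F a\<bar> \<le> (\<integral>\<^sup>+s. ennreal \<bar>F' s\<bar> \<partial>lborel)"
proof (cases "- R \<le> a")
  case True
  have ci: "continuous_on {-R..a} (\<lambda>s. \<bar>F' s\<bar>)" by (intro continuous_intros continuous_on_subset[OF F']) auto
  have "(F' has_integral (F a - F (- R))) {-R..a}"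
    using True F by (intro fundamental_theorem_of_calculus)
      (auto simp: has_real_derivative_iff_has_vector_derivative intro: has_vector_derivative_at_within)
  then have 1: "(F' has_integral F a) {-R..a}" using supp by simp
  then have "\<bar>F a\<bar> = norm (integral {-R..a} F')" by (simp add: integral_unique)
  also have "\<dots> \<le> integral {-R..a} (\<lambda>s. \<bar>F' s\<bar>)"
    by (rule integral_norm_bound_integral[OF has_integral_integrable[OF 1] integrable_continuous_real[OF ci]]) simp
  finally have "ennreal \<bar>F a\<bar> \<le> ennreal (integral {-R..a} (\<lambda>s. \<bar>F' s\<bar>))" by (rule ennreal_leI)
  also have "\<dots> = (\<integral>\<^sup>+s. ennreal \<bar>F' s\<bar> * indicator {-R..a} s \<partial>lborel)"
    by (rule nn_integral_has_integral_lebesgue'[symmetric, OF _ integrable_integral[OF integrable_continuous_real[OF ci]]]) auto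
  also have "\<dots> \<le> (\<integral>\<^sup>+s. ennreal \<bar>F' s\<bar> \<partial>lborel)"
    by (intro nn_integral_mono) (auto simp: indicator_def)
  finally show ?thesis .
qed (use supp in auto)

text \<open>
  \<open>|f(a, b)|\<close> is bounded by the integral of \<open>|\<partial>\<^sub>1 f|\<close> along the horizontal line and by that of \<open>|\<partial>\<^sub>2 f|\<close> along
  the vertical line. The product of these bounds depends on \<open>a\<close> and \<open>b\<close> separately, so its double integral
  factorises.
\<close>
lemma gagliardo_nirenberg_plane:
  fixes f :: "real^2 \<Rightarrow> real" and g :: "real^2 \<Rightarrow> ennreal"
  assumes f: "\<And>x. f differentiable (at x)" and pc: "\<And>k. continuous_on UNIV (partial_deriv k f)"
    and supp: "\<And>x. R < norm x \<Longrightarrow> f x = 0" and g [measurable]: "g \<in> borel_measurable borel"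
    and le: "\<And>k x. ennreal \<bar>partial_deriv k f x\<bar> \<le> g x"
  shows "(\<integral>\<^sup>+x. ennreal ((f x)\<^sup>2) \<partial>lborel) \<le> (\<integral>\<^sup>+x. g x \<partial>lborel)\<^sup>2"
proof -
  have "continuous_on UNIV f"
    using f by (auto intro!: continuous_at_imp_continuous_on differentiable_imp_continuous_within)
  then have [measurable]: "f \<in> borel_measurable borel" by (rule borel_measurable_continuous_onI)
  have ptm [measurable]: "(\<lambda>s. plane_pt (s, b)) \<in> borel_measurable borel" "(\<lambda>s. plane_pt (a, s)) \<in> borel_measurable borel" for a b
    by (auto intro!: measurable_compose[OF _ borel_measurable_pt] borel_measurable_Pair)
  define R' where "R' = \<bar>R\<bar> + 1"
  have R': "f (plane_pt (s, b)) = 0" "f (plane_pt (a, s)) = 0" if "s \<le> - R'" for a b s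
    using component_le_norm_cart[of "plane_pt (s, b)" 1] component_le_norm_cart[of "plane_pt (a, s)" 2] that
    by (auto intro!: supp simp: R'_def)
  have d1: "((\<lambda>s. plane_pt (s, b)) has_derivative (\<lambda>h. plane_pt (h, 0))) (at s)"
    and d2: "((\<lambda>s. plane_pt (a, s)) has_derivative (\<lambda>h. plane_pt (0, h))) (at s)" for a b s
    by (rule has_derivative_componentwise_within[THEN iffD2]; auto simp: Basis_vec2 inner_axis)+
  have c1: "continuous_on UNIV (\<lambda>s. plane_pt (s, b))" and c2: "continuous_on UNIV (\<lambda>s. plane_pt (a, s))" for a b
    using d1 d2 by (auto intro!: continuous_at_imp_continuous_on has_derivative_continuous)
  define F1 where "F1 b = (\<integral>\<^sup>+s. g (plane_pt (s, b)) \<partial>lborel)" for b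
  define F2 where "F2 a = (\<integral>\<^sup>+s. g (plane_pt (a, s)) \<partial>lborel)" for a
  have [measurable]: "F1 \<in> borel_measurable borel" "F2 \<in> borel_measurable borel"
    unfolding F1_def F2_def by measurable
  have b1: "ennreal \<bar>f (plane_pt (a, b))\<bar> \<le> F1 b" for a b
  proof -
    have "((\<lambda>s. f (plane_pt (s, b))) has_real_derivative partial_deriv 1 f (plane_pt (s, b))) (at s)" for s
      using has_derivative_compose[OF d1 C1_has_derivative[OF f]]
      by (rule has_derivative_imp_has_field_derivative) simp
    then have "ennreal \<bar>f (plane_pt (a, b))\<bar> \<le> (\<integral>\<^sup>+s. ennreal \<bar>partial_deriv 1 f (plane_pt (s, b))\<bar> \<partial>lborel)"
      by (rule compact_support_le_integral_derivative[where R = R']) (auto intro!: continuous_on_compose2[OF pc c1] R'(1))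
    also have "\<dots> \<le> F1 b" unfolding F1_def by (intro nn_integral_mono le)
    finally show ?thesis .
  qed
  have b2: "ennreal \<bar>f (plane_pt (a, b))\<bar> \<le> F2 a" for a b
  proof -
    have "((\<lambda>s. f (plane_pt (a, s))) has_real_derivative partial_deriv 2 f (plane_pt (a, s))) (at s)" for s
      using has_derivative_compose[OF d2 C1_has_derivative[OF f]]
      by (rule has_derivative_imp_has_field_derivative) simp
    then have "ennreal \<bar>f (plane_pt (a, b))\<bar> \<le> (\<integral>\<^sup>+s. ennreal \<bar>partial_deriv 2 f (plane_pt (a, s))\<bar> \<partial>lborel)"
      by (rule compact_support_le_integral_derivative[where R = R']) (auto intro!: continuous_on_compose2[OF pc c2] R'(2))
    also have "\<dots> \<le> F2 a" unfolding F2_def by (intro nn_integral_mono le)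
    finally show ?thesis .
  qed
  have "(\<integral>\<^sup>+x. ennreal ((f x)\<^sup>2) \<partial>lborel) = (\<integral>\<^sup>+a. \<integral>\<^sup>+b. ennreal ((f (plane_pt (a, b)))\<^sup>2) \<partial>lborel \<partial>lborel)"
    by (rule nn_integral_plane(1)) measurable
  also have "\<dots> \<le> (\<integral>\<^sup>+a. \<integral>\<^sup>+b. F2 a * F1 b \<partial>lborel \<partial>lborel)"
  proof (intro nn_integral_mono)
    fix a b
    have "ennreal ((f (plane_pt (a, b)))\<^sup>2) = ennreal \<bar>f (plane_pt (a, b))\<bar> * ennreal \<bar>f (plane_pt (a, b))\<bar>"
      by (subst ennreal_mult'[symmetric]) (auto simp: power2_eq_square)
    also have "\<dots> \<le> F2 a * F1 b" by (intro mult_mono b1 b2) auto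
    finally show "ennreal ((f (plane_pt (a, b)))\<^sup>2) \<le> F2 a * F1 b" .
  qed
  also have "\<dots> = (\<integral>\<^sup>+a. F2 a \<partial>lborel) * (\<integral>\<^sup>+b. F1 b \<partial>lborel)"
    by (simp add: nn_integral_cmult nn_integral_multc)
  also have "(\<integral>\<^sup>+a. F2 a \<partial>lborel) = (\<integral>\<^sup>+x. g x \<partial>lborel)"
    unfolding F2_def by (rule nn_integral_plane(1)[symmetric]) measurable
  also have "(\<integral>\<^sup>+b. F1 b \<partial>lborel) = (\<integral>\<^sup>+x. g x \<partial>lborel)"
    unfolding F1_def by (rule nn_integral_plane(2)[symmetric]) measurable
  finally show ?thesis by (simp add: power2_eq_square)
qed

definition weighted_power :: "(real^2 \<Rightarrow> complex) \<Rightarrow> nat \<Rightarrow> ennreal" where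
  "weighted_power u n = (\<integral>\<^sup>+x. ennreal (norm (u x) ^ n / (1 + (norm x)\<^sup>2)) \<partial>lborel)"

lemma ennreal_square_sum_le: "(a + b)\<^sup>2 \<le> 2 * (a\<^sup>2 + b\<^sup>2)" for a b :: ennreal
proof (cases "a = top \<or> b = top")
  case True
  then have top: "2 * (a\<^sup>2 + b\<^sup>2) = top"
    by (auto simp: power2_eq_square ennreal_mult_top ennreal_top_mult)
  show ?thesis unfolding top by (rule top_greatest)
next
  case False
  then obtain x y where "a = ennreal x" "b = ennreal y" "0 \<le> x" "0 \<le> y"
    by (metis ennreal_cases)
  moreover have "(x + y)\<^sup>2 \<le> 2 * (x\<^sup>2 + y\<^sup>2)" using sum_squares_bound[of x y] by (simp add: power2_sum)
  ultimately show ?thesis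
    by (simp add: ennreal_plus[symmetric] ennreal_power ennreal_mult''[symmetric] ennreal_numeral[symmetric] ennreal_leI del: ennreal_plus ennreal_numeral)
qed

text \<open>
  The Gagliardo-Nirenberg inequality for \<open>f = |u|\<^sup>2\<^sup>m (1 + |x|\<^sup>2)\<^sup>-\<^sup>1\<^sup>/\<^sup>2\<close>. The even power keeps \<open>f\<close> continuously
  differentiable at the zeros of \<open>u\<close>. The gradient of \<open>f\<close> is bounded by \<open>v (2m |\<nabla>|u|| + |u| w)\<close>, where \<open>w\<close> is
  the square root of the weight and \<open>v = |u|\<^sup>2\<^sup>m\<^sup>-\<^sup>1 w\<close>; the Cauchy-Schwarz inequality separates \<open>v\<close>.
\<close>
lemma weighted_power_step:
  assumes u: "u \<in> C1_compact" and m: "1 \<le> (m::nat)"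
  shows "weighted_power u (4 * m) \<le> ennreal (8 * (real m)\<^sup>2) *
     ((\<integral>\<^sup>+x. ennreal ((grad_abs u x)\<^sup>2) \<partial>lborel) + weighted_power u 2) * weighted_power u (4 * m - 2)"
proof -
  note [measurable] = borel_measurable_C1[OF u]
  define w where "w x = inverse (sqrt (1 + (norm x)\<^sup>2))" for x :: "real^2"
  have w0: "0 < w x" for x unfolding w_def by (simp add: add_pos_nonneg)
  have w2: "(w x)\<^sup>2 = 1 / (1 + (norm x)\<^sup>2)" for x
    unfolding w_def power_inverse by (simp add: add_nonneg_nonneg inverse_eq_divide)
  have [measurable]: "w \<in> borel_measurable borel" unfolding w_def by measurable
  define f where "f x = ((norm (u x))\<^sup>2) ^ m * w x" for x
  define f' where "f' x h = ((norm (u x))\<^sup>2) ^ m * (- ((x \<bullet> h) * (w x) ^ 3))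
      + (real m * ((norm (u x))\<^sup>2) ^ (m - 1) * (grad_sq u x \<bullet> h)) * w x" for x h
  have dw: "(w has_derivative (\<lambda>h. - ((x \<bullet> h) * (w x) ^ 3))) (at x)" for x
  proof -
    have pos: "0 < 1 + x \<bullet> x" by (simp add: add_pos_nonneg)
    have "((\<lambda>x. 1 + x \<bullet> x) has_derivative (\<lambda>h. 2 * (x \<bullet> h))) (at x)"
      by (auto intro!: derivative_eq_intros simp: inner_commute)
    moreover have "((\<lambda>s. inverse (sqrt s)) has_real_derivative (- (inverse (sqrt s) ^ 3 / 2))) (at s)" if "0 < s" for s
      using that by (auto intro!: derivative_eq_intros simp: power3_eq_cube power2_eq_square field_simps)
    ultimately show ?thesis unfolding w_def power2_norm_eq_inner
      using has_derivative_compose[of "\<lambda>x. 1 + x \<bullet> x" "\<lambda>h. 2 * (x \<bullet> h)" x UNIV "\<lambda>s. inverse (sqrt s)"] pos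
      by (fastforce simp: has_field_derivative_def mult.commute)
  qed
  have df: "(f has_derivative f' x) (at x)" for x
    unfolding f_def f'_def
    by (rule has_derivative_mult[OF has_derivative_power[OF grad_sq_derivative(1)[OF u]] dw, THEN has_derivative_eq_rhs])
       (simp add: fun_eq_iff algebra_simps)
  have pf: "partial_deriv k f x = f' x (axis k 1)" for k x by (rule partial_deriv_eq[OF df])
  have wc: "continuous_on UNIV w" using dw by (auto intro!: continuous_at_imp_continuous_on has_derivative_continuous)
  have pc: "continuous_on UNIV (partial_deriv k f)" for k
    unfolding pf[abs_def] f'_def
    by (intro continuous_intros wc C1_compactD(3)[OF u] grad_sq_derivative(2)[OF u])
  obtain R where R: "\<And>x. R < norm x \<Longrightarrow> u x = 0" and "\<And>x. R < norm x \<Longrightarrow> grad u x = 0"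
    by (rule C1_compact_support[OF u]) (rule that)
  define v where "v x = norm (u x) ^ (2 * m - 1) * w x" for x
  have v0: "0 \<le> v x" for x using w0[of x] by (simp add: v_def)
  define g where "g x = ennreal (v x) * ennreal (2 * real m * grad_abs u x) + ennreal (v x) * ennreal (norm (u x) * w x)" for x
  have [measurable]: "g \<in> borel_measurable borel" "v \<in> borel_measurable borel" unfolding g_def v_def by measurable
  have e1: "((norm (u x))\<^sup>2) ^ (m - 1) * norm (u x) = norm (u x) ^ (2 * m - 1)"
    and e2: "((norm (u x))\<^sup>2) ^ m = norm (u x) ^ (2 * m - 1) * norm (u x)" for x
  proof -
    have *: "2 * m - 1 = Suc (2 * (m - 1))" "2 * m = Suc (2 * m - 1)" using m by auto
    show "((norm (u x))\<^sup>2) ^ (m - 1) * norm (u x) = norm (u x) ^ (2 * m - 1)"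
      unfolding *(1) by (simp only: power_mult power_Suc2)
    show "((norm (u x))\<^sup>2) ^ m = norm (u x) ^ (2 * m - 1) * norm (u x)"
      unfolding power_mult[symmetric] power_Suc2[symmetric] *(2)[symmetric] ..
  qed
  have le: "ennreal \<bar>partial_deriv k f x\<bar> \<le> g x" for k x
  proof -
    have wx: "\<bar>x \<bullet> axis k 1\<bar> * w x \<le> 1"
    proof -
      have "\<bar>x \<bullet> axis k 1\<bar> \<le> norm x" by (simp add: inner_axis component_le_norm_cart)
      also have "\<dots> \<le> sqrt (1 + (norm x)\<^sup>2)" by (rule real_le_rsqrt) simp
      finally show ?thesis unfolding w_def by (simp add: field_simps add_pos_nonneg)
    qed
    have gs: "\<bar>grad_sq u x \<bullet> axis k 1\<bar> \<le> 2 * norm (u x) * grad_abs u x"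
      unfolding norm_grad_sq[symmetric] by (simp add: inner_axis component_le_norm_cart)
    have t1: "\<bar>((norm (u x))\<^sup>2) ^ m * (- ((x \<bullet> axis k 1) * (w x) ^ 3))\<bar> \<le> v x * (norm (u x) * w x)"
    proof -
      have "\<bar>((norm (u x))\<^sup>2) ^ m * (- ((x \<bullet> axis k 1) * (w x) ^ 3))\<bar> = (((norm (u x))\<^sup>2) ^ m * (w x)\<^sup>2) * (\<bar>x \<bullet> axis k 1\<bar> * w x)"
        using w0[of x] by (simp add: abs_mult power3_eq_cube power2_eq_square)
      also have "\<dots> \<le> (((norm (u x))\<^sup>2) ^ m * (w x)\<^sup>2) * 1" by (rule mult_left_mono[OF wx]) simp
      also have "\<dots> = v x * (norm (u x) * w x)" unfolding v_def e2 by (simp add: power2_eq_square)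
      finally show ?thesis .
    qed
    have t2: "\<bar>(real m * ((norm (u x))\<^sup>2) ^ (m - 1) * (grad_sq u x \<bullet> axis k 1)) * w x\<bar> \<le> v x * (2 * real m * grad_abs u x)"
    proof -
      have "\<bar>(real m * ((norm (u x))\<^sup>2) ^ (m - 1) * (grad_sq u x \<bullet> axis k 1)) * w x\<bar>
        = (real m * ((norm (u x))\<^sup>2) ^ (m - 1) * w x) * \<bar>grad_sq u x \<bullet> axis k 1\<bar>"
        using w0[of x] by (simp add: abs_mult)
      also have "\<dots> \<le> (real m * ((norm (u x))\<^sup>2) ^ (m - 1) * w x) * (2 * norm (u x) * grad_abs u x)"
        using w0[of x] by (intro mult_left_mono gs) auto
      also have "\<dots> = v x * (2 * real m * grad_abs u x)" unfolding v_def e1[symmetric] by (simp add: algebra_simps)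
      finally show ?thesis .
    qed
    have "\<bar>partial_deriv k f x\<bar> \<le> v x * (2 * real m * grad_abs u x) + v x * (norm (u x) * w x)"
      unfolding pf f'_def using t1 t2 by linarith
    then show ?thesis unfolding g_def using v0[of x] w0[of x] grad_abs_nonneg[of u x]
      by (simp add: ennreal_mult'[symmetric] ennreal_plus[symmetric] ennreal_leI del: ennreal_plus)
  qed
  define Q where "Q = (\<integral>\<^sup>+x. (ennreal (v x))\<^sup>2 \<partial>lborel)"
  define D where "D = (\<integral>\<^sup>+x. ennreal ((grad_abs u x)\<^sup>2) \<partial>lborel)"
  have Qe: "Q = weighted_power u (4 * m - 2)"
    unfolding Q_def weighted_power_def
  proof (rule nn_integral_cong)
    fix x
    have "(v x)\<^sup>2 = norm (u x) ^ (4 * m - 2) * (w x)\<^sup>2"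
    proof -
      have "(2 * m - 1) * 2 = 4 * m - 2" by simp
      then show ?thesis unfolding v_def power_mult_distrib power_mult[symmetric] by simp
    qed
    then show "(ennreal (v x))\<^sup>2 = ennreal (norm (u x) ^ (4 * m - 2) / (1 + (norm x)\<^sup>2))"
      using v0[of x] by (simp add: ennreal_power w2)
  qed
  have "weighted_power u (4 * m) = (\<integral>\<^sup>+x. ennreal ((f x)\<^sup>2) \<partial>lborel)"
    unfolding weighted_power_def
    by (intro nn_integral_cong) (simp add: f_def power_mult_distrib w2 power_mult[symmetric] mult.commute)
  also have "\<dots> \<le> (\<integral>\<^sup>+x. g x \<partial>lborel)\<^sup>2"
    by (rule gagliardo_nirenberg_plane[OF _ pc _ _ le]) (use df R m in \<open>auto simp: differentiable_def f_def zero_power\<close>)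
  also have "(\<integral>\<^sup>+x. g x \<partial>lborel) = (\<integral>\<^sup>+x. ennreal (v x) * ennreal (2 * real m * grad_abs u x) \<partial>lborel)
      + (\<integral>\<^sup>+x. ennreal (v x) * ennreal (norm (u x) * w x) \<partial>lborel)"
    unfolding g_def by (rule nn_integral_add) measurable
  also have "(\<dots>)\<^sup>2 \<le> 2 * ((\<integral>\<^sup>+x. ennreal (v x) * ennreal (2 * real m * grad_abs u x) \<partial>lborel)\<^sup>2
      + (\<integral>\<^sup>+x. ennreal (v x) * ennreal (norm (u x) * w x) \<partial>lborel)\<^sup>2)"
    by (rule ennreal_square_sum_le)
  also have "\<dots> \<le> 2 * (Q * (\<integral>\<^sup>+x. (ennreal (2 * real m * grad_abs u x))\<^sup>2 \<partial>lborel)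
      + Q * (\<integral>\<^sup>+x. (ennreal (norm (u x) * w x))\<^sup>2 \<partial>lborel))"
    unfolding Q_def by (intro mult_left_mono add_mono Cauchy_Schwarz_nn_integral) auto
  also have "(\<integral>\<^sup>+x. (ennreal (2 * real m * grad_abs u x))\<^sup>2 \<partial>lborel) = ennreal (4 * (real m)\<^sup>2) * D"
    unfolding D_def
    by (subst nn_integral_cmult[symmetric])
       (auto intro!: nn_integral_cong simp: ennreal_power grad_abs_nonneg power_mult_distrib ennreal_mult')
  also have "(\<integral>\<^sup>+x. (ennreal (norm (u x) * w x))\<^sup>2 \<partial>lborel) = weighted_power u 2"
    unfolding weighted_power_def
    by (intro nn_integral_cong) (simp add: ennreal_power w0 less_imp_le power_mult_distrib w2)
  also have "2 * (Q * (ennreal (4 * (real m)\<^sup>2) * D) + Q * weighted_power u 2)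
     \<le> 2 * (Q * (ennreal (4 * (real m)\<^sup>2) * D) + Q * (ennreal (4 * (real m)\<^sup>2) * weighted_power u 2))"
  proof -
    have "1 * 1 \<le> 4 * (real m)\<^sup>2" using m by (intro mult_mono) auto
    then have "1 * weighted_power u 2 \<le> ennreal (4 * (real m)\<^sup>2) * weighted_power u 2"
      by (intro mult_right_mono) (auto simp: ennreal_1[symmetric] simp del: ennreal_1 intro!: ennreal_leI)
    then show ?thesis by (intro mult_left_mono add_mono) auto
  qed
  also have "\<dots> = ennreal (8 * (real m)\<^sup>2) * (D + weighted_power u 2) * Q"
  proof -
    have "ennreal (8 * (real m)\<^sup>2) = 2 * ennreal (4 * (real m)\<^sup>2)"
      by (subst ennreal_numeral[symmetric], subst ennreal_mult'[symmetric]) auto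
    then show ?thesis by (simp add: algebra_simps)
  qed
  finally show ?thesis unfolding D_def Qe .
qed

text \<open>
  The first summand dominates for \<open>t \<le> l\<close>, the second for \<open>t \<ge> l\<close>. The free parameter \<open>l\<close> replaces
  an appeal to Hoelder's inequality.
\<close>
lemma powr_interpolation:
  fixes t l a b q :: real
  assumes "0 \<le> t" "0 < l" "a \<le> q" "q \<le> b"
  shows "t powr q \<le> l powr (q - a) * t powr a + l powr (q - b) * t powr b"
proof (cases "t = 0")
  case False
  then have t: "0 < t" using assms by simp
  show ?thesis
  proof (cases "t \<le> l")
    case True
    have "t powr q = t powr (q - a) * t powr a" using t by (simp add: powr_add[symmetric])
    also have "\<dots> \<le> l powr (q - a) * t powr a" using True t assms by (intro mult_right_mono powr_mono2) auto
    finally show ?thesis by (simp add: add_increasing2)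
  next
    case False
    have "t powr q = t powr (q - b) * t powr b" using t by (simp add: powr_add[symmetric])
    also have "\<dots> \<le> l powr (q - b) * t powr b" using False assms by (intro mult_right_mono powr_mono2') auto
    finally show ?thesis by (simp add: add_increasing)
  qed
qed simp

definition weighted_powr :: "(real^2 \<Rightarrow> complex) \<Rightarrow> real \<Rightarrow> ennreal" where
  "weighted_powr u q = (\<integral>\<^sup>+x. ennreal (norm (u x) powr q / (1 + (norm x)\<^sup>2)) \<partial>lborel)"

lemma weighted_power_eq: "0 < n \<Longrightarrow> weighted_power u n = weighted_powr u (real n)"
  unfolding weighted_power_def weighted_powr_def
proof (intro nn_integral_cong)
  fix x assume "0 < n"
  then have "norm (u x) ^ n = norm (u x) powr real n"
    by (cases "u x = 0") (auto simp: powr_realpow zero_power)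
  then show "ennreal (norm (u x) ^ n / (1 + (norm x)\<^sup>2)) = ennreal (norm (u x) powr real n / (1 + (norm x)\<^sup>2))" by simp
qed

lemma weighted_powr_interpolation:
  assumes [measurable]: "u \<in> borel_measurable borel" and "0 < l" "a \<le> q" "q \<le> b"
  shows "weighted_powr u q \<le> ennreal (l powr (q - a)) * weighted_powr u a + ennreal (l powr (q - b)) * weighted_powr u b"
proof -
  have "weighted_powr u q \<le> (\<integral>\<^sup>+x. ennreal (l powr (q - a)) * ennreal (norm (u x) powr a / (1 + (norm x)\<^sup>2))
      + ennreal (l powr (q - b)) * ennreal (norm (u x) powr b / (1 + (norm x)\<^sup>2)) \<partial>lborel)"
    unfolding weighted_powr_def
  proof (rule nn_integral_mono)
    fix x :: "real^2"
    have p: "0 < 1 + (norm x)\<^sup>2" by (simp add: add_pos_nonneg)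
    have "norm (u x) powr q / (1 + (norm x)\<^sup>2)
      \<le> (l powr (q - a) * norm (u x) powr a + l powr (q - b) * norm (u x) powr b) / (1 + (norm x)\<^sup>2)"
      using p assms by (intro divide_right_mono powr_interpolation) auto
    also have "\<dots> = l powr (q - a) * (norm (u x) powr a / (1 + (norm x)\<^sup>2)) + l powr (q - b) * (norm (u x) powr b / (1 + (norm x)\<^sup>2))"
      by (simp add: add_divide_distrib)
    finally show "ennreal (norm (u x) powr q / (1 + (norm x)\<^sup>2)) \<le> ennreal (l powr (q - a)) * ennreal (norm (u x) powr a / (1 + (norm x)\<^sup>2))
      + ennreal (l powr (q - b)) * ennreal (norm (u x) powr b / (1 + (norm x)\<^sup>2))"
      using p by (simp add: ennreal_mult'[symmetric] ennreal_plus[symmetric] ennreal_leI del: ennreal_plus)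
  qed
  also have "\<dots> = ennreal (l powr (q - a)) * weighted_powr u a + ennreal (l powr (q - b)) * weighted_powr u b"
    unfolding weighted_powr_def by (simp add: nn_integral_add nn_integral_cmult)
  finally show ?thesis .
qed

lemma weighted_powr_finite:
  assumes u: "u \<in> C1_compact" and "0 \<le> q"
  shows "weighted_powr u q < \<infinity>"
proof -
  obtain R where R: "\<And>x. R < norm x \<Longrightarrow> u x = 0" and "\<And>x. R < norm x \<Longrightarrow> grad u x = 0"
    by (rule C1_compact_support[OF u]) (rule that)
  obtain M where M: "0 \<le> M" "\<And>x. norm (u x) \<le> M" and "\<And>x. norm (grad u x) \<le> M"
    by (rule C1_compact_bounded[OF u]) (rule that)
  have "weighted_powr u q \<le> (\<integral>\<^sup>+x. ennreal (M powr q) * indicator (cball 0 R) x \<partial>(lborel :: (real^2) measure))"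
    unfolding weighted_powr_def
  proof (rule nn_integral_mono)
    fix x :: "real^2"
    show "ennreal (norm (u x) powr q / (1 + (norm x)\<^sup>2)) \<le> ennreal (M powr q) * indicator (cball 0 R) x"
    proof (cases "norm x \<le> R")
      case True
      have "norm (u x) powr q \<le> M powr q" using M assms(2) by (intro powr_mono2) auto
      then have "norm (u x) powr q \<le> M powr q * (1 + (norm x)\<^sup>2)"
        by (rule order_trans) (simp add: distrib_left)
      then show ?thesis using True by (simp add: divide_le_eq add_pos_nonneg ennreal_leI)
    next
      case False
      then show ?thesis using R[of x] by simp
    qed
  qed
  also have "\<dots> < \<infinity>"
    using emeasure_lborel_cball_finite[of "0::real^2" R] by (simp add: nn_integral_cmult_indicator ennreal_mult_less_top less_top)
  finally show ?thesis .
qed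

text \<open>
  Write \<open>Q\<^sub>s\<close> for the weighted integral of \<open>|u|\<^sup>s\<close> and choose \<open>M = 4m \<ge> q\<close>. The step lemma bounds \<open>Q\<^sub>M\<close> by
  \<open>C e Q\<close> with the exponent \<open>M - 2\<close>; interpolating this exponent between \<open>2\<close> and \<open>M\<close> reproduces half of \<open>Q\<^sub>M\<close>, which is
  finite and can be absorbed. This bounds \<open>Q\<^sub>M\<close> by \<open>e\<^sup>M\<^sup>/\<^sup>2\<close>, and a second interpolation gives \<open>Q\<^sub>q\<close>.
\<close>
lemma weighted_sobolev:
  fixes q :: real
  assumes "2 \<le> q"
  obtains C where "0 < C" "\<And>u e. u \<in> C1_compact \<Longrightarrow> 0 < e \<Longrightarrow>
    (\<integral>\<^sup>+x. ennreal ((grad_abs u x)\<^sup>2) \<partial>lborel) + weighted_power u 2 \<le> ennreal e \<Longrightarrow>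
    weighted_powr u q \<le> ennreal (C * e powr (q / 2))"
proof -
  obtain m0 :: nat where "q < real m0" using reals_Archimedean2 by blast
  define m where "m = Suc m0"
  have m: "1 \<le> m" "q \<le> 4 * real m" using \<open>q < real m0\<close> by (auto simp: m_def)
  define C where "C = 8 * (real m)\<^sup>2"
  have C: "0 < C" using m by (simp add: C_def)
  define M where "M = 4 * real m"
  define K where "K = (2 * C) powr (2 * real m - 1)"
  have main: "weighted_powr u q \<le> ennreal ((1 + K) * e powr (q / 2))"
    if u: "u \<in> C1_compact" and e: "0 < e"
      and E: "(\<integral>\<^sup>+x. ennreal ((grad_abs u x)\<^sup>2) \<partial>lborel) + weighted_power u 2 \<le> ennreal e" for u e
  proof -
    have um: "u \<in> borel_measurable borel" by (rule borel_measurable_C1[OF u])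
    have "weighted_power u 2 \<le> (\<integral>\<^sup>+x. ennreal ((grad_abs u x)\<^sup>2) \<partial>lborel) + weighted_power u 2" by simp
    also note E
    finally have Q2: "weighted_powr u 2 \<le> ennreal e" by (simp add: weighted_power_eq)
    obtain x where x: "weighted_powr u M = ennreal x" "0 \<le> x"
      using weighted_powr_finite[OF u, of M] by (cases "weighted_powr u M") (auto simp: M_def)
    have interp: "weighted_powr u s \<le> ennreal (l powr (s - 2) * e + l powr (s - M) * x)"
      if "0 < l" "2 \<le> s" "s \<le> M" for s l
    proof -
      have "weighted_powr u s \<le> ennreal (l powr (s - 2)) * weighted_powr u 2 + ennreal (l powr (s - M)) * weighted_powr u M"
        using that by (intro weighted_powr_interpolation um) auto
      also have "\<dots> \<le> ennreal (l powr (s - 2)) * ennreal e + ennreal (l powr (s - M)) * ennreal x"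
        unfolding x(1) using Q2 by (intro add_mono mult_left_mono) auto
      also have "\<dots> = ennreal (l powr (s - 2) * e + l powr (s - M) * x)"
        using e x by (simp add: ennreal_mult')
      finally show ?thesis .
    qed
    \<comment> \<open>With this \<open>l\<close> the coefficient \<open>C e l\<^sup>-\<^sup>2\<close> of \<open>weighted_powr u M\<close> equals \<open>1 / 2\<close>, so that term can be absorbed.\<close>
    define l where "l = (2 * C * e) powr (1 / 2)"
    have l: "0 < l" using C e by (simp add: l_def)
    have nat: "weighted_power u (4 * m) = weighted_powr u M" "weighted_power u (4 * m - 2) = weighted_powr u (M - 2)"
      using m by (auto simp: weighted_power_eq M_def of_nat_diff)
    have "weighted_powr u M \<le> ennreal C * ennreal e * weighted_powr u (M - 2)"
      using order_trans[OF weighted_power_step[OF u m(1)] mult_right_mono[OF mult_left_mono[OF E]]]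
      unfolding nat C_def by simp
    also have "\<dots> \<le> ennreal C * ennreal e * ennreal (l powr (M - 2 - 2) * e + l powr (M - 2 - M) * x)"
      using l m by (intro mult_left_mono interp) (auto simp: M_def)
    also have "\<dots> = ennreal (C * e * (l powr (M - 4) * e + l powr (- 2) * x))"
      using C e by (simp add: ennreal_mult'[symmetric] mult.assoc)
    finally have "ennreal x \<le> ennreal (C * e * (l powr (M - 4) * e + l powr (- 2) * x))" unfolding x(1) .
    then have "x \<le> C * e * (l powr (M - 4) * e + l powr (- 2) * x)"
      using C e x by (subst (asm) ennreal_le_iff) auto
    also have "l powr (- 2) = 1 / (2 * C * e)"
      using C e by (simp add: l_def powr_powr powr_minus inverse_eq_divide)
    also have "C * e * (l powr (M - 4) * e + 1 / (2 * C * e) * x) = C * e * l powr (M - 4) * e + x / 2"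
      using C e by (simp add: field_simps)
    finally have "x \<le> 2 * (C * e * l powr (M - 4) * e)" by linarith
    also have "\<dots> = 2 * C * e * e * l powr (M - 4)" by simp
    also have "l powr (M - 4) = (2 * C * e) powr (2 * real m - 2)"
      by (simp add: l_def powr_powr M_def diff_divide_distrib)
    also have "\<dots> = (2 * C) powr (2 * real m - 2) * e powr (2 * real m - 2)"
      by (simp add: powr_mult)
    also have "2 * C * e * e * \<dots> = ((2 * C) powr 1 * (2 * C) powr (2 * real m - 2)) * ((e powr 1 * e powr 1) * e powr (2 * real m - 2))"
      using C e by simp
    also have "\<dots> = K * e powr (2 * real m)"
      unfolding powr_add[symmetric] K_def by (simp add: add.commute)
    finally have xK: "x \<le> K * e powr (2 * real m)" .
    have "weighted_powr u q \<le> ennreal ((e powr (1 / 2)) powr (q - 2) * e + (e powr (1 / 2)) powr (q - M) * x)"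
      using e assms m by (intro interp) (auto simp: M_def)
    also have "\<dots> \<le> ennreal ((e powr (1 / 2)) powr (q - 2) * e + (e powr (1 / 2)) powr (q - M) * (K * e powr (2 * real m)))"
      using xK by (intro ennreal_leI add_left_mono mult_left_mono) auto
    also have "(e powr (1 / 2)) powr (q - 2) * e = e powr (q / 2)"
    proof -
      have "(e powr (1 / 2)) powr (q - 2) * e = e powr ((q - 2) / 2) * e powr 1" using e by (simp add: powr_powr)
      also have "\<dots> = e powr (q / 2)" unfolding powr_add[symmetric] by (simp add: field_simps)
      finally show ?thesis .
    qed
    also have "(e powr (1 / 2)) powr (q - M) * (K * e powr (2 * real m)) = K * e powr (q / 2)"
    proof -
      have "(e powr (1 / 2)) powr (q - M) * (K * e powr (2 * real m)) = K * (e powr ((q - M) / 2) * e powr (2 * real m))"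
        by (simp add: powr_powr)
      also have "\<dots> = K * e powr (q / 2)" unfolding powr_add[symmetric] by (simp add: M_def field_simps)
      finally show ?thesis .
    qed
    finally show ?thesis by (simp add: distrib_right)
  qed
  show thesis by (rule that[OF _ main]) (auto simp: K_def intro: add_pos_nonneg)
qed

section \<open>Mollification\<close>



lemma compact_support_uniformly_continuous:
  fixes c :: "'a::euclidean_space \<Rightarrow> 'b::real_normed_vector"
  assumes c: "continuous_on UNIV c" and supp: "\<And>x. R < norm x \<Longrightarrow> c x = 0" and e: "0 < e"
  obtains d where "0 < d" "\<And>x y. norm (x - y) < d \<Longrightarrow> norm (c x - c y) \<le> e"
proof -
  have "uniformly_continuous_on (cball 0 (R + 1)) c"
    by (intro compact_uniformly_continuous continuous_on_subset[OF c]) auto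
  then obtain d where d: "0 < d" "\<And>x y. x \<in> cball 0 (R + 1) \<Longrightarrow> y \<in> cball 0 (R + 1) \<Longrightarrow> dist y x < d \<Longrightarrow> dist (c y) (c x) < e"
    using e unfolding uniformly_continuous_on_def by metis
  show thesis
  proof (rule that[of "min d 1"])
    fix x y :: 'a assume xy: "norm (x - y) < min d 1"
    show "norm (c x - c y) \<le> e"
    proof (cases "norm x \<le> R + 1 \<and> norm y \<le> R + 1")
      case True
      then show ?thesis using d(2)[of y x] xy by (auto simp: dist_norm)
    next
      case False
      have "norm x \<le> norm y + norm (x - y)" "norm y \<le> norm x + norm (x - y)"
        using norm_triangle_ineq[of y "x - y"] norm_triangle_ineq4[of x "x - y"] by auto
      then have "R < norm x" "R < norm y" using False xy by auto
      then show ?thesis using supp e by simp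
    qed
  qed (use d in auto)
qed

lemma compact_support_bounded:
  fixes c :: "'a::euclidean_space \<Rightarrow> 'b::real_normed_vector"
  assumes c: "continuous_on UNIV c" and supp: "\<And>x. R < norm x \<Longrightarrow> c x = 0"
  obtains M where "0 \<le> M" "\<And>x. norm (c x) \<le> M"
proof -
  have "bounded (c ` cball 0 R)"
    by (intro compact_imp_bounded compact_continuous_image continuous_on_subset[OF c]) auto
  then obtain a where "\<forall>y\<in>c ` cball 0 R. norm y \<le> a" unfolding bounded_iff by blast
  then have a: "\<And>x. norm x \<le> R \<Longrightarrow> norm (c x) \<le> a" by auto
  show thesis
  proof (rule that[of "max 0 a"])
    fix x show "norm (c x) \<le> max 0 a" using a[of x] supp[of x] by (cases "norm x \<le> R") auto
  qed simp
qed

definition bump :: "real \<Rightarrow> real^2 \<Rightarrow> real" where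
  "bump \<delta> z = flat 0 (\<delta>\<^sup>2 - (norm z)\<^sup>2)"

definition mollifier :: "real \<Rightarrow> real^2 \<Rightarrow> real" where
  "mollifier \<delta> z = bump \<delta> z / (LINT z|lborel. bump \<delta> z)"

definition mollifier_grad :: "real \<Rightarrow> real^2 \<Rightarrow> real^2" where
  "mollifier_grad \<delta> z = (- (2 * flat 2 (\<delta>\<^sup>2 - (norm z)\<^sup>2) / (LINT z|lborel. bump \<delta> z))) *\<^sub>R z"

definition mollify :: "real \<Rightarrow> (real^2 \<Rightarrow> 'b::{banach,second_countable_topology}) \<Rightarrow> real^2 \<Rightarrow> 'b" where
  "mollify \<delta> f x = (LINT y|lborel. mollifier \<delta> (x - y) *\<^sub>R f y)"

lemma continuous_flat: "continuous_on UNIV (flat n)"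
  by (intro continuous_at_imp_continuous_on ballI DERIV_isCont[OF flat_deriv])

lemma outside_disc: "0 < \<delta> \<Longrightarrow> \<delta> < norm z \<Longrightarrow> \<delta>\<^sup>2 - (norm z)\<^sup>2 \<le> 0"
  by (simp add: power_mono)

lemma bump_props:
  assumes "0 < \<delta>"
  shows "continuous_on UNIV (bump \<delta>)" "integrable lborel (bump \<delta>)" "0 < (LINT z|lborel. bump \<delta> z)"
    "\<And>z. \<delta> < norm z \<Longrightarrow> bump \<delta> z = 0" "\<And>z. 0 \<le> bump \<delta> z"
proof -
  show c: "continuous_on UNIV (bump \<delta>)" unfolding bump_def
    by (rule continuous_on_compose2[OF continuous_flat]) (auto intro!: continuous_intros)
  then have [measurable]: "bump \<delta> \<in> borel_measurable borel" by (rule borel_measurable_continuous_onI)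
  show nn: "0 \<le> bump \<delta> z" for z by (simp add: bump_def flat_nonneg)
  show zero: "\<delta> < norm z \<Longrightarrow> bump \<delta> z = 0" for z
    using outside_disc[OF assms, of z] by (simp add: bump_def flat_def)
  have i: "integrable lborel (\<lambda>z. indicat_real (cball (0::real^2) \<delta>) z)"
    using emeasure_lborel_cball_finite[of "0::real^2" \<delta>] by (intro integrable_real_indicator) auto
  show int: "integrable lborel (bump \<delta>)"
  proof (rule Bochner_Integration.integrable_bound[OF i])
    have "bump \<delta> z \<le> indicat_real (cball 0 \<delta>) z" for z
      using zero[of z] flat_0_le_one by (auto simp: indicator_def bump_def)
    then show "AE z in lborel. norm (bump \<delta> z) \<le> norm (indicat_real (cball (0::real^2) \<delta>) z)"
      using nn by (intro AE_I2) (simp add: abs_of_nonneg)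
  qed simp
  define k where "k = exp (- (1 / (\<delta>\<^sup>2 * (3 / 4))))"
  have "0 < k * measure lborel (ball (0::real^2) (\<delta> / 2))"
    using content_ball_pos[of "\<delta> / 2" "0::real^2"] assms by (simp add: k_def)
  also have "k * measure lborel (ball (0::real^2) (\<delta> / 2)) = (LINT z|lborel. k * indicat_real (ball 0 (\<delta> / 2)) (z::real^2))"
    using emeasure_lborel_ball_finite[of "0::real^2" "\<delta> / 2"] by simp
  also have "\<dots> \<le> (LINT z|lborel. bump \<delta> z)"
  proof (rule integral_mono[OF _ int])
    show "integrable lborel (\<lambda>z::real^2. k * indicat_real (ball 0 (\<delta> / 2)) z)"
      using emeasure_lborel_ball_finite[of "0::real^2" "\<delta> / 2"] by (intro integrable_mult_right integrable_real_indicator) auto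
    fix z :: "real^2"
    show "k * indicat_real (ball 0 (\<delta> / 2)) z \<le> bump \<delta> z"
    proof (cases "norm z < \<delta> / 2")
      case True
      have "(norm z)\<^sup>2 \<le> (\<delta> / 2)\<^sup>2" using True by (intro power_mono) auto
      then have "\<delta>\<^sup>2 * (3 / 4) \<le> \<delta>\<^sup>2 - (norm z)\<^sup>2" by (simp add: power_divide)
      moreover have "0 < \<delta>\<^sup>2 * (3 / 4)" using assms by simp
      ultimately have "0 < \<delta>\<^sup>2 - (norm z)\<^sup>2" "1 / (\<delta>\<^sup>2 - (norm z)\<^sup>2) \<le> 1 / (\<delta>\<^sup>2 * (3 / 4))"
        by (linarith, intro frac_le) auto
      then show ?thesis using True by (simp add: bump_def flat_def k_def)
    qed (use nn in simp)
  qed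
  finally show "0 < (LINT z|lborel. bump \<delta> z)" .
qed

lemma mollifier_props:
  assumes \<delta>: "0 < \<delta>"
  shows "continuous_on UNIV (mollifier \<delta>)" "\<And>z. 0 \<le> mollifier \<delta> z" "\<And>z. \<delta> < norm z \<Longrightarrow> mollifier \<delta> z = 0"
    "(\<integral>\<^sup>+z. ennreal (mollifier \<delta> z) \<partial>lborel) = 1"
    "\<And>z. (mollifier \<delta> has_derivative (\<lambda>h. mollifier_grad \<delta> z \<bullet> h)) (at z)"
    "continuous_on UNIV (mollifier_grad \<delta>)" "\<And>z. \<delta> < norm z \<Longrightarrow> mollifier_grad \<delta> z = 0"
proof -
  note b = bump_props[OF \<delta>]
  let ?m = "LINT z|lborel. bump \<delta> z"
  show "continuous_on UNIV (mollifier \<delta>)" unfolding mollifier_def using b(3) by (intro continuous_intros b(1)) auto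
  show "0 \<le> mollifier \<delta> z" for z unfolding mollifier_def using b(3,5) by (simp add: less_imp_le)
  show "\<delta> < norm z \<Longrightarrow> mollifier \<delta> z = 0" for z by (simp add: mollifier_def b(4))
  have "(\<integral>\<^sup>+z. ennreal (mollifier \<delta> z) \<partial>lborel) = ennreal (LINT z|lborel. mollifier \<delta> z)"
    unfolding mollifier_def using b(2,3,5) by (intro nn_integral_eq_integral) (auto simp: less_imp_le)
  also have "(LINT z|lborel. mollifier \<delta> z) = 1" unfolding mollifier_def using b(3) by simp
  finally show "(\<integral>\<^sup>+z. ennreal (mollifier \<delta> z) \<partial>lborel) = 1" by simp
  show "(mollifier \<delta> has_derivative (\<lambda>h. mollifier_grad \<delta> z \<bullet> h)) (at z)" for z
  proof -
    have "((\<lambda>z. \<delta>\<^sup>2 - z \<bullet> z) has_derivative (\<lambda>h. - (2 * (z \<bullet> h)))) (at z)"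
      by (auto intro!: derivative_eq_intros simp: inner_commute)
    from has_derivative_compose[OF this flat_deriv[of 0, unfolded has_field_derivative_def]]
    have "(bump \<delta> has_derivative (\<lambda>h. flat 2 (\<delta>\<^sup>2 - z \<bullet> z) * - (2 * (z \<bullet> h)))) (at z)"
      unfolding bump_def[abs_def] power2_norm_eq_inner by (simp add: numeral_2_eq_2)
    note d = has_derivative_mult_left[OF this, of "1 / ?m"]
    have 1: "mollifier \<delta> = (\<lambda>x. bump \<delta> x * (1 / ?m))" by (simp add: fun_eq_iff mollifier_def)
    have 2: "(\<lambda>h. mollifier_grad \<delta> z \<bullet> h) = (\<lambda>h. flat 2 (\<delta>\<^sup>2 - z \<bullet> z) * - (2 * (z \<bullet> h)) * (1 / ?m))"
      by (simp add: fun_eq_iff mollifier_grad_def power2_norm_eq_inner)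
    show ?thesis unfolding 1 2 by (rule d)
  qed
  show "continuous_on UNIV (mollifier_grad \<delta>)" unfolding mollifier_grad_def[abs_def] using b(3)
    by (intro continuous_intros continuous_on_compose2[OF continuous_flat[of 2]]) auto
  show "\<delta> < norm z \<Longrightarrow> mollifier_grad \<delta> z = 0" for z
    using outside_disc[OF \<delta>, of z] by (simp add: mollifier_grad_def flat_def)
qed

lemma mollifier_translate_test_function:
  assumes \<delta>: "0 < \<delta>"
  shows "(\<lambda>y. mollifier \<delta> (x - y)) \<in> test_functions"
    and "partial_deriv k (\<lambda>y. mollifier \<delta> (x - y)) y = - (mollifier_grad \<delta> (x - y) $ k)"
proof -
  have "(\<lambda>y. (1 / (LINT z|lborel. bump \<delta> z)) * flat 0 (\<delta>\<^sup>2 + (- 1) * (norm (y - x))\<^sup>2)) \<in> smooth_algebra"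
    by (intro smooth_algebra.intros(1-5) smooth_algebra_norm_square)
  moreover have "(\<lambda>y. (1 / (LINT z|lborel. bump \<delta> z)) * flat 0 (\<delta>\<^sup>2 + (- 1) * (norm (y - x))\<^sup>2)) = (\<lambda>y. mollifier \<delta> (x - y))"
    by (simp add: mollifier_def bump_def fun_eq_iff norm_minus_commute)
  ultimately have "(\<lambda>y. mollifier \<delta> (x - y)) \<in> smooth_algebra" by simp
  then show "(\<lambda>y. mollifier \<delta> (x - y)) \<in> test_functions"
  proof (rule smooth_algebra_test_function[where R = "norm x + \<delta>"])
    fix y :: "real^2" assume "norm x + \<delta> < norm y"
    then have "\<delta> < norm (x - y)" using norm_triangle_ineq4[of x "x - y"] by simp
    then show "mollifier \<delta> (x - y) = 0" by (rule mollifier_props(3)[OF \<delta>])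
  qed
  have "((\<lambda>y. x - y) has_derivative (\<lambda>h. - h)) (at y)" by (auto intro!: derivative_eq_intros)
  from partial_deriv_eq[OF has_derivative_compose[OF this mollifier_props(5)[OF \<delta>]], of k]
  show "partial_deriv k (\<lambda>y. mollifier \<delta> (x - y)) y = - (mollifier_grad \<delta> (x - y) $ k)"
    by (simp add: inner_axis)
qed

lemma convolution_integrable:
  fixes f :: "real^2 \<Rightarrow> 'b::{banach,second_countable_topology}"
  assumes k: "continuous_on UNIV k" and supp: "\<And>z. \<delta> < norm z \<Longrightarrow> k z = (0::real)"
    and [measurable]: "f \<in> borel_measurable borel" and f: "\<And>R. set_integrable lborel (cball 0 R) f"
  shows "integrable lborel (\<lambda>y. k (x - y) *\<^sub>R f y)"
proof -
  have [measurable]: "k \<in> borel_measurable borel" using k by (rule borel_measurable_continuous_onI)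
  obtain M where M: "0 \<le> M" "\<And>z. norm (k z) \<le> M" by (rule compact_support_bounded[where R = \<delta>, OF k], erule supp, rule that)
  have "integrable lborel (\<lambda>y. M *\<^sub>R (indicat_real (cball 0 (norm x + \<delta>)) y *\<^sub>R f y))"
    using f[of "norm x + \<delta>"] unfolding set_integrable_def by (rule integrable_scaleR_right)
  then show ?thesis
  proof (rule Bochner_Integration.integrable_bound)
    show "AE y in lborel. norm (k (x - y) *\<^sub>R f y) \<le> norm (M *\<^sub>R indicat_real (cball 0 (norm x + \<delta>)) y *\<^sub>R f y)"
    proof (rule AE_I2)
      fix y
      show "norm (k (x - y) *\<^sub>R f y) \<le> norm (M *\<^sub>R indicat_real (cball 0 (norm x + \<delta>)) y *\<^sub>R f y)"
      proof (cases "norm y \<le> norm x + \<delta>")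
        case True
        then show ?thesis using M by (simp add: mult_right_mono)
      next
        case False
        then have "\<delta> < norm (x - y)" using norm_triangle_ineq4[of x "x - y"] by simp
        then show ?thesis using supp by simp
      qed
    qed
  qed measurable
qed

text \<open>
  The remainder of the mollifier is \<open>o(h)\<close> uniformly in its argument, since its gradient is uniformly
  continuous. It vanishes off a fixed ball, on which \<open>f\<close> is integrable.
\<close>
lemma mollify_has_derivative:
  fixes f :: "real^2 \<Rightarrow> 'b::{banach,second_countable_topology}"
  assumes \<delta>: "0 < \<delta>" and [measurable]: "f \<in> borel_measurable borel" and f: "\<And>R. set_integrable lborel (cball 0 R) f"
  shows "(mollify \<delta> f has_derivative (\<lambda>h. LINT y|lborel. (mollifier_grad \<delta> (x - y) \<bullet> h) *\<^sub>R f y)) (at x)"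
proof -
  note m = mollifier_props[OF \<delta>]
  define D where "D h = (LINT y|lborel. (mollifier_grad \<delta> (x - y) \<bullet> h) *\<^sub>R f y)" for h
  have i1: "integrable lborel (\<lambda>y. mollifier \<delta> (z - y) *\<^sub>R f y)" for z
    by (rule convolution_integrable[OF m(1,3) _ f]) auto
  have i2: "integrable lborel (\<lambda>y. (mollifier_grad \<delta> (x - y) \<bullet> h) *\<^sub>R f y)" for h
    by (rule convolution_integrable[where k = "\<lambda>z. mollifier_grad \<delta> z \<bullet> h" and \<delta> = \<delta>, OF _ _ _ f])
       (auto intro!: continuous_intros m(6) simp: m(7))
  have "linear D"
    unfolding D_def
    by (rule linearI) (auto simp: inner_add_right scaleR_add_left i2[simplified] Bochner_Integration.integral_add[OF i2 i2] scaleR_scaleR[symmetric] simp del: scaleR_scaleR)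
  then have bl: "bounded_linear D" by (simp add: linear_conv_bounded_linear)
  have "\<forall>e>0. \<exists>d>0. \<forall>x'\<in>UNIV. norm (x' - x) < d \<longrightarrow> norm (mollify \<delta> f x' - mollify \<delta> f x - D (x' - x)) \<le> e * norm (x' - x)"
  proof (intro allI impI)
    fix e :: real assume e: "0 < e"
    define R where "R = norm x + \<delta> + 1"
    define I where "I = (LINT y|lborel. norm (indicat_real (cball 0 R) y *\<^sub>R f y))"
    have I: "0 \<le> I" unfolding I_def by simp
    define e' where "e' = e / (I + 1)"
    have e': "0 < e'" "e' * I \<le> e" using e I by (auto simp: e'_def field_simps)
    obtain d where d: "0 < d" "\<And>z z'. norm (z - z') < d \<Longrightarrow> norm (mollifier_grad \<delta> z - mollifier_grad \<delta> z') \<le> e'"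
      by (rule compact_support_uniformly_continuous[where R = \<delta>, OF m(6) _ e'(1)], erule m(7), rule that)
    have rem: "\<bar>mollifier \<delta> z' - mollifier \<delta> z - mollifier_grad \<delta> z \<bullet> (z' - z)\<bar> \<le> norm (z' - z) * e'"
      if "norm (z' - z) < d" for z z'
    proof -
      have "norm (mollifier \<delta> z' - mollifier \<delta> z - (\<lambda>h. mollifier_grad \<delta> z \<bullet> h) (z' - z)) \<le> norm (z' - z) * e'"
      proof (rule differentiable_bound_linearization[of z z' "ball z d" "mollifier \<delta>" "\<lambda>y h. mollifier_grad \<delta> y \<bullet> h" z e'])
        show "z + t *\<^sub>R (z' - z) \<in> ball z d" if "t \<in> {0..1}" for t
        proof -
          have "norm (t *\<^sub>R (z' - z)) \<le> 1 * norm (z' - z)"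
            unfolding norm_scaleR using that by (intro mult_right_mono) auto
          then show ?thesis using \<open>norm (z' - z) < d\<close> by (simp add: dist_norm)
        qed
        show "(mollifier \<delta> has_derivative (\<lambda>h. mollifier_grad \<delta> y \<bullet> h)) (at y within ball z d)" for y
          by (rule has_derivative_at_withinI[OF m(5)])
        show "onorm ((\<lambda>h. mollifier_grad \<delta> y \<bullet> h) - (\<lambda>h. mollifier_grad \<delta> z \<bullet> h)) \<le> e'" if "y \<in> ball z d" for y
          unfolding fun_diff_def
        proof (rule onorm_le)
          fix h
          have "norm (mollifier_grad \<delta> y \<bullet> h - mollifier_grad \<delta> z \<bullet> h) = \<bar>(mollifier_grad \<delta> y - mollifier_grad \<delta> z) \<bullet> h\<bar>"
            by (simp add: inner_diff_left)
          also have "\<dots> \<le> norm (mollifier_grad \<delta> y - mollifier_grad \<delta> z) * norm h" by (rule Cauchy_Schwarz_ineq2)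
          also have "\<dots> \<le> e' * norm h" using that d(2)[of y z] by (intro mult_right_mono) (auto simp: dist_norm norm_minus_commute)
          finally show "norm (mollifier_grad \<delta> y \<bullet> h - mollifier_grad \<delta> z \<bullet> h) \<le> e' * norm h" .
        qed
      qed (use d in auto)
      then show ?thesis by simp
    qed
    show "\<exists>d>0. \<forall>x'\<in>UNIV. norm (x' - x) < d \<longrightarrow> norm (mollify \<delta> f x' - mollify \<delta> f x - D (x' - x)) \<le> e * norm (x' - x)"
    proof (intro exI[of _ "min d 1"] conjI ballI impI)
      fix x' assume x': "norm (x' - x) < min d 1"
      have "mollify \<delta> f x' - mollify \<delta> f x - D (x' - x)
        = (LINT y|lborel. mollifier \<delta> (x' - y) *\<^sub>R f y - mollifier \<delta> (x - y) *\<^sub>R f y - (mollifier_grad \<delta> (x - y) \<bullet> (x' - x)) *\<^sub>R f y)"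
        unfolding mollify_def D_def
        by (simp only: Bochner_Integration.integral_diff Bochner_Integration.integrable_diff i1 i2)
      also have "norm \<dots> \<le> (LINT y|lborel. (norm (x' - x) * e') * norm (indicat_real (cball 0 R) y *\<^sub>R f y))"
      proof (rule Bochner_Integration.integral_norm_bound_integral)
        show "integrable lborel (\<lambda>y. mollifier \<delta> (x' - y) *\<^sub>R f y - mollifier \<delta> (x - y) *\<^sub>R f y - (mollifier_grad \<delta> (x - y) \<bullet> (x' - x)) *\<^sub>R f y)"
          by (intro Bochner_Integration.integrable_diff i1 i2)
        show "integrable lborel (\<lambda>y. (norm (x' - x) * e') * norm (indicat_real (cball 0 R) y *\<^sub>R f y))"
          using f[of R] unfolding set_integrable_def by (intro integrable_mult_right integrable_norm)
        fix y
        have fac: "mollifier \<delta> (x' - y) *\<^sub>R f y - mollifier \<delta> (x - y) *\<^sub>R f y - (mollifier_grad \<delta> (x - y) \<bullet> (x' - x)) *\<^sub>R f y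
          = (mollifier \<delta> (x' - y) - mollifier \<delta> (x - y) - mollifier_grad \<delta> (x - y) \<bullet> ((x' - y) - (x - y))) *\<^sub>R f y"
          by (simp add: scaleR_diff_left)
        show "norm (mollifier \<delta> (x' - y) *\<^sub>R f y - mollifier \<delta> (x - y) *\<^sub>R f y - (mollifier_grad \<delta> (x - y) \<bullet> (x' - x)) *\<^sub>R f y)
          \<le> (norm (x' - x) * e') * norm (indicat_real (cball 0 R) y *\<^sub>R f y)"
        proof (cases "norm y \<le> R")
          case True
          then show ?thesis unfolding fac using rem[of "x' - y" "x - y"] x' by (simp add: mult_right_mono)
        next
          case False
          have "norm y \<le> norm x + norm (x - y)" "norm y \<le> norm x' + norm (x' - y)" "norm x' \<le> norm x + norm (x' - x)"
            using norm_triangle_ineq4[of x "x - y"] norm_triangle_ineq4[of x' "x' - y"] norm_triangle_ineq[of x "x' - x"] by auto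
          then have "\<delta> < norm (x - y)" "\<delta> < norm (x' - y)" using False x' by (auto simp: R_def)
          then show ?thesis using e'(1) by (simp add: m(3,7))
        qed
      qed
      also have "\<dots> = norm (x' - x) * (e' * I)" by (simp add: I_def)
      also have "\<dots> \<le> norm (x' - x) * e" using e' by (intro mult_left_mono) auto
      finally show "norm (mollify \<delta> f x' - mollify \<delta> f x - D (x' - x)) \<le> e * norm (x' - x)" by (simp add: mult.commute)
    qed (use d in auto)
  qed
  with bl have "(mollify \<delta> f has_derivative D) (at x)" by (simp add: has_derivative_within_alt)
  then show ?thesis unfolding D_def .
qed

lemma continuous_mollify:
  fixes f :: "real^2 \<Rightarrow> 'b::{banach,second_countable_topology}"
  assumes "0 < \<delta>" and "f \<in> borel_measurable borel" and "\<And>R. set_integrable lborel (cball 0 R) f"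
  shows "continuous_on UNIV (mollify \<delta> f)"
  by (rule has_derivative_continuous_on[OF has_derivative_at_withinI[OF mollify_has_derivative[OF assms]]])

lemma L2_locally_integrable:
  fixes f :: "real^2 \<Rightarrow> 'b::{banach,second_countable_topology}"
  assumes [measurable]: "f \<in> borel_measurable borel" and fin: "(\<integral>\<^sup>+x. ennreal ((norm (f x))\<^sup>2) \<partial>lborel) < \<infinity>"
  shows "set_integrable lborel (cball 0 R) f"
  unfolding set_integrable_def
proof (rule integrableI_bounded)
  show "(\<lambda>x. indicat_real (cball 0 R) x *\<^sub>R f x) \<in> borel_measurable lborel"
    by (auto intro!: borel_measurable_scaleR borel_measurable_indicator)
  have "(\<integral>\<^sup>+x. ennreal (norm (indicat_real (cball 0 R) x *\<^sub>R f x)) \<partial>lborel)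
    \<le> (\<integral>\<^sup>+x. indicator (cball 0 R) x + ennreal ((norm (f x))\<^sup>2) \<partial>lborel)"
  proof (rule nn_integral_mono)
    fix x
    have "norm (f x) \<le> 1 + (norm (f x))\<^sup>2" 
      using sum_squares_bound[of 1 "norm (f x)"] norm_ge_zero[of "f x"] unfolding one_power2 by linarith
    then show "ennreal (norm (indicat_real (cball 0 R) x *\<^sub>R f x)) \<le> indicator (cball 0 R) x + ennreal ((norm (f x))\<^sup>2)"
      by (auto simp: indicator_def ennreal_1[symmetric] ennreal_plus[symmetric] simp del: ennreal_1 ennreal_plus intro!: ennreal_leI)
  qed
  also have "\<dots> = emeasure lborel (cball (0::real^2) R) + (\<integral>\<^sup>+x. ennreal ((norm (f x))\<^sup>2) \<partial>lborel)"
    by (subst nn_integral_add) (auto intro!: borel_measurable_indicator)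
  also have "\<dots> < \<infinity>" using fin emeasure_lborel_cball_finite[of "0::real^2" R] by simp
  finally show "(\<integral>\<^sup>+x. ennreal (norm (indicat_real (cball 0 R) x *\<^sub>R f x)) \<partial>lborel) < \<infinity>" .
qed

lemma nn_integral_reflect_translate:
  fixes f :: "real^2 \<Rightarrow> ennreal"
  assumes [measurable]: "f \<in> borel_measurable borel"
  shows "(\<integral>\<^sup>+y. f (x - y) \<partial>lborel) = (\<integral>\<^sup>+y. f y \<partial>lborel)" "(\<integral>\<^sup>+y. f (y - x) \<partial>lborel) = (\<integral>\<^sup>+y. f y \<partial>lborel)"
proof -
  have 1: "lborel = distr lborel borel (\<lambda>y::real^2. x - y)"
    using lborel_affine[of "-1" x] by (simp add: density_1)
  show "(\<integral>\<^sup>+y. f (x - y) \<partial>lborel) = (\<integral>\<^sup>+y. f y \<partial>lborel)"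
    by (subst (2) 1) (simp add: nn_integral_distr)
  have 2: "lborel = distr lborel borel (\<lambda>y::real^2. y - x)"
  proof -
    have "(+) (- x) = (\<lambda>y. y - x)" by (simp add: fun_eq_iff)
    then show ?thesis using lborel_distr_plus[of "- x"] by simp
  qed
  show "(\<integral>\<^sup>+y. f (y - x) \<partial>lborel) = (\<integral>\<^sup>+y. f y \<partial>lborel)"
    by (subst (2) 2) (simp add: nn_integral_distr)
qed

text \<open>
  Since the mollifier is a probability density, the Cauchy-Schwarz inequality bounds the square of the mean by the mean of
  the square; then integrate in \<open>x\<close> first.
\<close>
lemma mollify_contraction_L2:
  fixes f :: "real^2 \<Rightarrow> real"
  assumes \<delta>: "0 < \<delta>" and [measurable]: "f \<in> borel_measurable borel" and f: "\<And>R. set_integrable lborel (cball 0 R) f"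
  shows "(\<integral>\<^sup>+x. ennreal ((mollify \<delta> f x)\<^sup>2) \<partial>lborel) \<le> (\<integral>\<^sup>+x. ennreal ((f x)\<^sup>2) \<partial>lborel)"
proof -
  note m = mollifier_props[OF \<delta>]
  have mm [measurable]: "mollifier \<delta> \<in> borel_measurable borel" using m(1) by (rule borel_measurable_continuous_onI)
  have one: "(\<integral>\<^sup>+y. ennreal (mollifier \<delta> (x - y)) \<partial>lborel) = 1" "(\<integral>\<^sup>+x. ennreal (mollifier \<delta> (x - y)) \<partial>lborel) = 1" for x y
    using nn_integral_reflect_translate[of "\<lambda>z. ennreal (mollifier \<delta> z)"] m(4) by simp_all
  have pw: "ennreal ((mollify \<delta> f x)\<^sup>2) \<le> (\<integral>\<^sup>+y. ennreal (mollifier \<delta> (x - y)) * ennreal ((f y)\<^sup>2) \<partial>lborel)" for x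
  proof -
    have "ennreal \<bar>mollify \<delta> f x\<bar> \<le> (\<integral>\<^sup>+y. ennreal (norm (mollifier \<delta> (x - y) *\<^sub>R f y)) \<partial>lborel)"
      using integral_norm_bound_ennreal[OF convolution_integrable[where k = "mollifier \<delta>" and \<delta> = \<delta>, OF m(1,3) _ f]]
      unfolding mollify_def real_norm_def by measurable
    also have "\<dots> = (\<integral>\<^sup>+y. ennreal (sqrt (mollifier \<delta> (x - y))) * ennreal (sqrt (mollifier \<delta> (x - y)) * \<bar>f y\<bar>) \<partial>lborel)"
      using m(2) by (intro nn_integral_cong) (simp add: ennreal_mult'[symmetric] abs_mult)
    finally have "(ennreal \<bar>mollify \<delta> f x\<bar>)\<^sup>2 \<le> \<dots>\<^sup>2" by (intro power_mono) auto
    also have "\<dots> \<le> (\<integral>\<^sup>+y. (ennreal (sqrt (mollifier \<delta> (x - y))))\<^sup>2 \<partial>lborel) * (\<integral>\<^sup>+y. (ennreal (sqrt (mollifier \<delta> (x - y)) * \<bar>f y\<bar>))\<^sup>2 \<partial>lborel)"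
      by (rule Cauchy_Schwarz_nn_integral) measurable
    also have "(\<integral>\<^sup>+y. (ennreal (sqrt (mollifier \<delta> (x - y))))\<^sup>2 \<partial>lborel) = 1"
      using m(2) one(1)[of x] by (simp add: ennreal_power)
    also have "(\<integral>\<^sup>+y. (ennreal (sqrt (mollifier \<delta> (x - y)) * \<bar>f y\<bar>))\<^sup>2 \<partial>lborel) = (\<integral>\<^sup>+y. ennreal (mollifier \<delta> (x - y)) * ennreal ((f y)\<^sup>2) \<partial>lborel)"
      using m(2) by (intro nn_integral_cong) (simp add: ennreal_power power_mult_distrib ennreal_mult')
    finally show ?thesis by (simp add: ennreal_power)
  qed
  have "(\<integral>\<^sup>+x. ennreal ((mollify \<delta> f x)\<^sup>2) \<partial>lborel) \<le> (\<integral>\<^sup>+x. \<integral>\<^sup>+y. ennreal (mollifier \<delta> (x - y)) * ennreal ((f y)\<^sup>2) \<partial>lborel \<partial>lborel)"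
    by (intro nn_integral_mono pw)
  also have "\<dots> = (\<integral>\<^sup>+y. \<integral>\<^sup>+x. ennreal (mollifier \<delta> (x - y)) * ennreal ((f y)\<^sup>2) \<partial>lborel \<partial>lborel)"
    by (rule lborel_pair.Fubini') measurable
  also have "\<dots> = (\<integral>\<^sup>+x. ennreal ((f x)\<^sup>2) \<partial>lborel)"
    by (intro nn_integral_cong) (simp add: nn_integral_multc one)
  finally show ?thesis .
qed

lemma mollify_uniform_approx:
  fixes c :: "real^2 \<Rightarrow> real"
  assumes c: "continuous_on UNIV c" and \<delta>: "0 < \<delta>" "\<delta> < d" and e: "\<And>x y. norm (x - y) < d \<Longrightarrow> norm (c x - c y) \<le> e"
  shows "\<bar>mollify \<delta> c x - c x\<bar> \<le> e"
proof -
  note m = mollifier_props[OF \<delta>(1)]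
  have mm [measurable]: "mollifier \<delta> \<in> borel_measurable borel" using m(1) by (rule borel_measurable_continuous_onI)
  have [measurable]: "c \<in> borel_measurable borel" using c by (rule borel_measurable_continuous_onI)
  have one: "(\<integral>\<^sup>+y. ennreal (mollifier \<delta> (x - y)) \<partial>lborel) = 1"
    using nn_integral_reflect_translate(1)[of "\<lambda>z. ennreal (mollifier \<delta> z)" x] m(4) by simp
  have i: "integrable lborel (\<lambda>y. mollifier \<delta> (x - y))"
    using one m(2) by (intro integrableI_bounded) auto
  have l1: "(LINT y|lborel. mollifier \<delta> (x - y)) = 1"
    using one m(2) by (simp add: integral_eq_nn_integral)
  have ci: "set_integrable lborel (cball 0 R) c" for R
    unfolding set_integrable_def by (rule borel_integrable_compact) (auto intro: continuous_on_subset[OF c])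
  have i2: "integrable lborel (\<lambda>y. mollifier \<delta> (x - y) *\<^sub>R c y)"
    by (rule convolution_integrable[where \<delta> = \<delta>, OF m(1,3) _ ci]) auto
  have "mollify \<delta> c x - c x = (LINT y|lborel. mollifier \<delta> (x - y) *\<^sub>R c y - mollifier \<delta> (x - y) * c x)"
    unfolding mollify_def using i i2 by (simp add: l1)
  also have "\<bar>\<dots>\<bar> \<le> (LINT y|lborel. mollifier \<delta> (x - y) * e)"
    unfolding real_norm_def[symmetric]
  proof (rule Bochner_Integration.integral_norm_bound_integral)
    show "integrable lborel (\<lambda>y. mollifier \<delta> (x - y) *\<^sub>R c y - mollifier \<delta> (x - y) * c x)"
      using i i2 by (intro Bochner_Integration.integrable_diff) auto
    show "integrable lborel (\<lambda>y. mollifier \<delta> (x - y) * e)" using i by auto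
    fix y
    show "norm (mollifier \<delta> (x - y) *\<^sub>R c y - mollifier \<delta> (x - y) * c x) \<le> mollifier \<delta> (x - y) * e"
    proof (cases "norm (x - y) \<le> \<delta>")
      case True
      then have "\<bar>c y - c x\<bar> \<le> e" using e[of y x] \<delta> by (simp add: norm_minus_commute)
      then have "mollifier \<delta> (x - y) * \<bar>c y - c x\<bar> \<le> mollifier \<delta> (x - y) * e" using m(2) by (intro mult_left_mono)
      then show ?thesis using m(2)[of "x - y"] by (simp add: right_diff_distrib[symmetric] abs_mult)
    next
      case False
      then show ?thesis using m(3) by simp
    qed
  qed
  also have "\<dots> = e" using l1 by simp
  finally show ?thesis .
qed

text \<open>
  For a continuous function of bounded support the convergence is uniform on a bounded set. The contraction property
  transfers it to all of \<open>L\<^sup>2\<close>.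
\<close>
lemma mollify_L2_close:
  fixes f :: "real^2 \<Rightarrow> real"
  assumes fm [measurable]: "f \<in> borel_measurable borel" and fin: "(\<integral>\<^sup>+x. ennreal ((f x)\<^sup>2) \<partial>lborel) < \<infinity>" and e: "0 < e"
  shows "\<exists>d>0. \<forall>\<delta>. 0 < \<delta> \<and> \<delta> < d \<longrightarrow> (\<integral>\<^sup>+x. ennreal ((mollify \<delta> f x - f x)\<^sup>2) \<partial>lborel) \<le> ennreal e"
proof -
  \<comment> \<open>The triangle inequality is applied twice, each time with the factor \<open>2\<^sup>2\<close>: \<open>4 (e1 + 4 (e1 + e1)) = 36 e1\<close>.\<close>
  define e1 where "e1 = e / 36"
  have e1: "0 < e1" using e by (simp add: e1_def)
  have "Cc_approximable 2 f" using fin by (intro Cc_dense_Lp) auto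
  then obtain c where c: "continuous_on UNIV c" "bounded {x. c x \<noteq> 0}"
      and fc: "(\<integral>\<^sup>+x. ennreal (\<bar>f x - c x\<bar> ^ 2) \<partial>lborel) \<le> ennreal e1"
    using e1 unfolding Cc_approximable_def by meson
  have cm [measurable]: "c \<in> borel_measurable borel" using c(1) by (rule borel_measurable_continuous_onI)
  from c(2) obtain R where "\<forall>x\<in>{x. c x \<noteq> 0}. norm x \<le> R" unfolding bounded_iff by blast
  then have R: "\<And>x. R < norm x \<Longrightarrow> c x = 0" by force
  define V where "V = measure lborel (cball (0::real^2) (R + 1))"
  have V: "0 \<le> V" by (simp add: V_def)
  define e2 where "e2 = sqrt (e1 / (V + 1))"
  have e2: "0 < e2" "e2\<^sup>2 * V \<le> e1" using e1 V by (auto simp: e2_def field_simps)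
  obtain d where d: "0 < d" "\<And>x y. norm (x - y) < d \<Longrightarrow> norm (c x - c y) \<le> e2"
    by (rule compact_support_uniformly_continuous[where R = R, OF c(1) _ e2(1)], erule R, rule that)
  have fi: "set_integrable lborel (cball 0 R) f" for R
    using fin by (intro L2_locally_integrable) auto
  have ci: "set_integrable lborel (cball 0 R) c" for R
    unfolding set_integrable_def by (rule borel_integrable_compact) (auto intro: continuous_on_subset[OF c(1)])
  show ?thesis
  proof (intro exI[of _ "min d 1"] conjI allI impI)
    fix \<delta> assume "0 < \<delta> \<and> \<delta> < min d 1"
    then have \<delta>: "0 < \<delta>" "\<delta> < d" "\<delta> < 1" by auto
    note m = mollifier_props[OF \<delta>(1)]
    have mc: "mollify \<delta> f \<in> borel_measurable borel" "mollify \<delta> c \<in> borel_measurable borel"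
      by (rule borel_measurable_continuous_onI[OF continuous_mollify[OF \<delta>(1) fm fi]],
          rule borel_measurable_continuous_onI[OF continuous_mollify[OF \<delta>(1) cm ci]])
    have "mollify \<delta> f x - mollify \<delta> c x = mollify \<delta> (\<lambda>y. f y - c y) x" for x
      unfolding mollify_def
      by (simp add: right_diff_distrib Bochner_Integration.integral_diff
          convolution_integrable[where k = "mollifier \<delta>" and \<delta> = \<delta>, OF m(1,3) fm fi, simplified]
          convolution_integrable[where k = "mollifier \<delta>" and \<delta> = \<delta>, OF m(1,3) cm ci, simplified])
    then have "(\<integral>\<^sup>+x. ennreal (\<bar>mollify \<delta> f x - mollify \<delta> c x\<bar> ^ 2) \<partial>lborel) = (\<integral>\<^sup>+x. ennreal ((mollify \<delta> (\<lambda>y. f y - c y) x)\<^sup>2) \<partial>lborel)" by simp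
    also have "\<dots> \<le> (\<integral>\<^sup>+x. ennreal ((f x - c x)\<^sup>2) \<partial>lborel)"
      by (intro mollify_contraction_L2 \<delta>) (auto intro: set_integral_diff(1) fi ci)
    finally have 1: "(\<integral>\<^sup>+x. ennreal (\<bar>mollify \<delta> f x - mollify \<delta> c x\<bar> ^ 2) \<partial>lborel) \<le> ennreal e1" using fc by simp
    have "(\<integral>\<^sup>+x. ennreal (\<bar>mollify \<delta> c x - c x\<bar> ^ 2) \<partial>lborel) \<le> (\<integral>\<^sup>+x. ennreal (e2\<^sup>2) * indicator (cball (0::real^2) (R + 1)) x \<partial>lborel)"
    proof (rule nn_integral_mono)
      fix x :: "real^2"
      show "ennreal (\<bar>mollify \<delta> c x - c x\<bar> ^ 2) \<le> ennreal (e2\<^sup>2) * indicator (cball (0::real^2) (R + 1)) x"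
      proof (cases "norm x \<le> R + 1")
        case True
        have "\<bar>mollify \<delta> c x - c x\<bar> ^ 2 \<le> e2\<^sup>2"
          by (intro power_mono mollify_uniform_approx[OF c(1) \<delta>(1,2) d(2)]) auto
        then show ?thesis using True by (simp add: ennreal_leI)
      next
        case False
        have "mollifier \<delta> (x - y) *\<^sub>R c y = 0" for y
        proof (cases "norm y \<le> R")
          case True
          then have "\<delta> < norm (x - y)" using False \<delta> norm_triangle_ineq[of y "x - y"] by simp
          then show ?thesis using m(3) by simp
        qed (use R in auto)
        then have "mollify \<delta> c x = 0" by (simp only: mollify_def) simp
        then show ?thesis using False R[of x] by simp
      qed
    qed
    also have "\<dots> = ennreal (e2\<^sup>2 * V)"
      using emeasure_lborel_cball_finite[of "0::real^2" "R + 1"]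
      by (subst nn_integral_cmult_indicator) (auto simp: V_def emeasure_eq_ennreal_measure ennreal_mult' less_top)
    also have "\<dots> \<le> ennreal e1" using e2 by (intro ennreal_leI)
    finally have 2: "(\<integral>\<^sup>+x. ennreal (\<bar>mollify \<delta> c x - c x\<bar> ^ 2) \<partial>lborel) \<le> ennreal e1" .
    have fc': "(\<integral>\<^sup>+x. ennreal (\<bar>c x - f x\<bar> ^ 2) \<partial>lborel) \<le> ennreal e1" using fc by (simp add: abs_minus_commute power2_commute)
    have "(\<integral>\<^sup>+x. ennreal (\<bar>mollify \<delta> f x - f x\<bar> ^ 2) \<partial>lborel) \<le> ennreal (2 ^ 2 * (e1 + (2 ^ 2 * (e1 + e1))))"
      using e1 by (intro nn_integral_diff_power_le[OF mc(1) mc(2) fm 1 nn_integral_diff_power_le[OF mc(2) cm fm 2 fc']]) auto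
    then show "(\<integral>\<^sup>+x. ennreal ((mollify \<delta> f x - f x)\<^sup>2) \<partial>lborel) \<le> ennreal e" by (simp add: e1_def)
  qed (use d in auto)
qed

lemma mollify_tendsto_L2:
  fixes f :: "real^2 \<Rightarrow> 'b::euclidean_space"
  assumes fm [measurable]: "f \<in> borel_measurable borel" and fin: "(\<integral>\<^sup>+x. ennreal ((norm (f x))\<^sup>2) \<partial>lborel) < \<infinity>"
  shows "(\<lambda>n. \<integral>\<^sup>+x. ennreal ((norm (mollify (1 / real (Suc n)) f x - f x))\<^sup>2) \<partial>lborel) \<longlonglongrightarrow> 0"
proof -
  define \<delta> where "\<delta> n = 1 / real (Suc n)" for n
  have \<delta>: "0 < \<delta> n" for n by (simp add: \<delta>_def)
  have \<delta>0: "\<delta> \<longlonglongrightarrow> 0" using LIMSEQ_inverse_real_of_nat by (simp add: \<delta>_def[abs_def] inverse_eq_divide)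
  have fi: "set_integrable lborel (cball 0 R) f" for R by (rule L2_locally_integrable[OF fm fin])
  have comp: "(\<lambda>n. \<integral>\<^sup>+x. ennreal ((mollify (\<delta> n) (\<lambda>y. f y \<bullet> b) x - f x \<bullet> b)\<^sup>2) \<partial>lborel) \<longlonglongrightarrow> 0" if b: "b \<in> Basis" for b
  proof -
    have "(\<integral>\<^sup>+x. ennreal ((f x \<bullet> b)\<^sup>2) \<partial>lborel) \<le> (\<integral>\<^sup>+x. ennreal ((norm (f x))\<^sup>2) \<partial>lborel)"
      using Basis_le_norm[OF b] by (intro nn_integral_mono ennreal_leI abs_le_square_iff[THEN iffD1]) simp
    then have fb: "(\<integral>\<^sup>+x. ennreal ((f x \<bullet> b)\<^sup>2) \<partial>lborel) < \<infinity>" using fin by (rule le_less_trans)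
    show ?thesis
    proof (rule order_tendstoI)
      fix a :: ennreal assume "0 < a"
      then obtain e' where e': "0 < e'" "e' < a" using dense by blast
      then obtain e where "e' = ennreal e" by (cases e') auto
      with e' have e: "0 < e" "ennreal e < a" by auto
      from mollify_L2_close[OF _ fb e(1)] obtain d where d: "0 < d"
        "\<And>\<delta>. 0 < \<delta> \<Longrightarrow> \<delta> < d \<Longrightarrow> (\<integral>\<^sup>+x. ennreal ((mollify \<delta> (\<lambda>y. f y \<bullet> b) x - f x \<bullet> b)\<^sup>2) \<partial>lborel) \<le> ennreal e" by auto
      have "\<forall>\<^sub>F n in sequentially. \<delta> n < d" using \<delta>0 d(1) by (rule order_tendstoD)
      then show "\<forall>\<^sub>F n in sequentially. (\<integral>\<^sup>+x. ennreal ((mollify (\<delta> n) (\<lambda>y. f y \<bullet> b) x - f x \<bullet> b)\<^sup>2) \<partial>lborel) < a"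
        by eventually_elim (use d(2) \<delta> e(2) le_less_trans in blast)
    qed simp
  qed
  have "(\<integral>\<^sup>+x. ennreal ((norm (mollify (\<delta> n) f x - f x))\<^sup>2) \<partial>lborel)
     = (\<Sum>b\<in>Basis. \<integral>\<^sup>+x. ennreal ((mollify (\<delta> n) (\<lambda>y. f y \<bullet> b) x - f x \<bullet> b)\<^sup>2) \<partial>lborel)" for n
  proof -
    have in_b: "mollify (\<delta> n) f x \<bullet> b = mollify (\<delta> n) (\<lambda>y. f y \<bullet> b) x" for x b
      unfolding mollify_def
      using integral_inner_left[OF convolution_integrable[where k = "mollifier (\<delta> n)" and \<delta> = "\<delta> n" and x = x, OF mollifier_props(1,3)[OF \<delta>] fm fi], of b]
      by simp
    have [measurable]: "mollify (\<delta> n) f \<in> borel_measurable borel"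
      by (rule borel_measurable_continuous_onI[OF continuous_mollify[OF \<delta> fm fi]])
    have "(norm (mollify (\<delta> n) f x - f x))\<^sup>2 = (\<Sum>b\<in>Basis. (mollify (\<delta> n) f x \<bullet> b - f x \<bullet> b)\<^sup>2)" for x
      unfolding power2_norm_eq_inner by (subst euclidean_inner) (simp add: inner_diff_left power2_eq_square)
    then have "(\<integral>\<^sup>+x. ennreal ((norm (mollify (\<delta> n) f x - f x))\<^sup>2) \<partial>lborel) = (\<integral>\<^sup>+x. (\<Sum>b\<in>Basis. ennreal ((mollify (\<delta> n) f x \<bullet> b - f x \<bullet> b)\<^sup>2)) \<partial>lborel)"
      by (simp add: sum_ennreal)
    also have "\<dots> = (\<Sum>b\<in>Basis. \<integral>\<^sup>+x. ennreal ((mollify (\<delta> n) f x \<bullet> b - f x \<bullet> b)\<^sup>2) \<partial>lborel)"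
      by (rule nn_integral_sum) measurable
    finally show ?thesis unfolding in_b .
  qed
  moreover have "(\<lambda>n. \<Sum>b\<in>(Basis :: 'b set). \<integral>\<^sup>+x. ennreal ((mollify (\<delta> n) (\<lambda>y. f y \<bullet> b) x - f x \<bullet> b)\<^sup>2) \<partial>lborel) \<longlonglongrightarrow> (\<Sum>b\<in>(Basis :: 'b set). 0)"
    by (rule tendsto_sum) (rule comp)
  ultimately show ?thesis by (simp add: \<delta>_def)
qed

section \<open>Approximation in the Sobolev space\<close>



text \<open>
  Convergence to zero in \<open>L\<^sup>2\<close>, stated with the integral of nonnegative functions so that it can be
  compared and added without integrability side conditions.
\<close>
definition L2_null :: "(nat \<Rightarrow> real^2 \<Rightarrow> real) \<Rightarrow> bool" where
  "L2_null f \<longleftrightarrow> (\<lambda>n. \<integral>\<^sup>+x. ennreal ((f n x)\<^sup>2) \<partial>lborel) \<longlonglongrightarrow> 0"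

lemma L2_null_le:
  assumes "L2_null g" and "\<And>n. AE x in lborel. \<bar>f n x\<bar> \<le> \<bar>g n x\<bar>"
  shows "L2_null f"
  unfolding L2_null_def
proof (rule tendsto_sandwich[OF _ _ tendsto_const assms(1)[unfolded L2_null_def]])
  show "\<forall>\<^sub>F n in sequentially. (\<integral>\<^sup>+x. ennreal ((f n x)\<^sup>2) \<partial>lborel) \<le> (\<integral>\<^sup>+x. ennreal ((g n x)\<^sup>2) \<partial>lborel)"
  proof (rule always_eventually, rule allI, rule nn_integral_mono_AE)
    fix n
    show "AE x in lborel. ennreal ((f n x)\<^sup>2) \<le> ennreal ((g n x)\<^sup>2)"
      using assms(2)[of n] by eventually_elim (intro ennreal_leI abs_le_square_iff[THEN iffD1])
  qed
qed simp

lemma L2_null_add: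
  assumes "L2_null f" "L2_null g" and [measurable]: "\<And>n. f n \<in> borel_measurable borel" "\<And>n. g n \<in> borel_measurable borel"
  shows "L2_null (\<lambda>n x. f n x + g n x)"
  unfolding L2_null_def
proof (rule tendsto_sandwich[OF _ _ tendsto_const])
  let ?I = "\<lambda>f n. \<integral>\<^sup>+x. ennreal ((f n x)\<^sup>2) \<partial>(lborel :: (real^2) measure)"
  have "(\<lambda>n. 2 * (?I f n + ?I g n)) \<longlonglongrightarrow> 2 * (0 + 0)"
    using assms(1,2) unfolding L2_null_def by (intro ennreal_tendsto_cmult tendsto_add) auto
  then show "(\<lambda>n. 2 * (?I f n + ?I g n)) \<longlonglongrightarrow> 0" by simp
  show "\<forall>\<^sub>F n in sequentially. (\<integral>\<^sup>+x. ennreal ((f n x + g n x)\<^sup>2) \<partial>lborel) \<le> 2 * (?I f n + ?I g n)"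
  proof (rule always_eventually, rule allI)
    fix n
    have "(\<integral>\<^sup>+x. ennreal ((f n x + g n x)\<^sup>2) \<partial>lborel) \<le> (\<integral>\<^sup>+x. 2 * (ennreal ((f n x)\<^sup>2) + ennreal ((g n x)\<^sup>2)) \<partial>lborel)"
    proof (rule nn_integral_mono)
      fix x
      have "(f n x + g n x)\<^sup>2 \<le> 2 * ((f n x)\<^sup>2 + (g n x)\<^sup>2)"
        using sum_squares_bound[of "f n x" "g n x"] by (simp add: power2_sum)
      then have "ennreal ((f n x + g n x)\<^sup>2) \<le> ennreal (2 * ((f n x)\<^sup>2 + (g n x)\<^sup>2))" by (rule ennreal_leI)
      then show "ennreal ((f n x + g n x)\<^sup>2) \<le> 2 * (ennreal ((f n x)\<^sup>2) + ennreal ((g n x)\<^sup>2))"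
        by (subst (asm) ennreal_mult') (auto simp: ennreal_plus)
    qed
    also have "\<dots> = 2 * (?I f n + ?I g n)"
      by (subst nn_integral_cmult) (auto simp: nn_integral_add)
    finally show "(\<integral>\<^sup>+x. ennreal ((f n x + g n x)\<^sup>2) \<partial>lborel) \<le> 2 * (?I f n + ?I g n)" .
  qed
qed simp

lemma L2_null_cmult:
  assumes "L2_null f" and [measurable]: "\<And>n. f n \<in> borel_measurable borel"
  shows "L2_null (\<lambda>n x. c * f n x)"
proof -
  have "(\<integral>\<^sup>+x. ennreal ((c * f n x)\<^sup>2) \<partial>lborel) = ennreal (c\<^sup>2) * (\<integral>\<^sup>+x. ennreal ((f n x)\<^sup>2) \<partial>lborel)" for n
    by (subst nn_integral_cmult[symmetric]) (auto simp: power_mult_distrib ennreal_mult')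
  moreover have "(\<lambda>n. ennreal (c\<^sup>2) * (\<integral>\<^sup>+x. ennreal ((f n x)\<^sup>2) \<partial>lborel)) \<longlonglongrightarrow> ennreal (c\<^sup>2) * 0"
    using assms(1) unfolding L2_null_def by (intro ennreal_tendsto_cmult) auto
  ultimately show ?thesis by (simp add: L2_null_def)
qed

lemma L2_null_dominated:
  assumes [measurable]: "\<And>n. f n \<in> borel_measurable borel" "w \<in> borel_measurable borel"
    and fin: "(\<integral>\<^sup>+x. ennreal ((w x)\<^sup>2) \<partial>lborel) < \<infinity>"
    and le: "\<And>n x. \<bar>f n x\<bar> \<le> \<bar>K * w x\<bar>" and lim: "\<And>x. (\<lambda>n. f n x) \<longlonglongrightarrow> 0"
  shows "L2_null f"
proof -
  have "(\<lambda>n. \<integral>\<^sup>+x. ennreal ((f n x)\<^sup>2) \<partial>lborel) \<longlonglongrightarrow> (\<integral>\<^sup>+x. ennreal 0 \<partial>(lborel::(real^2) measure))"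
  proof (rule nn_integral_dominated_convergence[where w = "\<lambda>x. ennreal (K\<^sup>2) * ennreal ((w x)\<^sup>2)"])
    have "(f n x)\<^sup>2 \<le> (K * w x)\<^sup>2" for n x using le[of n x] by (rule abs_le_square_iff[THEN iffD1])
    then show "AE x in lborel. ennreal ((f n x)\<^sup>2) \<le> ennreal (K\<^sup>2) * ennreal ((w x)\<^sup>2)" for n
      by (intro AE_I2) (simp add: ennreal_mult'[symmetric] power_mult_distrib ennreal_leI)
    show "(\<integral>\<^sup>+x. ennreal (K\<^sup>2) * ennreal ((w x)\<^sup>2) \<partial>lborel) < \<infinity>"
      using fin by (subst nn_integral_cmult) (auto simp: ennreal_mult_less_top)
    have "(\<lambda>n. (f n x)\<^sup>2) \<longlonglongrightarrow> 0\<^sup>2" for x by (intro tendsto_intros lim)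
    then show "AE x in lborel. (\<lambda>n. ennreal ((f n x)\<^sup>2)) \<longlonglongrightarrow> ennreal 0"
      by (intro AE_I2 tendsto_ennrealI) simp
  qed auto
  then show ?thesis by (simp add: L2_null_def)
qed

lemma positive_part_square_deriv: "((\<lambda>s. (max 0 s)\<^sup>2) has_real_derivative 2 * max 0 s) (at (s::real))"
proof -
  consider "s < 0" | "s = 0" | "0 < s" by linarith
  then show ?thesis
  proof cases
    case 1
    have "((\<lambda>_. 0) has_real_derivative 0) (at s)" by simp
    then have "((\<lambda>s. (max 0 s)\<^sup>2) has_real_derivative 0) (at s)"
      by (rule has_field_derivative_transform_within_open[of _ _ _ "{..<0}"]) (use 1 in auto)
    then show ?thesis using 1 by simp
  next
    case 2
    have "((\<lambda>h::real. ((max 0 (0 + h))\<^sup>2 - (max 0 0)\<^sup>2) / h) \<longlongrightarrow> 0) (at 0)"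
    proof (rule Lim_null_comparison)
      show "((\<lambda>h::real. \<bar>h\<bar>) \<longlongrightarrow> 0) (at 0)" by (rule tendsto_rabs_zero[OF tendsto_ident_at])
      show "\<forall>\<^sub>F h in at 0. norm (((max 0 (0 + h))\<^sup>2 - (max 0 0)\<^sup>2) / h) \<le> \<bar>h::real\<bar>"
        by (rule always_eventually) (auto simp: max_def power2_eq_square)
    qed
    then show ?thesis using 2 by (simp add: DERIV_def)
  next
    case 3
    have "((\<lambda>s. s\<^sup>2) has_real_derivative 2 * s) (at s)" by (auto intro!: derivative_eq_intros)
    then have "((\<lambda>s. (max 0 s)\<^sup>2) has_real_derivative 2 * s) (at s)"
      by (rule has_field_derivative_transform_within_open[of _ _ _ "{0<..}"]) (use 3 in auto)
    then show ?thesis using 3 by simp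
  qed
qed

text \<open>
  A polynomial in \<open>|x|\<^sup>2\<close> cut off at its double zero: continuously differentiable, and with a
  gradient of order \<open>1 / n\<close>.
\<close>
definition cutoff :: "nat \<Rightarrow> real^2 \<Rightarrow> real" where
  "cutoff n x = (max 0 (1 - (norm x)\<^sup>2 / (real (Suc n))\<^sup>2))\<^sup>2"

definition cutoff_grad :: "nat \<Rightarrow> real^2 \<Rightarrow> real^2" where
  "cutoff_grad n x = (- (4 * max 0 (1 - (norm x)\<^sup>2 / (real (Suc n))\<^sup>2) / (real (Suc n))\<^sup>2)) *\<^sub>R x"

lemma cutoff_props:
  "0 \<le> cutoff n x" "cutoff n x \<le> 1" "real (Suc n) < norm x \<Longrightarrow> cutoff n x = 0"
  "(cutoff n has_derivative (\<lambda>h. cutoff_grad n x \<bullet> h)) (at x)" "continuous_on UNIV (cutoff_grad n)"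
  "norm (cutoff_grad n x) \<le> 4 / real (Suc n)" "(\<lambda>n. cutoff n x) \<longlonglongrightarrow> 1"
proof -
  define N where "N = real (Suc n)"
  have N: "0 < N" by (simp add: N_def)
  show "0 \<le> cutoff n x" by (simp add: cutoff_def)
  show "cutoff n x \<le> 1" unfolding cutoff_def by (intro power_le_one) auto
  have out: "max 0 (1 - (norm x)\<^sup>2 / N\<^sup>2) = 0" if "N < norm x"
  proof -
    have "N\<^sup>2 \<le> (norm x)\<^sup>2" using that N by (intro power_mono) auto
    then show ?thesis using N by (simp add: max_def field_simps)
  qed
  show "real (Suc n) < norm x \<Longrightarrow> cutoff n x = 0"
    using out unfolding cutoff_def N_def by simp
  show "(cutoff n has_derivative (\<lambda>h. cutoff_grad n x \<bullet> h)) (at x)"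
  proof -
    have "((\<lambda>x::real^2. 1 - (x \<bullet> x) * inverse (N\<^sup>2)) has_derivative (\<lambda>h. - (2 * (x \<bullet> h) * inverse (N\<^sup>2)))) (at x)"
      by (auto intro!: derivative_eq_intros simp: inner_commute algebra_simps)
    note d = has_derivative_compose[OF this positive_part_square_deriv[unfolded has_field_derivative_def]]
    have 1: "cutoff n = (\<lambda>x. (max 0 (1 - x \<bullet> x * inverse (N\<^sup>2)))\<^sup>2)" by (simp add: fun_eq_iff cutoff_def N_def power2_norm_eq_inner divide_inverse)
    have 2: "(\<lambda>h. cutoff_grad n x \<bullet> h) = (\<lambda>h. 2 * max 0 (1 - x \<bullet> x * inverse (N\<^sup>2)) * - (2 * (x \<bullet> h) * inverse (N\<^sup>2)))"
      by (simp add: fun_eq_iff cutoff_grad_def N_def power2_norm_eq_inner divide_inverse)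
    show ?thesis unfolding 1 2 by (rule d)
  qed
  show "continuous_on UNIV (cutoff_grad n)"
    unfolding cutoff_grad_def[abs_def] by (intro continuous_intros) auto
  show "norm (cutoff_grad n x) \<le> 4 / real (Suc n)"
  proof (cases "N < norm x")
    case True
    then show ?thesis using out unfolding cutoff_grad_def N_def by simp
  next
    case False
    have "norm (cutoff_grad n x) = 4 * max 0 (1 - (norm x)\<^sup>2 / N\<^sup>2) / N\<^sup>2 * norm x"
      unfolding cutoff_grad_def N_def[symmetric] by (simp add: abs_mult)
    also have "\<dots> \<le> 4 * 1 / N\<^sup>2 * N"
      using False N by (intro mult_mono divide_right_mono mult_left_mono) auto
    also have "\<dots> = 4 / N" using N by (simp add: power2_eq_square)
    finally show ?thesis unfolding N_def .
  qed
  have "(\<lambda>n. inverse (real (Suc n))) \<longlonglongrightarrow> 0" by (rule LIMSEQ_inverse_real_of_nat)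
  then have "(\<lambda>n. (max 0 (1 - (norm x)\<^sup>2 * (inverse (real (Suc n)))\<^sup>2))\<^sup>2) \<longlonglongrightarrow> (max 0 (1 - (norm x)\<^sup>2 * 0\<^sup>2))\<^sup>2"
    by (intro tendsto_intros)
  then show "(\<lambda>n. cutoff n x) \<longlonglongrightarrow> 1"
    by (simp add: cutoff_def divide_inverse power_inverse)
qed

lemma integral_lebesgue_eq_lborel:
  fixes f g :: "real^2 \<Rightarrow> 'b::{banach,second_countable_topology}"
  assumes "f \<in> borel_measurable lebesgue" "g \<in> borel_measurable borel" "AE x in lborel. f x = g x"
  shows "(LINT x|lebesgue. f x) = (LINT x|lborel. g x)"
proof -
  have g: "g \<in> borel_measurable lborel" using assms(2) by simp
  have "(LINT x|lebesgue. f x) = (LINT x|lebesgue. g x)"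
    by (rule integral_cong_AE[OF assms(1) measurable_completion[OF g] AE_completion[OF assms(3)]])
  also have "\<dots> = (LINT x|lborel. g x)" using g by (rule integral_completion)
  finally show ?thesis .
qed

text \<open>
  A translate of the mollifier is a test function, so the derivative moves from the mollifier to \<open>u\<close> by the
  definition of the weak derivative.
\<close>
lemma mollify_weak_gradient:
  fixes u :: "real^2 \<Rightarrow> complex"
  assumes w: "weak_partial_deriv k u (\<lambda>x. G x $ k)"
    and u'm [measurable]: "u' \<in> borel_measurable borel" and G'm [measurable]: "G' \<in> borel_measurable borel"
    and uu': "AE x in lborel. u x = u' x" and GG': "AE x in lborel. G x = (G' x :: complex^2)"
    and u'i: "\<And>R. set_integrable lborel (cball 0 R) u'" and G'i: "\<And>R. set_integrable lborel (cball 0 R) G'"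
    and \<delta>: "0 < \<delta>"
  shows "partial_deriv k (mollify \<delta> u') x = mollify \<delta> G' x $ k"
proof -
  note m = mollifier_props[OF \<delta>]
  define \<phi> where "\<phi> y = mollifier \<delta> (x - y)" for y
  have \<phi>t: "\<phi> \<in> test_functions" unfolding \<phi>_def by (rule mollifier_translate_test_function(1)[OF \<delta>])
  have p\<phi>: "partial_deriv k \<phi> y = - (mollifier_grad \<delta> (x - y) $ k)" for y
    unfolding \<phi>_def by (rule mollifier_translate_test_function(2)[OF \<delta>])
  have [measurable]: "mollifier \<delta> \<in> borel_measurable borel" "mollifier_grad \<delta> \<in> borel_measurable borel"
    using m(1,6) by (auto intro: borel_measurable_continuous_onI)
  have \<phi>m [measurable]: "\<phi> \<in> borel_measurable borel" "partial_deriv k \<phi> \<in> borel_measurable borel"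
    unfolding \<phi>_def[abs_def] p\<phi>[abs_def, unfolded \<phi>_def[abs_def]] by measurable
  have \<phi>l [measurable]: "\<phi> \<in> borel_measurable lebesgue" "partial_deriv k \<phi> \<in> borel_measurable lebesgue"
    using \<phi>m by (auto intro: measurable_completion)
  have [measurable]: "u \<in> borel_measurable lebesgue" "(\<lambda>x. G x $ k) \<in> borel_measurable lebesgue"
    using w by (auto simp: weak_partial_deriv_def L1_loc_def)
  have "partial_deriv k (mollify \<delta> u') x = (LINT y|lborel. (mollifier_grad \<delta> (x - y) \<bullet> axis k 1) *\<^sub>R u' y)"
    by (rule partial_deriv_eq[OF mollify_has_derivative[OF \<delta> u'm u'i]])
  also have "\<dots> = - (LINT y|lborel. partial_deriv k \<phi> y *\<^sub>R u' y)"
    unfolding p\<phi> by (simp add: inner_axis)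
  also have "(LINT y|lborel. partial_deriv k \<phi> y *\<^sub>R u' y) = (LINT y|lebesgue. partial_deriv k \<phi> y *\<^sub>R u y)"
    using uu' by (intro integral_lebesgue_eq_lborel[symmetric]) auto
  also have "\<dots> = - (LINT y|lebesgue. \<phi> y *\<^sub>R G y $ k)"
    using w \<phi>t unfolding weak_partial_deriv_def by blast
  also have "(LINT y|lebesgue. \<phi> y *\<^sub>R G y $ k) = (LINT y|lborel. \<phi> y *\<^sub>R G' y $ k)"
    using GG' by (intro integral_lebesgue_eq_lborel) auto
  also have "\<dots> = (LINT y|lborel. \<phi> y *\<^sub>R G' y) $ k"
  proof -
    have "integrable lborel (\<lambda>y. \<phi> y *\<^sub>R G' y)"
      unfolding \<phi>_def by (rule convolution_integrable[where \<delta> = \<delta>, OF m(1,3) G'm G'i])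
    from integral_bounded_linear[OF bounded_linear_vec_nth this, of k] show ?thesis by simp
  qed
  finally show ?thesis unfolding mollify_def[of \<delta> G'] \<phi>_def minus_minus .
qed

text \<open>
  The approximants are the mollified functions multiplied by the cutoffs. The gradient of the cutoff contributes a term
  of order \<open>1 / n\<close>.
\<close>
lemma H1_approximation:
  assumes H: "H1_with_gradient u G"
    and u'm [measurable]: "u' \<in> borel_measurable borel" and G'm [measurable]: "G' \<in> borel_measurable borel"
    and uu': "AE x in lborel. u x = u' x" and GG': "AE x in lborel. G x = G' x"
    and u'2: "(\<integral>\<^sup>+x. ennreal ((norm (u' x))\<^sup>2) \<partial>lborel) < \<infinity>" and G'2: "(\<integral>\<^sup>+x. ennreal ((norm (G' x))\<^sup>2) \<partial>lborel) < \<infinity>"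
  obtains v where "\<And>n. v n \<in> C1_compact" "L2_null (\<lambda>n x. norm (v n x - u' x))" "L2_null (\<lambda>n x. norm (grad (v n) x - G' x))"
proof -
  define \<delta> where "\<delta> n = 1 / real (Suc n)" for n
  have \<delta>: "0 < \<delta> n" for n by (simp add: \<delta>_def)
  have u'i: "set_integrable lborel (cball 0 R) u'" for R by (rule L2_locally_integrable[OF u'm u'2])
  have G'i: "set_integrable lborel (cball 0 R) G'" for R by (rule L2_locally_integrable[OF G'm G'2])
  define U where "U n = mollify (\<delta> n) u'" for n
  define V where "V n = mollify (\<delta> n) G'" for n
  have Uc: "continuous_on UNIV (U n)" and Vc: "continuous_on UNIV (V n)" for n
    unfolding U_def V_def by (rule continuous_mollify[OF \<delta>]; fact)+
  have [measurable]: "U n \<in> borel_measurable borel" "V n \<in> borel_measurable borel" for n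
    using Uc Vc by (auto intro: borel_measurable_continuous_onI)
  have cc: "continuous_on UNIV (cutoff n)" for n
    by (rule has_derivative_continuous_on[OF has_derivative_at_withinI[OF cutoff_props(4)]])
  have [measurable]: "cutoff n \<in> borel_measurable borel" for n using cc by (rule borel_measurable_continuous_onI)
  have Ud: "U n differentiable (at x)" for n x
    unfolding U_def using mollify_has_derivative[OF \<delta> u'm u'i] by (auto simp: differentiable_def)
  have Up: "partial_deriv k (U n) x = V n x $ k" for k n x
    unfolding U_def V_def using H
    by (intro mollify_weak_gradient[OF _ u'm G'm uu' GG' u'i G'i \<delta>]) (auto simp: H1_with_gradient_def)
  define v where "v n x = cutoff n x *\<^sub>R U n x" for n x
  have vd: "(v n has_derivative (\<lambda>h. cutoff n x *\<^sub>R (h $ 1 *\<^sub>R partial_deriv 1 (U n) x + h $ 2 *\<^sub>R partial_deriv 2 (U n) x)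
      + (cutoff_grad n x \<bullet> h) *\<^sub>R U n x)) (at x)" for n x
    unfolding v_def by (rule has_derivative_scaleR[OF cutoff_props(4) C1_has_derivative[OF Ud]])
  have vp: "partial_deriv k (v n) x = cutoff n x *\<^sub>R V n x $ k + (cutoff_grad n x $ k) *\<^sub>R U n x" for k n x
  proof -
    have "axis k 1 $ 1 *\<^sub>R partial_deriv 1 (U n) x + axis k 1 $ 2 *\<^sub>R partial_deriv 2 (U n) x = partial_deriv k (U n) x"
      using exhaust_2[of k] by (auto simp: axis_def)
    then show ?thesis unfolding partial_deriv_eq[OF vd] Up[symmetric] by (simp add: inner_axis)
  qed
  have vC: "v n \<in> C1_compact" for n
    unfolding C1_compact_def
  proof (intro CollectI conjI allI)
    show "v n differentiable (at x)" for x using vd by (auto simp: differentiable_def)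
    show "continuous_on UNIV (partial_deriv k (v n))" for k
      unfolding vp[abs_def] by (intro continuous_intros cc Vc Uc cutoff_props(5))
    show "\<exists>R. \<forall>x. R < norm x \<longrightarrow> v n x = 0"
      using cutoff_props(3) by (intro exI[of _ "real (Suc n)"]) (auto simp: v_def)
  qed
  have Un: "L2_null (\<lambda>n x. norm (U n x - u' x))" "L2_null (\<lambda>n x. norm (V n x - G' x))"
    unfolding L2_null_def U_def V_def \<delta>_def by (rule mollify_tendsto_L2; fact)+
  have cut: "L2_null (\<lambda>n x. (1 - cutoff n x) * w x)"
    if [measurable]: "w \<in> borel_measurable borel" and fin: "(\<integral>\<^sup>+x. ennreal ((w x)\<^sup>2) \<partial>lborel) < \<infinity>" for w
  proof (rule L2_null_dominated[where K = 1, OF _ that])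
    show "\<bar>(1 - cutoff n x) * w x\<bar> \<le> \<bar>1 * w x\<bar>" for n x
      using cutoff_props(1,2)[of n x] by (auto simp: abs_mult intro: mult_left_le_one_le)
    have "(\<lambda>n. (1 - cutoff n x) * w x) \<longlonglongrightarrow> (1 - 1) * w x" for x by (intro tendsto_intros cutoff_props(7))
    then show "(\<lambda>n. (1 - cutoff n x) * w x) \<longlonglongrightarrow> 0" for x by simp
  qed measurable
  have small: "L2_null (\<lambda>n x. 4 / real (Suc n) * norm (u' x))"
  proof (rule L2_null_dominated[where K = 4 and w = "\<lambda>x. norm (u' x)"])
    show "\<bar>4 / real (Suc n) * norm (u' x)\<bar> \<le> \<bar>4 * norm (u' x)\<bar>" for n x
      unfolding abs_mult by (intro mult_right_mono) (auto simp: field_simps)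
    have "(\<lambda>n. 4 * inverse (real (Suc n)) * norm (u' x)) \<longlonglongrightarrow> 4 * 0 * norm (u' x)" for x
      by (intro tendsto_intros LIMSEQ_inverse_real_of_nat)
    then show "(\<lambda>n. 4 / real (Suc n) * norm (u' x)) \<longlonglongrightarrow> 0" for x by (simp add: divide_inverse)
  qed (use u'2 in auto)
  have n1: "L2_null (\<lambda>n x. norm (v n x - u' x))"
  proof (rule L2_null_le)
    show "L2_null (\<lambda>n x. norm (U n x - u' x) + (1 - cutoff n x) * norm (u' x))"
      by (intro L2_null_add Un cut) (use u'2 in auto)
    show "AE x in lborel. \<bar>norm (v n x - u' x)\<bar> \<le> \<bar>norm (U n x - u' x) + (1 - cutoff n x) * norm (u' x)\<bar>" for n
    proof (rule AE_I2)
      fix x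
      have "v n x - u' x = cutoff n x *\<^sub>R (U n x - u' x) - (1 - cutoff n x) *\<^sub>R u' x"
        by (simp add: v_def algebra_simps)
      then have "norm (v n x - u' x) \<le> norm (cutoff n x *\<^sub>R (U n x - u' x)) + norm ((1 - cutoff n x) *\<^sub>R u' x)"
        by (simp only: norm_triangle_ineq4)
      also have "\<dots> \<le> norm (U n x - u' x) + (1 - cutoff n x) * norm (u' x)"
        using cutoff_props(1,2)[of n x] by (auto intro!: add_mono mult_left_le_one_le)
      finally show "\<bar>norm (v n x - u' x)\<bar> \<le> \<bar>norm (U n x - u' x) + (1 - cutoff n x) * norm (u' x)\<bar>" by simp
    qed
  qed
  have n2: "L2_null (\<lambda>n x. norm (grad (v n) x - G' x))"
  proof (rule L2_null_le)
    show "L2_null (\<lambda>n x. (norm (V n x - G' x) + (1 - cutoff n x) * norm (G' x)) + (4 / real (Suc n) * norm (u' x) + 4 * norm (U n x - u' x)))"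
    proof (intro L2_null_add Un cut small)
      show "L2_null (\<lambda>n x. 4 * norm (U n x - u' x))"
        by (intro L2_null_cmult Un) auto
    qed (use G'2 in auto)
    show "AE x in lborel. \<bar>norm (grad (v n) x - G' x)\<bar> \<le>
      \<bar>(norm (V n x - G' x) + (1 - cutoff n x) * norm (G' x)) + (4 / real (Suc n) * norm (u' x) + 4 * norm (U n x - u' x))\<bar>" for n
    proof (rule AE_I2)
      fix x
      define W where "W = (\<chi> k. (cutoff_grad n x $ k) *\<^sub>R U n x)"
      have W: "norm W = norm (cutoff_grad n x) * norm (U n x)"
      proof -
        have "norm W = L2_set (\<lambda>k. norm (cutoff_grad n x $ k) * norm (U n x)) UNIV" by (simp add: W_def norm_vec_def)
        also have "\<dots> = norm (cutoff_grad n x) * norm (U n x)" by (simp add: norm_vec_def L2_set_left_distrib)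
        finally show ?thesis .
      qed
      have "norm W \<le> 4 / real (Suc n) * norm (U n x)" unfolding W by (intro mult_right_mono cutoff_props(6)) simp
      also have "\<dots> \<le> 4 / real (Suc n) * (norm (u' x) + norm (U n x - u' x))"
        using norm_triangle_ineq[of "u' x" "U n x - u' x"] by (intro mult_left_mono) auto
      also have "\<dots> \<le> 4 / real (Suc n) * norm (u' x) + 4 * norm (U n x - u' x)"
        unfolding distrib_left by (intro add_left_mono mult_right_mono) (auto simp: field_simps)
      finally have Wb: "norm W \<le> 4 / real (Suc n) * norm (u' x) + 4 * norm (U n x - u' x)" .
      have "grad (v n) x - G' x = (cutoff n x *\<^sub>R (V n x - G' x) - (1 - cutoff n x) *\<^sub>R G' x) + W"
        by (rule vec2_eqI) (simp_all add: grad_def vp W_def algebra_simps)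
      then have "norm (grad (v n) x - G' x) \<le> norm (cutoff n x *\<^sub>R (V n x - G' x) - (1 - cutoff n x) *\<^sub>R G' x) + norm W"
        by (simp only: norm_triangle_ineq)
      also have "\<dots> \<le> norm (cutoff n x *\<^sub>R (V n x - G' x)) + norm ((1 - cutoff n x) *\<^sub>R G' x) + norm W"
        by (intro add_right_mono norm_triangle_ineq4)
      also have "\<dots> \<le> (norm (V n x - G' x) + (1 - cutoff n x) * norm (G' x)) + (4 / real (Suc n) * norm (u' x) + 4 * norm (U n x - u' x))"
        using cutoff_props(1,2)[of n x] Wb by (intro add_mono) (auto intro!: mult_left_le_one_le)
      finally show "\<bar>norm (grad (v n) x - G' x)\<bar> \<le>
        \<bar>(norm (V n x - G' x) + (1 - cutoff n x) * norm (G' x)) + (4 / real (Suc n) * norm (u' x) + 4 * norm (U n x - u' x))\<bar>" by simp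
    qed
  qed
  show thesis by (rule that[OF vC n1 n2])
qed

section \<open>The magnetic Sobolev inequality\<close>


text \<open>
  The Hardy and Sobolev inequalities combined. The bound is stated for every number \<open>e\<close> above the energy, so that it
  passes to limits of functions and covers vanishing energy.
\<close>
lemma magnetic_energy_bound:
  fixes q :: real
  assumes "A \<in> L2_loc" "is_curl B A" "flux_condition B" and q: "2 \<le> q"
  obtains C where "0 < C" "\<And>u e. u \<in> C1_compact \<Longrightarrow> 0 < e \<Longrightarrow>
    magnetic_energy A u (grad u) \<le> ennreal e \<Longrightarrow>
    weighted_powr u q \<le> ennreal (C * e powr (q / 2))"
proof -
  obtain H where H: "0 < H" and hardy: "\<And>u. u \<in> C1_compact \<Longrightarrow>
     (\<integral>\<^sup>+x. ennreal ((norm (u x))\<^sup>2 / (1 + (norm x)\<^sup>2)) \<partial>lborel)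
      \<le> ennreal H * magnetic_energy A u (grad u)"
    by (rule hardy_inequality[OF assms(1-3)]) (rule that)
  obtain C where C: "0 < C" and sob: "\<And>u e. u \<in> C1_compact \<Longrightarrow> 0 < e \<Longrightarrow>
    (\<integral>\<^sup>+x. ennreal ((grad_abs u x)\<^sup>2) \<partial>lborel) + weighted_power u 2 \<le> ennreal e \<Longrightarrow>
    weighted_powr u q \<le> ennreal (C * e powr (q / 2))"
    by (rule weighted_sobolev[OF q]) (rule that)
  have main: "weighted_powr u q \<le> ennreal (C * (1 + H) powr (q / 2) * e powr (q / 2))"
    if u: "u \<in> C1_compact" and e: "0 < e"
      and E: "magnetic_energy A u (grad u) \<le> ennreal e" for u e
  proof -
    have "(\<integral>\<^sup>+x. ennreal ((grad_abs u x)\<^sup>2) \<partial>lborel) \<le> magnetic_energy A u (grad u)"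
      by (intro nn_integral_mono ennreal_leI power_mono grad_abs_le_magnetic grad_abs_nonneg)
    then have D: "(\<integral>\<^sup>+x. ennreal ((grad_abs u x)\<^sup>2) \<partial>lborel) \<le> ennreal e" using E by (rule order_trans)
    have "weighted_power u 2 \<le> ennreal H * ennreal e"
      unfolding weighted_power_def using hardy[OF u] mult_left_mono[OF E, of "ennreal H"] by (auto intro: order_trans)
    then have "(\<integral>\<^sup>+x. ennreal ((grad_abs u x)\<^sup>2) \<partial>lborel) + weighted_power u 2 \<le> ennreal e + ennreal H * ennreal e"
      by (intro add_mono D)
    also have "\<dots> = ennreal ((1 + H) * e)" using H e by (simp add: ennreal_mult'[symmetric] ennreal_plus[symmetric] distrib_right del: ennreal_plus)
    finally have "weighted_powr u q \<le> ennreal (C * ((1 + H) * e) powr (q / 2))" using H e by (intro sob[OF u]) auto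
    also have "((1 + H) * e) powr (q / 2) = (1 + H) powr (q / 2) * e powr (q / 2)" by (simp add: powr_mult)
    finally show ?thesis by (simp add: mult.assoc)
  qed
  show thesis by (rule that[OF _ main]) (use C H in auto)
qed

text \<open>
  Let \<open>e\<close> decrease to the energy and solve for it. The weight \<open>(1 + |x|)\<^sup>-\<^sup>2\<close> is at most \<open>1 / (1 + |x|\<^sup>2)\<close>.
\<close>
lemma magnetic_sobolev_from_energy_bound:
  fixes u :: "real^2 \<Rightarrow> complex" and G :: "real^2 \<Rightarrow> complex^2" and q C :: real
  assumes q: "2 \<le> q" and C: "0 < C"
    and mm: "magnetic_gradient A u G \<in> borel_measurable lebesgue" and um: "u \<in> borel_measurable lebesgue"
    and fin: "magnetic_energy A u G < \<infinity>"
    and bound: "\<And>e. 0 < e \<Longrightarrow> magnetic_energy A u G < ennreal e \<Longrightarrow>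
      weighted_powr u q \<le> ennreal (C * e powr (q / 2))"
  shows "magnetic_sobolev_inequality A q (C powr (- (2 / q))) u G"
proof -
  define E where "E = (LINT x|lebesgue. (norm (magnetic_gradient A u G x))\<^sup>2)"
  define Q where "Q = (LINT x|lebesgue. norm (u x) powr q * (1 + norm x) powr (- 2))"
  have i1: "integrable lebesgue (\<lambda>x. (norm (magnetic_gradient A u G x))\<^sup>2)"
  proof (rule integrableI_bounded)
    show "(\<lambda>x. (norm (magnetic_gradient A u G x))\<^sup>2) \<in> borel_measurable lebesgue" using mm by measurable
    show "(\<integral>\<^sup>+x. ennreal (norm ((norm (magnetic_gradient A u G x))\<^sup>2)) \<partial>lebesgue) < \<infinity>"
      using fin by (simp add: nn_integral_completion)
  qed
  have E0: "0 \<le> E" unfolding E_def by simp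
  have Een: "magnetic_energy A u G = ennreal E"
    unfolding E_def using nn_integral_eq_integral[OF i1] by (simp add: nn_integral_completion)
  define w where "w x = norm (u x) powr q * (1 + norm x) powr (- 2)" for x
  have w0: "0 \<le> w x" for x by (simp add: w_def)
  have wle: "w x \<le> norm (u x) powr q / (1 + (norm x)\<^sup>2)" for x
  proof -
    have p: "0 < 1 + norm x" by (simp add: add_pos_nonneg)
    have "(1 + norm x) powr (- 2) = 1 / (1 + norm x)\<^sup>2"
      using p by (simp add: powr_minus powr_numeral inverse_eq_divide)
    also have "\<dots> \<le> 1 / (1 + (norm x)\<^sup>2)"
      using p by (intro divide_left_mono) (auto simp: power2_sum add_pos_nonneg intro!: mult_pos_pos)
    finally have "norm (u x) powr q * (1 + norm x) powr (- 2) \<le> norm (u x) powr q * (1 / (1 + (norm x)\<^sup>2))"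
      by (rule mult_left_mono) simp
    then show ?thesis by (simp add: w_def)
  qed
  have wb: "(\<integral>\<^sup>+x. ennreal (w x) \<partial>lebesgue) \<le> ennreal (C * e powr (q / 2))" if "E < e" for e
  proof -
    have "(\<integral>\<^sup>+x. ennreal (w x) \<partial>lebesgue) \<le> weighted_powr u q"
      unfolding weighted_powr_def nn_integral_completion using wle by (intro nn_integral_mono ennreal_leI)
    also have "\<dots> \<le> ennreal (C * e powr (q / 2))"
      using that E0 by (intro bound) (auto simp: Een ennreal_less_iff)
    finally show ?thesis .
  qed
  have i2: "integrable lebesgue w"
  proof (rule integrableI_bounded)
    have "(\<lambda>x::real^2. norm x) \<in> borel_measurable lebesgue" by (rule measurable_completion) simp
    then show "w \<in> borel_measurable lebesgue" unfolding w_def using um by measurable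
    show "(\<integral>\<^sup>+x. ennreal (norm (w x)) \<partial>lebesgue) < \<infinity>"
      using wb[of "E + 1"] w0 by (auto simp: le_less_trans[OF _ ennreal_less_top])
  qed
  have Q0: "0 \<le> Q" unfolding Q_def by simp
  have Qe: "Q \<le> C * e powr (q / 2)" if "E < e" for e
  proof -
    have "ennreal Q = (\<integral>\<^sup>+x. ennreal (w x) \<partial>lebesgue)"
      unfolding Q_def w_def[symmetric] by (rule nn_integral_eq_integral[symmetric, OF i2]) (simp add: w0)
    then have "ennreal Q \<le> ennreal (C * e powr (q / 2))" using wb[OF that] by simp
    then show ?thesis using C by (subst (asm) ennreal_le_iff) auto
  qed
  have "C powr (- (2 / q)) * Q powr (2 / q) \<le> E"
  proof (rule dense_ge)
    fix e assume e: "E < e"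
    have "Q powr (2 / q) \<le> (C * e powr (q / 2)) powr (2 / q)"
      using Q0 Qe[OF e] q by (intro powr_mono2) auto
    also have "\<dots> = C powr (2 / q) * e"
      using e E0 q C by (simp add: powr_mult powr_powr)
    finally have "C powr (- (2 / q)) * Q powr (2 / q) \<le> C powr (- (2 / q)) * (C powr (2 / q) * e)"
      by (rule mult_left_mono) simp
    also have "\<dots> = e" using C by (simp add: mult.assoc[symmetric] powr_add[symmetric])
    finally show "C powr (- (2 / q)) * Q powr (2 / q) \<le> e" .
  qed
  then show ?thesis
    unfolding magnetic_sobolev_inequality_def using i1 i2 unfolding w_def E_def Q_def by simp
qed

lemma norm_magnetic_gradient_le: "norm (magnetic_gradient A u G x) \<le> norm (G x) + norm (A x) * norm (u x)"
proof -
  have "magnetic_gradient A u G x = (\<chi> k. \<i> * G x $ k) + (\<chi> k. of_real (A x $ k) * u x)"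
    by (simp add: magnetic_gradient_def vec_eq_iff)
  moreover have "norm (\<chi> k. complex_of_real (A x $ k) * u x) = norm (A x) * norm (u x)"
    by (simp add: norm_vec_def norm_mult L2_set_left_distrib)
  ultimately show ?thesis using norm_triangle_ineq norm_i_vec[of "G x"] by metis
qed

lemma test_function_C1_compact:
  fixes u :: "real^2 \<Rightarrow> complex"
  assumes "u \<in> test_functions"
  shows "u \<in> C1_compact"
proof -
  have "C_k 1 u" using assms by (simp only: test_functions_def mem_Collect_eq)
  then have 1: "\<forall>x. u differentiable (at x)" "\<forall>k. continuous_on UNIV (partial_deriv k u)" by auto
  have "bounded (closure (support_on UNIV u))" using assms by (simp add: test_functions_def compact_imp_bounded)
  then obtain R where "\<forall>x\<in>closure (support_on UNIV u). norm x \<le> R" unfolding bounded_iff by blast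
  then have "u x = 0" if "R < norm x" for x
    using that closure_subset[of "support_on UNIV u"] by (force simp: support_on_def)
  with 1 show ?thesis unfolding C1_compact_def by blast
qed

lemma magnetic_energy_finite:
  assumes A: "A \<in> L2_loc" and u: "u \<in> C1_compact"
  shows "magnetic_energy A u (grad u) < \<infinity>"
proof -
  obtain R where R: "\<And>x. R < norm x \<Longrightarrow> u x = 0" "\<And>x. R < norm x \<Longrightarrow> grad u x = 0"
    by (rule C1_compact_support[OF u]) (rule that)
  obtain M where M: "0 \<le> M" "\<And>x. norm (u x) \<le> M" "\<And>x. norm (grad u x) \<le> M"
    by (rule C1_compact_bounded[OF u]) (rule that)
  let ?i = "\<lambda>x::real^2. indicator (cball 0 R) x :: ennreal"
  have Am: "A \<in> borel_measurable lebesgue" using A by (simp add: L2_loc_def)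
  have fin: "(\<integral>\<^sup>+x. ennreal ((norm (A x))\<^sup>2) * ?i x \<partial>lebesgue) < \<infinity>"
  proof -
    have "set_integrable lebesgue (cball 0 R) (\<lambda>x. (norm (A x))\<^sup>2)" using A by (simp add: L2_loc_def)
    then have "(\<integral>\<^sup>+x. ennreal (norm (indicat_real (cball 0 R) x *\<^sub>R (norm (A x))\<^sup>2)) \<partial>lebesgue) < \<infinity>"
      unfolding set_integrable_def integrable_iff_bounded by blast
    also have "(\<integral>\<^sup>+x. ennreal (norm (indicat_real (cball 0 R) x *\<^sub>R (norm (A x))\<^sup>2)) \<partial>lebesgue) = (\<integral>\<^sup>+x. ennreal ((norm (A x))\<^sup>2) * ?i x \<partial>lebesgue)"
      by (intro nn_integral_cong) (auto simp: indicator_def)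
    finally show ?thesis .
  qed
  have "magnetic_energy A u (grad u)
     = (\<integral>\<^sup>+x. ennreal ((norm (magnetic_gradient A u (grad u) x))\<^sup>2) \<partial>lebesgue)" by (simp add: nn_integral_completion)
  also have "\<dots> \<le> (\<integral>\<^sup>+x. ennreal (2 * M\<^sup>2) * ?i x + ennreal (2 * M\<^sup>2) * (ennreal ((norm (A x))\<^sup>2) * ?i x) \<partial>lebesgue)"
  proof (rule nn_integral_mono)
    fix x
    show "ennreal ((norm (magnetic_gradient A u (grad u) x))\<^sup>2) \<le> ennreal (2 * M\<^sup>2) * ?i x + ennreal (2 * M\<^sup>2) * (ennreal ((norm (A x))\<^sup>2) * ?i x)"
    proof (cases "norm x \<le> R")
      case True
      have "norm (magnetic_gradient A u (grad u) x) \<le> M + norm (A x) * M"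
        using norm_magnetic_gradient_le[of A u "grad u" x] M by (meson add_mono mult_left_mono norm_ge_zero order_trans)
      then have "(norm (magnetic_gradient A u (grad u) x))\<^sup>2 \<le> (M + norm (A x) * M)\<^sup>2" by (intro power_mono) auto
      also have "\<dots> \<le> 2 * M\<^sup>2 + 2 * (norm (A x) * M)\<^sup>2"
        using sum_squares_bound[of M "norm (A x) * M"] by (simp add: power2_sum)
      also have "\<dots> = 2 * M\<^sup>2 + 2 * M\<^sup>2 * (norm (A x))\<^sup>2" by (simp add: power_mult_distrib)
      finally show ?thesis using True
        by (simp add: ennreal_mult'[symmetric] ennreal_plus[symmetric] ennreal_leI del: ennreal_plus)
    next
      case False
      then have "norm (magnetic_gradient A u (grad u) x) \<le> 0" using norm_magnetic_gradient_le[of A u "grad u" x] R by simp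
      then show ?thesis by simp
    qed
  qed
  also have "\<dots> = ennreal (2 * M\<^sup>2) * emeasure lebesgue (cball (0::real^2) R) + ennreal (2 * M\<^sup>2) * (\<integral>\<^sup>+x. ennreal ((norm (A x))\<^sup>2) * ?i x \<partial>lebesgue)"
  proof -
    have [measurable]: "(\<lambda>x. ennreal ((norm (A x))\<^sup>2) * ?i x) \<in> borel_measurable lebesgue"
      using Am by (intro borel_measurable_times_ennreal borel_measurable_indicator) auto
    have [measurable]: "?i \<in> borel_measurable lebesgue" by (intro borel_measurable_indicator) auto
    show ?thesis by (subst nn_integral_add) (auto simp: nn_integral_cmult nn_integral_cmult_indicator)
  qed
  also have "\<dots> < \<infinity>" using fin emeasure_lborel_cball_finite[of "0::real^2" R] by (auto simp: ennreal_mult_less_top)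
  finally show ?thesis .
qed

text \<open>
  A subsequence converges almost everywhere, and Fatou's lemma applies to it.
\<close>
lemma weighted_powr_fatou:
  fixes v :: "nat \<Rightarrow> real^2 \<Rightarrow> complex"
  assumes vm: "\<And>n. v n \<in> borel_measurable borel" and um [measurable]: "u \<in> borel_measurable borel"
    and lim: "L2_null (\<lambda>n x. norm (v n x - u x))" and q: "0 < q"
    and bd: "\<forall>\<^sub>F n in sequentially. weighted_powr (v n) q \<le> ennreal K"
  shows "weighted_powr u q \<le> ennreal K"
proof -
  note [measurable] = vm
  have "\<forall>\<^sub>F n in sequentially. (\<integral>\<^sup>+x. ennreal ((norm (v n x - u x))\<^sup>2) \<partial>lborel) < 1"
    using lim unfolding L2_null_def by (rule order_tendstoD) simp
  with bd obtain N where N: "\<And>n. N \<le> n \<Longrightarrow> weighted_powr (v n) q \<le> ennreal K"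
      "\<And>n. N \<le> n \<Longrightarrow> (\<integral>\<^sup>+x. ennreal ((norm (v n x - u x))\<^sup>2) \<partial>lborel) < 1"
    unfolding eventually_sequentially by (meson le_cases order_trans)
  define f where "f n x = (norm (v (n + N) x - u x))\<^sup>2" for n x
  have fi: "integrable lborel (f n)" for n
  proof (rule integrableI_bounded)
    show "f n \<in> borel_measurable lborel" unfolding f_def by measurable
    have "(\<integral>\<^sup>+x. ennreal (norm (f n x)) \<partial>lborel) < 1" using N(2)[of "n + N"] by (simp add: f_def)
    then show "(\<integral>\<^sup>+x. ennreal (norm (f n x)) \<partial>lborel) < \<infinity>" by (rule order_less_trans) simp
  qed
  have "(\<lambda>n. \<integral>\<^sup>+x. ennreal (f n x) \<partial>lborel) \<longlonglongrightarrow> 0"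
    using LIMSEQ_ignore_initial_segment[OF lim[unfolded L2_null_def], of N] by (simp add: f_def)
  moreover have "(\<integral>\<^sup>+x. ennreal (f n x) \<partial>lborel) = ennreal (LINT x|lborel. norm (f n x))" for n
  proof -
    have nf: "norm (f n x) = f n x" for x by (simp add: f_def)
    show ?thesis unfolding nf by (rule nn_integral_eq_integral[OF fi]) (simp add: f_def)
  qed
  ultimately have "(\<lambda>n. ennreal (LINT x|lborel. norm (f n x))) \<longlonglongrightarrow> ennreal 0" by simp
  then have "(\<lambda>n. LINT x|lborel. norm (f n x)) \<longlonglongrightarrow> 0"
    by (subst (asm) tendsto_ennreal_iff) auto
  from tendsto_L1_AE_subseq[OF fi this] obtain r :: "nat \<Rightarrow> nat" where r: "AE x in lborel. (\<lambda>n. f (r n) x) \<longlonglongrightarrow> 0" by blast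
  define g where "g n x = ennreal (norm (v (r n + N) x) powr q / (1 + (norm x)\<^sup>2))" for n x
  have gm [measurable]: "g n \<in> borel_measurable borel" for n unfolding g_def by measurable
  have AElim: "AE x in lborel. ennreal (norm (u x) powr q / (1 + (norm x)\<^sup>2)) = liminf (\<lambda>n. g n x)"
    using r
  proof eventually_elim
    case (elim x)
    have "(\<lambda>n. sqrt (f (r n) x)) \<longlonglongrightarrow> sqrt 0" by (intro tendsto_intros elim)
    then have "(\<lambda>n. norm (v (r n + N) x - u x)) \<longlonglongrightarrow> 0" by (simp add: f_def)
    then have "(\<lambda>n. v (r n + N) x - u x) \<longlonglongrightarrow> 0" by (rule tendsto_norm_zero_cancel)
    then have "(\<lambda>n. v (r n + N) x) \<longlonglongrightarrow> u x" by (rule LIM_zero_cancel)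
    then have "(\<lambda>n. norm (v (r n + N) x) powr q / (1 + (norm x)\<^sup>2)) \<longlonglongrightarrow> norm (u x) powr q / (1 + (norm x)\<^sup>2)"
      using q by (intro tendsto_intros tendsto_powr2) (auto simp: add_nonneg_eq_0_iff)
    then have "(\<lambda>n. g n x) \<longlonglongrightarrow> ennreal (norm (u x) powr q / (1 + (norm x)\<^sup>2))"
      unfolding g_def by (rule tendsto_ennrealI)
    from lim_imp_Liminf[OF _ this] show ?case by simp
  qed
  have "weighted_powr u q = (\<integral>\<^sup>+x. liminf (\<lambda>n. g n x) \<partial>lborel)"
    unfolding weighted_powr_def by (rule nn_integral_cong_AE[OF AElim])
  also have "\<dots> \<le> liminf (\<lambda>n. \<integral>\<^sup>+x. g n x \<partial>lborel)"
    by (rule nn_integral_liminf) simp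
  also have "\<dots> \<le> liminf (\<lambda>n. ennreal K)"
  proof (rule Liminf_mono, rule always_eventually, rule allI)
    fix n
    show "(\<integral>\<^sup>+x. g n x \<partial>lborel) \<le> ennreal K"
      using N(1)[of "r n + N"] by (simp add: g_def weighted_powr_def)
  qed
  also have "\<dots> = ennreal K" by (simp add: Liminf_const)
  finally show ?thesis .
qed

theorem corollary3p5:
  fixes A :: "real^2 \<Rightarrow> real^2" and B :: "real^2 \<Rightarrow> real" and q :: real
  assumes "A \<in> L2_loc"
    and "is_curl B A"
    and "flux_condition B"
    and "2 \<le> q"
  shows "\<exists>S>0.
      (\<forall>u \<in> test_functions. magnetic_sobolev_inequality A q S u (grad u)) \<and>
      (essentially_bounded A \<longrightarrow>
        (\<forall>u G. H1_with_gradient u G \<longrightarrow> magnetic_sobolev_inequality A q S u G))"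
proof -
  have Am: "A \<in> borel_measurable lebesgue" using assms(1) by (simp add: L2_loc_def)
  obtain C where C: "0 < C" and core: "\<And>u e. u \<in> C1_compact \<Longrightarrow> 0 < e \<Longrightarrow>
    magnetic_energy A u (grad u) \<le> ennreal e \<Longrightarrow>
    weighted_powr u q \<le> ennreal (C * e powr (q / 2))"
    by (rule magnetic_energy_bound[OF assms]) (rule that)
  define S where "S = C powr (- (2 / q))"
  have test: "magnetic_sobolev_inequality A q S u (grad u)" if "u \<in> test_functions" for u
  proof -
    have u: "u \<in> C1_compact" by (rule test_function_C1_compact[OF that])
    have m: "u \<in> borel_measurable lebesgue" "grad u \<in> borel_measurable lebesgue"
      using borel_measurable_C1(1,3)[OF u] by (auto intro: measurable_completion)
    show ?thesis unfolding S_def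
      by (rule magnetic_sobolev_from_energy_bound[OF assms(4) C borel_measurable_magnetic_gradient[OF Am m] m(1) magnetic_energy_finite[OF assms(1) u]])
         (intro core[OF u] less_imp_le)
  qed
  have h1: "magnetic_sobolev_inequality A q S u G" if bd: "essentially_bounded A" and H: "H1_with_gradient u G" for u G
  proof -
    have um: "u \<in> borel_measurable lebesgue" and Gm: "G \<in> borel_measurable lebesgue"
      and u2: "integrable lebesgue (\<lambda>x. (norm (u x))\<^sup>2)" and G2: "integrable lebesgue (\<lambda>x. (norm (G x))\<^sup>2)"
      using H by (auto simp: H1_with_gradient_def L2_def)
    obtain M0 where "AE x in lebesgue. norm (A x) \<le> M0" using bd by (auto simp: essentially_bounded_def)
    then have M0: "AE x in lborel. norm (A x) \<le> M0" by (simp add: AE_completion_iff)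
    define M where "M = max 0 M0"
    have M: "0 \<le> M" "AE x in lborel. norm (A x) \<le> M" using M0 by (auto simp: M_def)
    obtain u' where u'm [measurable]: "u' \<in> borel_measurable borel" and uu': "AE x in lborel. u x = u' x"
      by (rule borel_representative[OF um])
    obtain G' where G'm [measurable]: "G' \<in> borel_measurable borel" and GG': "AE x in lborel. G x = G' x"
      by (rule borel_representative[OF Gm])
    have fin: "(\<integral>\<^sup>+x. ennreal ((norm (f' x))\<^sup>2) \<partial>lborel) < \<infinity>"
      if "integrable lebesgue (\<lambda>x. (norm (f x))\<^sup>2)" "AE x in lborel. f x = f' x" for f f' :: "real^2 \<Rightarrow> 'z::real_normed_vector"
    proof -
      have "(\<integral>\<^sup>+x. ennreal ((norm (f' x))\<^sup>2) \<partial>lborel) = (\<integral>\<^sup>+x. ennreal ((norm (f x))\<^sup>2) \<partial>lborel)"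
        by (rule nn_integral_cong_AE) (use that(2) in \<open>eventually_elim, simp\<close>)
      also have "\<dots> < \<infinity>" using that(1) by (simp add: integrable_iff_bounded nn_integral_completion)
      finally show ?thesis .
    qed
    have u'2: "(\<integral>\<^sup>+x. ennreal ((norm (u' x))\<^sup>2) \<partial>lborel) < \<infinity>" by (rule fin[OF u2 uu'])
    have G'2: "(\<integral>\<^sup>+x. ennreal ((norm (G' x))\<^sup>2) \<partial>lborel) < \<infinity>" by (rule fin[OF G2 GG'])
    define E where "E = magnetic_energy A u G"
    have Efin: "E < \<infinity>"
    proof -
      have "E \<le> (\<integral>\<^sup>+x. 2 * ennreal ((norm (G' x))\<^sup>2) + ennreal (2 * M\<^sup>2) * ennreal ((norm (u' x))\<^sup>2) \<partial>lborel)"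
        unfolding E_def
      proof (rule nn_integral_mono_AE)
        show "AE x in lborel. ennreal ((norm (magnetic_gradient A u G x))\<^sup>2) \<le> 2 * ennreal ((norm (G' x))\<^sup>2) + ennreal (2 * M\<^sup>2) * ennreal ((norm (u' x))\<^sup>2)"
          using uu' GG' M(2)
        proof eventually_elim
          case (elim x)
          have "norm (magnetic_gradient A u G x) \<le> norm (G' x) + M * norm (u' x)"
            using norm_magnetic_gradient_le[of A u G x] elim by (smt (verit) mult_right_mono norm_ge_zero)
          then have "(norm (magnetic_gradient A u G x))\<^sup>2 \<le> (norm (G' x) + M * norm (u' x))\<^sup>2" by (intro power_mono) auto
          also have "\<dots> \<le> 2 * (norm (G' x))\<^sup>2 + 2 * (M * norm (u' x))\<^sup>2"
            using sum_squares_bound[of "norm (G' x)" "M * norm (u' x)"] by (simp add: power2_sum)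
          also have "\<dots> = 2 * (norm (G' x))\<^sup>2 + 2 * M\<^sup>2 * (norm (u' x))\<^sup>2" by (simp add: power_mult_distrib)
          finally have "ennreal ((norm (magnetic_gradient A u G x))\<^sup>2) \<le> ennreal (2 * (norm (G' x))\<^sup>2 + 2 * M\<^sup>2 * (norm (u' x))\<^sup>2)"
            by (rule ennreal_leI)
          then show ?case by (simp add: ennreal_mult')
        qed
      qed
      also have "\<dots> = 2 * (\<integral>\<^sup>+x. ennreal ((norm (G' x))\<^sup>2) \<partial>lborel) + ennreal (2 * M\<^sup>2) * (\<integral>\<^sup>+x. ennreal ((norm (u' x))\<^sup>2) \<partial>lborel)"
        by (simp add: nn_integral_add nn_integral_cmult)
      also have "\<dots> < \<infinity>" using u'2 G'2 by (auto simp: ennreal_mult_less_top)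
      finally show ?thesis .
    qed
    obtain v where v: "\<And>n. v n \<in> C1_compact" and v1: "L2_null (\<lambda>n x. norm (v n x - u' x))"
      and v2: "L2_null (\<lambda>n x. norm (grad (v n) x - G' x))"
      by (rule H1_approximation[OF H u'm G'm uu' GG' u'2 G'2]) (rule that)
    note vm [measurable] = borel_measurable_C1(1,3)[OF v]
    define h where "h n x = norm (grad (v n) x - G' x) + M * norm (v n x - u' x)" for n x
    have hm [measurable]: "h n \<in> borel_measurable borel" for n unfolding h_def by measurable
    have hnull: "L2_null h"
    proof -
      have "L2_null (\<lambda>n x. M * norm (v n x - u' x))"
        by (intro L2_null_cmult v1) auto
      then show ?thesis unfolding h_def by (intro L2_null_add v2) auto
    qed
    show ?thesis unfolding S_def
    proof (rule magnetic_sobolev_from_energy_bound[OF assms(4) C borel_measurable_magnetic_gradient[OF Am um Gm] um])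
      show "magnetic_energy A u G < \<infinity>" using Efin by (simp add: E_def)
      fix e :: real
      assume e: "0 < e" and "magnetic_energy A u G < ennreal e"
      then have Ee: "E < ennreal e" by (simp add: E_def)
      have ev: "\<forall>\<^sub>F n in sequentially. magnetic_energy A (v n) (grad (v n)) \<le> ennreal e"
      proof -
        obtain E0 where E0: "E = ennreal E0" "0 \<le> E0" using Efin by (cases E) auto
        have E0e: "E0 < e" using Ee E0 by (simp add: ennreal_less_iff)
        \<comment> \<open>Small enough for \<open>(1 + \<eta>) E0 < e\<close>, which leaves room for the error of the approximation in \<open>(a + b)\<^sup>2 \<le> (1 + \<eta>) a\<^sup>2 + (1 + 1 / \<eta>) b\<^sup>2\<close>.\<close>
        define \<eta> where "\<eta> = (e - E0) / (2 * (E0 + 1))"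
        have \<eta>: "0 < \<eta>" using E0e E0 by (simp add: \<eta>_def)
        have "\<eta> * E0 \<le> \<eta> * (E0 + 1)" using \<eta> by (intro mult_left_mono) auto
        also have "\<dots> = (e - E0) / 2" using E0 by (simp add: \<eta>_def field_simps)
        finally have \<eta>e: "(1 + \<eta>) * E0 < e" using E0e by (simp add: distrib_right)
        have le: "magnetic_energy A (v n) (grad (v n))
          \<le> ennreal (1 + \<eta>) * E + ennreal (1 + 1 / \<eta>) * (\<integral>\<^sup>+x. ennreal ((h n x)\<^sup>2) \<partial>lborel)" for n
        proof -
          have mg [measurable]: "magnetic_gradient A u G \<in> borel_measurable lebesgue"
            by (rule borel_measurable_magnetic_gradient[OF Am um Gm])
          have hl [measurable]: "h n \<in> borel_measurable lebesgue" using hm[of n] by (auto intro: measurable_completion)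
          have "magnetic_energy A (v n) (grad (v n))
            = (\<integral>\<^sup>+x. ennreal ((norm (magnetic_gradient A (v n) (grad (v n)) x))\<^sup>2) \<partial>lebesgue)" by (simp add: nn_integral_completion)
          also have "\<dots> \<le> (\<integral>\<^sup>+x. ennreal (1 + \<eta>) * ennreal ((norm (magnetic_gradient A u G x))\<^sup>2) + ennreal (1 + 1 / \<eta>) * ennreal ((h n x)\<^sup>2) \<partial>lebesgue)"
          proof (rule nn_integral_mono_AE)
            show "AE x in lebesgue. ennreal ((norm (magnetic_gradient A (v n) (grad (v n)) x))\<^sup>2)
              \<le> ennreal (1 + \<eta>) * ennreal ((norm (magnetic_gradient A u G x))\<^sup>2) + ennreal (1 + 1 / \<eta>) * ennreal ((h n x)\<^sup>2)"
              using AE_completion[OF uu'] AE_completion[OF GG'] AE_completion[OF M(2)]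
            proof eventually_elim
              case (elim x)
              define a where "a = norm (magnetic_gradient A u G x)"
              define b where "b = h n x"
              have "magnetic_gradient A (v n) (grad (v n)) x = magnetic_gradient A u G x
                  + magnetic_gradient A (\<lambda>x. v n x - u x) (\<lambda>x. grad (v n) x - G x) x"
                by (simp add: magnetic_gradient_def vec_eq_iff algebra_simps)
              then have "norm (magnetic_gradient A (v n) (grad (v n)) x)
                \<le> a + norm (magnetic_gradient A (\<lambda>x. v n x - u x) (\<lambda>x. grad (v n) x - G x) x)"
                unfolding a_def by (simp only: norm_triangle_ineq)
              also have "norm (magnetic_gradient A (\<lambda>x. v n x - u x) (\<lambda>x. grad (v n) x - G x) x)
                \<le> norm (grad (v n) x - G x) + norm (A x) * norm (v n x - u x)" by (rule norm_magnetic_gradient_le)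
              also have "\<dots> \<le> b" unfolding b_def h_def using elim by (auto intro: mult_right_mono)
              finally have "(norm (magnetic_gradient A (v n) (grad (v n)) x))\<^sup>2 \<le> (a + b)\<^sup>2" by (intro power_mono) auto
              also have "\<dots> \<le> (1 + \<eta>) * a\<^sup>2 + (1 + 1 / \<eta>) * b\<^sup>2"
              proof -
                have "2 * (sqrt \<eta> * a) * (b / sqrt \<eta>) \<le> (sqrt \<eta> * a)\<^sup>2 + (b / sqrt \<eta>)\<^sup>2" by (rule sum_squares_bound)
                then have "2 * a * b \<le> \<eta> * a\<^sup>2 + b\<^sup>2 / \<eta>" using \<eta> by (simp add: power_mult_distrib power_divide)
                then show ?thesis by (simp add: power2_sum distrib_right)
              qed
              finally have "ennreal ((norm (magnetic_gradient A (v n) (grad (v n)) x))\<^sup>2) \<le> ennreal ((1 + \<eta>) * a\<^sup>2 + (1 + 1 / \<eta>) * b\<^sup>2)"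
                by (rule ennreal_leI)
              also have "\<dots> = ennreal (1 + \<eta>) * ennreal (a\<^sup>2) + ennreal (1 + 1 / \<eta>) * ennreal (b\<^sup>2)"
                using \<eta> by (subst ennreal_plus) (auto simp: ennreal_mult' simp del: ennreal_plus)
              finally show ?case unfolding a_def b_def .
            qed
          qed
          also have "\<dots> = ennreal (1 + \<eta>) * (\<integral>\<^sup>+x. ennreal ((norm (magnetic_gradient A u G x))\<^sup>2) \<partial>lebesgue)
              + ennreal (1 + 1 / \<eta>) * (\<integral>\<^sup>+x. ennreal ((h n x)\<^sup>2) \<partial>lebesgue)"
            by (subst nn_integral_add, measurable, subst nn_integral_cmult, measurable, subst nn_integral_cmult, measurable)
          finally show ?thesis by (simp add: E_def nn_integral_completion)
        qed
        have "(\<lambda>n. ennreal (1 + \<eta>) * E + ennreal (1 + 1 / \<eta>) * (\<integral>\<^sup>+x. ennreal ((h n x)\<^sup>2) \<partial>lborel))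
          \<longlonglongrightarrow> ennreal (1 + \<eta>) * E + ennreal (1 + 1 / \<eta>) * 0"
          using hnull unfolding L2_null_def by (intro tendsto_add tendsto_const ennreal_tendsto_cmult) auto
        moreover have "ennreal (1 + \<eta>) * E + ennreal (1 + 1 / \<eta>) * 0 < ennreal e"
        proof -
          have "ennreal (1 + \<eta>) * E = ennreal ((1 + \<eta>) * E0)" unfolding E0(1) using \<eta> by (simp only: ennreal_mult')
          then show ?thesis using \<eta>e \<eta> E0(2) by (simp add: ennreal_less_iff del: ennreal_plus)
        qed
        ultimately have "\<forall>\<^sub>F n in sequentially. ennreal (1 + \<eta>) * E + ennreal (1 + 1 / \<eta>) * (\<integral>\<^sup>+x. ennreal ((h n x)\<^sup>2) \<partial>lborel) < ennreal e"
          by (rule order_tendstoD)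
        then show ?thesis by eventually_elim (use le in \<open>meson less_imp_le order_trans\<close>)
      qed
      then have "\<forall>\<^sub>F n in sequentially. weighted_powr (v n) q \<le> ennreal (C * e powr (q / 2))"
        by eventually_elim (intro core v e)
      then have "weighted_powr u' q \<le> ennreal (C * e powr (q / 2))"
        using assms(4) by (intro weighted_powr_fatou[OF vm(1) u'm v1]) auto
      also have "weighted_powr u' q = weighted_powr u q"
        unfolding weighted_powr_def
        by (rule nn_integral_cong_AE) (use uu' in \<open>eventually_elim, simp\<close>)
      finally show "weighted_powr u q \<le> ennreal (C * e powr (q / 2))" .
    qed
  qed
  have "0 < S" using C by (simp add: S_def)
  with test h1 show ?thesis by blast
qed

end
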